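(* Let $n\ge 2$ and let $D_n=\langle a,b\mid a^n=b^2=1,\ bab=a^{-1}\rangle$ be the dihedral group of order $2n$. Let $\mathcal{M}=CM(D_n,X,p)$ be a reflexible regular Cayley map for $D_n$ of valency $d=|X|$. If $d=2$, then $\mathcal{M}$ is isomorphic to $CM(D_n,\{b,ab\},(b,ab))$. If $d=3$, then $\mathcal{M}$ is isomorphic to $CM(D_2,\{b,ab,a\},(b,ab,a))$, to $CM(D_3,\{b,ab,a^2b\},(b,ab,a^2b))$, or to $CM(D_4,\{b,a,a^{-1}\},(b,a,a^{-1}))$. If $d\ge 4$, then $\mathcal{M}$ is isomorphic to one of the following maps (in each case $X_i$ is the set of entries of the cycle $p_i$): (1) $\mathcal{M}_1=CM(D_n,X_1,p_1)$ with $p_1=(b,\ ab,\ a^{\ell+1}b,\ a^{\ell^2+\ell+1}b,\ \ldots,\ a^{\ell^{d-2}+\ell^{d-3}+\cdots+1}b)$ (i.e. the $k$-th entry, $k=0,\dots,d-1$, is $a^{1+\ell+\cdots+\ell^{k-1}}b$), for some integer $\ell$ with $\ell^2\equiv 1\pmod n$, where $d$ is the smallest positive integer with $\ell^{d-1}+\ell^{d-2}+\cdots+1\equiv 0\pmod n$; (2) $n$ is even and $\mathcal{M}_2=CM(D_n,X_2,p_2)$ with $p_2=(b,a,a^2b,a^3,a^4b,\ldots,a^{n-2}b,a^{n-1})$ (the $k$-th entry, $k=0,\dots,n-1$, is $a^kb$ for $k$ even and $a^k$ for $k$ odd); (3) $n=2m$ is a multiple of $8$ and $\mathcal{M}_3=CM(D_n,X_3,p_3)$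 with $p_3=(b,a,a^{m+2}b,a^3,a^4b,\ldots,a^{m-2}b,a^{n-1})$ (the $k$-th entry, $k=0,\dots,n-1$, is $a^{k+(k/2)m}b$ for $k$ even and $a^k$ for $k$ odd); (4) $n=3k$ for some positive integer $k$ and $\mathcal{M}_4=CM(D_n,X_4,p_4)$ with $p_4=(a^{-1},a,b,a^2b)$; (5) $n=2m=8k+4$ for some positive integer $k$ and $\mathcal{M}_5=CM(D_n,X_5,p_5)$ with $p_5=(a^{-1},a,b,a^{m+1},a^{m-1},a^{m+2}b)$; (6) $n=2m=4k+2$ for some positive integer $k$ and $\mathcal{M}_6=CM(D_n,X_6,p_6)$ with $p_6=(b,a^{m-2}b,a,a^{-2}b,a^mb,a^{-1})$. Furthermore, all the Cayley maps $\mathcal{M}_1,\dots,\mathcal{M}_6$ listed above (under the stated conditions) are reflexible regular Cayley maps.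
   Context: For a finite group $G$ and a generating set $X\subseteq G\setminus\{1_G\}$ with $X=X^{-1}$, the Cayley graph $C(G,X)$ has vertex set $G$ with $g,h$ adjacent iff $g^{-1}h\in X$. For a cyclic permutation $p$ of $X$, the Cayley map $CM(G,X,p)$ is the embedding of $C(G,X)$ into an orientable surface in which the cyclic order of the edges $\{g,gx\}$, $x\in X$, around every vertex $g$ is given by $p$. A map automorphism is a graph automorphism extending to a homeomorphism of the surface. The map is regular if its group of orientation-preserving automorphisms acts transitively (hence regularly) on arcs (incident vertex-edge pairs), and reflexible if moreover it admits an orientation-reversing automorphism. The valency of $CM(G,X,p)$ is $|X|$. Isomorphism means isomorphism of maps. *)

theory Defs
  imports "HOL-Algebra.Generated_Groups" "HOL-Combinatorics.Cycles"
    "HOL-Combinatorics.Orbits" "HOL-Number_Theory.Cong"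
begin

text \<open>
  A cellular embedding of a simple graph in an oriented surface is represented by its rotation
  system: \<open>rot M v w\<close> is the neighbour of \<open>v\<close> such that, in the cyclic order around \<open>v\<close> induced by
  the orientation, the edge \<open>{v, rot M v w}\<close> is the successor of the edge \<open>{v, w}\<close>.
\<close>

record 'v omap =
  verts :: "'v set"
  adj :: "'v \<Rightarrow> 'v \<Rightarrow> bool"
  rot :: "'v \<Rightarrow> 'v \<Rightarrow> 'v"

definition arcs :: "'v omap \<Rightarrow> ('v \<times> 'v set) set" where
  "arcs M = {(v, {v, w}) | v w. v \<in> verts M \<and> w \<in> verts M \<and> adj M v w}"

definition graph_iso :: "'v omap \<Rightarrow> 'w omap \<Rightarrow> ('v \<Rightarrow> 'w) \<Rightarrow> bool" where
  "graph_iso M N f \<longleftrightarrow> bij_betw f (verts M) (verts N) \<and>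
     (\<forall>v \<in> verts M. \<forall>w \<in> verts M. adj M v w \<longleftrightarrow> adj N (f v) (f w))"

text \<open>
  A graph isomorphism extends to an orientation-preserving (orientation-reversing) homeomorphism
  of the surfaces iff it carries the cyclic order around each vertex to the cyclic order
  (to the inverse of the cyclic order) around its image.
\<close>

definition pres_iso :: "'v omap \<Rightarrow> 'w omap \<Rightarrow> ('v \<Rightarrow> 'w) \<Rightarrow> bool" where
  "pres_iso M N f \<longleftrightarrow> graph_iso M N f \<and>
     (\<forall>v \<in> verts M. \<forall>w \<in> verts M. adj M v w \<longrightarrow> f (rot M v w) = rot N (f v) (f w))"

definition rev_iso :: "'v omap \<Rightarrow> 'w omap \<Rightarrow> ('v \<Rightarrow> 'w) \<Rightarrow> bool" where
  "rev_iso M N f \<longleftrightarrow> graph_iso M N f \<and>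
     (\<forall>v \<in> verts M. \<forall>w \<in> verts M. adj M v w \<longrightarrow> rot N (f v) (f (rot M v w)) = f w)"

definition map_isomorphic :: "'v omap \<Rightarrow> 'w omap \<Rightarrow> bool" (infix \<open>\<simeq>\<^sub>m\<close> 50) where
  "M \<simeq>\<^sub>m N \<longleftrightarrow> (\<exists>f. pres_iso M N f \<or> rev_iso M N f)"

definition regular_map :: "'v omap \<Rightarrow> bool" where
  "regular_map M \<longleftrightarrow> (\<forall>(v, e) \<in> arcs M. \<forall>(v', e') \<in> arcs M.
     \<exists>f. pres_iso M M f \<and> f v = v' \<and> f ` e = e')"

definition reflexible_regular_map :: "'v omap \<Rightarrow> bool" where
  "reflexible_regular_map M \<longleftrightarrow> regular_map M \<and> (\<exists>f. rev_iso M M f)"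

definition CM :: "('g, 'r) monoid_scheme \<Rightarrow> 'g set \<Rightarrow> ('g \<Rightarrow> 'g) \<Rightarrow> 'g omap" where
  "CM G X p = \<lparr>
     verts = carrier G,
     adj = (\<lambda>g h. g \<in> carrier G \<and> h \<in> carrier G \<and> inv\<^bsub>G\<^esub> g \<otimes>\<^bsub>G\<^esub> h \<in> X),
     rot = (\<lambda>g h. g \<otimes>\<^bsub>G\<^esub> p (inv\<^bsub>G\<^esub> g \<otimes>\<^bsub>G\<^esub> h)) \<rparr>"

definition cayley_map_data :: "('g, 'r) monoid_scheme \<Rightarrow> 'g set \<Rightarrow> ('g \<Rightarrow> 'g) \<Rightarrow> bool" where
  "cayley_map_data G X p \<longleftrightarrow> group G \<and> finite (carrier G) \<and>
     X \<subseteq> carrier G - {\<one>\<^bsub>G\<^esub>} \<and> (\<lambda>x. inv\<^bsub>G\<^esub> x) ` X = X \<and> generate G X = carrier G \<and>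
     p permutes X \<and> cyclic_on p X"

definition reflexible_regular_CM :: "('g, 'r) monoid_scheme \<Rightarrow> 'g set \<Rightarrow> ('g \<Rightarrow> 'g) \<Rightarrow> bool" where
  "reflexible_regular_CM G X p \<longleftrightarrow> cayley_map_data G X p \<and> reflexible_regular_map (CM G X p)"

text \<open>
  The maps of the classification are given by a cycle \<open>p = (x\<^sub>0, \<dots>, x\<^sub>d\<^sub>-\<^sub>1)\<close> written as a list, with
  \<open>X\<close> its set of entries. Since \<^const>\<open>cycle_of_list\<close> is a cyclic permutation only for lists without
  repetitions, this requirement is part of the claim that such a list defines a Cayley map.
\<close>

definition CM_cycle :: "('g, 'r) monoid_scheme \<Rightarrow> 'g list \<Rightarrow> 'g omap" where
  "CM_cycle G xs = CM G (set xs) (cycle_of_list xs)"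

definition reflexible_regular_CM_cycle :: "('g, 'r) monoid_scheme \<Rightarrow> 'g list \<Rightarrow> bool" where
  "reflexible_regular_CM_cycle G xs \<longleftrightarrow>
     cycle xs \<and> reflexible_regular_CM G (set xs) (cycle_of_list xs)"

text \<open>
  The dihedral group of order \<open>2n\<close>; the pair \<open>(i, e)\<close> stands for \<open>a\<^sup>i\<close> if \<open>e\<close> is false and for
  \<open>a\<^sup>ib\<close> if \<open>e\<close> is true.
\<close>

definition dihedral :: "nat \<Rightarrow> (int \<times> bool) monoid" where
  "dihedral n = \<lparr>
     carrier = {0..<int n} \<times> UNIV,
     monoid.mult = (\<lambda>(i, e) (j, f). ((if e then i - j else i + j) mod int n, e \<noteq> f)),
     one = (0, False) \<rparr>"

definition dih_a :: "nat \<Rightarrow> int \<times> bool" where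
  "dih_a n = (1 mod int n, False)"

definition dih_b :: "int \<times> bool" where
  "dih_b = (0, True)"

definition apow :: "nat \<Rightarrow> int \<Rightarrow> int \<times> bool" where
  "apow n k = dih_a n [^]\<^bsub>dihedral n\<^esub> k"

definition apow_b :: "nat \<Rightarrow> int \<Rightarrow> int \<times> bool" where
  "apow_b n k = dih_a n [^]\<^bsub>dihedral n\<^esub> k \<otimes>\<^bsub>dihedral n\<^esub> dih_b"

lemma group_dihedral:
  assumes "n > 0" shows "group (dihedral n)"
proof (rule groupI)
  fix x y assume "x \<in> carrier (dihedral n)" "y \<in> carrier (dihedral n)"
  then show "x \<otimes>\<^bsub>dihedral n\<^esub> y \<in> carrier (dihedral n)"
    using assms by (auto simp: dihedral_def split: prod.splits)
next
  show "\<one>\<^bsub>dihedral n\<^esub> \<in> carrier (dihedral n)"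
    using assms by (auto simp: dihedral_def)
next
  fix x y z
  show "x \<otimes>\<^bsub>dihedral n\<^esub> y \<otimes>\<^bsub>dihedral n\<^esub> z = x \<otimes>\<^bsub>dihedral n\<^esub> (y \<otimes>\<^bsub>dihedral n\<^esub> z)"
    by (auto simp: dihedral_def mod_simps algebra_simps split: prod.splits)
next
  fix x assume x: "x \<in> carrier (dihedral n)"
  then show "\<one>\<^bsub>dihedral n\<^esub> \<otimes>\<^bsub>dihedral n\<^esub> x = x"
    by (auto simp: dihedral_def)
  obtain i e where [simp]: "x = (i, e)" by fastforce
  have "(if e then (i, e) else (- i mod int n, False)) \<otimes>\<^bsub>dihedral n\<^esub> x = \<one>\<^bsub>dihedral n\<^esub>"
    by (auto simp: dihedral_def mod_simps)
  moreover have "(if e then (i, e) else (- i mod int n, False)) \<in> carrier (dihedral n)"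
    using x assms by (auto simp: dihedral_def)
  ultimately show "\<exists>y \<in> carrier (dihedral n). y \<otimes>\<^bsub>dihedral n\<^esub> x = \<one>\<^bsub>dihedral n\<^esub>"
    by blast
qed

lemma order_dihedral: "order (dihedral n) = 2 * n"
  by (simp add: order_def dihedral_def card_cartesian_product)

lemma dih_gens_closed:
  assumes "n > 0" shows "dih_a n \<in> carrier (dihedral n)" "dih_b \<in> carrier (dihedral n)"
  using assms by (auto simp: dihedral_def dih_a_def dih_b_def)

lemma dih_a_nat_pow: "dih_a n [^]\<^bsub>dihedral n\<^esub> (k::nat) = (int k mod int n, False)" if "n > 0"
proof (induction k)
  case 0
  show ?case by (simp add: nat_pow_def dihedral_def)
next
  case (Suc k)
  then show ?case
    by (simp add: nat_pow_def dihedral_def dih_a_def mod_simps algebra_simps)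
qed

lemma apow_eq: "apow n k = (k mod int n, False)" if n: "n > 0"
proof -
  interpret group "dihedral n" using n by (rule group_dihedral)
  show ?thesis
  proof (cases "k \<ge> 0")
    case True
    then obtain m where "k = int m" by (metis nat_eq_iff)
    then show ?thesis using dih_a_nat_pow[OF n] by (simp add: apow_def int_pow_int)
  next
    case False
    then obtain m where m: "k = - int m" by (metis int_cases2 of_nat_0_le_iff)
    have "inv\<^bsub>dihedral n\<^esub> (int m mod int n, False) = (k mod int n, False)"
      using n by (intro inv_equality) (auto simp: dihedral_def m mod_simps)
    then show ?thesis
      using dih_a_nat_pow[OF n] dih_gens_closed[OF n] m by (simp add: apow_def int_pow_neg int_pow_int)
  qed
qed

lemma apow_b_eq: "apow_b n k = (k mod int n, True)" if "n > 0"
  using apow_eq[OF that, of k] unfolding apow_b_def apow_def by (simp add: dihedral_def dih_b_def)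

lemma dihedral_relations:
  assumes "n > 0"
  shows "dih_a n [^]\<^bsub>dihedral n\<^esub> n = \<one>\<^bsub>dihedral n\<^esub>"
    and "dih_b \<otimes>\<^bsub>dihedral n\<^esub> dih_b = \<one>\<^bsub>dihedral n\<^esub>"
    and "dih_b \<otimes>\<^bsub>dihedral n\<^esub> dih_a n \<otimes>\<^bsub>dihedral n\<^esub> dih_b = inv\<^bsub>dihedral n\<^esub> (dih_a n)"
proof -
  interpret group "dihedral n" using assms by (rule group_dihedral)
  show "dih_a n [^]\<^bsub>dihedral n\<^esub> n = \<one>\<^bsub>dihedral n\<^esub>"
    using assms by (simp add: dih_a_nat_pow) (simp add: dihedral_def)
  show "dih_b \<otimes>\<^bsub>dihedral n\<^esub> dih_b = \<one>\<^bsub>dihedral n\<^esub>"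
    by (simp add: dihedral_def dih_b_def)
  show "dih_b \<otimes>\<^bsub>dihedral n\<^esub> dih_a n \<otimes>\<^bsub>dihedral n\<^esub> dih_b = inv\<^bsub>dihedral n\<^esub> (dih_a n)"
    using assms
    by (intro inv_equality[symmetric]) (auto simp: dihedral_def dih_a_def dih_b_def mod_simps)
qed

lemma generate_dihedral:
  assumes n: "n > 0"
  shows "generate (dihedral n) {dih_a n, dih_b} = carrier (dihedral n)"
proof -
  interpret group "dihedral n" using n by (rule group_dihedral)
  have sub: "{dih_a n, dih_b} \<subseteq> carrier (dihedral n)" using dih_gens_closed[OF n] by auto
  have sg: "subgroup (generate (dihedral n) {dih_a n, dih_b}) (dihedral n)"
    using sub by (rule generate_is_subgroup)
  have r: "apow n k \<in> generate (dihedral n) {dih_a n, dih_b}" for k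
    unfolding apow_def by (rule subgroup_int_pow_closed[OF sg]) (auto intro: generate.incl)
  have s: "apow_b n k \<in> generate (dihedral n) {dih_a n, dih_b}" for k
    using r[of k] unfolding apow_b_def apow_def by (auto intro: generate.eng generate.incl)
  have "carrier (dihedral n) \<subseteq> generate (dihedral n) {dih_a n, dih_b}"
  proof
    fix x assume x: "x \<in> carrier (dihedral n)"
    obtain i e where ie: "x = (i, e)" by fastforce
    then show "x \<in> generate (dihedral n) {dih_a n, dih_b}"
      using x r[of i] s[of i] n by (cases e) (auto simp: apow_eq apow_b_eq dihedral_def)
  qed
  then show ?thesis using generate_incl[OF sub] by blast
qed

definition least_geom_sum_zero :: "nat \<Rightarrow> int \<Rightarrow> nat \<Rightarrow> bool" where
  "least_geom_sum_zero n l d \<longleftrightarrow> d > 0 \<and> [(\<Sum>i<d. l ^ i) = 0] (mod int n) \<and>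
     (\<forall>j. 0 < j \<and> j < d \<longrightarrow> \<not> [(\<Sum>i<j. l ^ i) = 0] (mod int n))"

definition cyc1 :: "nat \<Rightarrow> int \<Rightarrow> nat \<Rightarrow> (int \<times> bool) list" where
  "cyc1 n l d = map (\<lambda>k. apow_b n (\<Sum>i<k. l ^ i)) [0..<d]"

definition cyc2 :: "nat \<Rightarrow> (int \<times> bool) list" where
  "cyc2 n = map (\<lambda>k. if even k then apow_b n (int k) else apow n (int k)) [0..<n]"

definition cyc3 :: "nat \<Rightarrow> nat \<Rightarrow> (int \<times> bool) list" where
  "cyc3 n m = map (\<lambda>k. if even k then apow_b n (int (k + (k div 2) * m)) else apow n (int k)) [0..<n]"

definition cyc4 :: "nat \<Rightarrow> (int \<times> bool) list" where
  "cyc4 n = [apow n (- 1), apow n 1, apow_b n 0, apow_b n 2]"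

definition cyc5 :: "nat \<Rightarrow> nat \<Rightarrow> (int \<times> bool) list" where
  "cyc5 n m = [apow n (- 1), apow n 1, apow_b n 0,
     apow n (int m + 1), apow n (int m - 1), apow_b n (int m + 2)]"

definition cyc6 :: "nat \<Rightarrow> nat \<Rightarrow> (int \<times> bool) list" where
  "cyc6 n m = [apow_b n 0, apow_b n (int m - 2), apow n 1, apow_b n (- 2), apow_b n (int m), apow n (- 1)]"

end

theory Submission
  imports Defs
begin

text \<open>
  Number the entries of the cycle \<open>p\<close> by integers modulo \<open>d\<close>. An automorphism \<open>F\<close> of the map acts at
  each vertex \<open>g\<close> by \<open>F(g x\<^sub>i) = F(g) x\<^sub>\<plusminus>\<^sub>i\<^sub>+\<^sub>P\<^sub>(\<^sub>g\<^sub>)\<close>, with sign \<open>+\<close> or \<open>-\<close> according to its effect on the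
  orientation, and is determined by the image of one arc.

  The core is the largest subgroup of \<open>\<langle>a\<rangle>\<close> that is normal in the group of orientation-preserving
  automorphisms; the rotation about \<open>1\<close> by one place acts on it by a multiplier \<open>\<omega>\<close>. If \<open>X\<close>
  consists of reflections, all differences of exponents lie in the core, and the mirror symmetry
  gives \<open>\<omega>\<^sup>2 = 1\<close>; this is the first family. Otherwise, factoring out the core leaves a map in
  which two different places where a reflection is followed by a rotation would produce a
  translation of \<open>X\<close>; hence the indices of the reflections form one of four periodic patterns (one
  in two, one in three, two in three, two in four), and these lift to the original map. For each
  pattern the mirror symmetry determines \<open>X\<close> up to an affine automorphism of the dihedral group.
  Conversely, the listed maps have an explicit rotation about \<open>1\<close> and a group automorphism that
  reverses the cycle.
\<close>

section \<open>Integers modulo \<open>m\<close>\<close>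

lemma residue_induct [consumes 1, case_names base step cong]:
  fixes m :: int
  assumes "0 < m" and "Q a" and "\<And>j. Q j \<Longrightarrow> Q (j + 1)" and "\<And>i j. m dvd i - j \<Longrightarrow> Q i \<Longrightarrow> Q j"
  shows "Q j"
proof -
  have "Q (a + int k)" for k
  proof (induction k)
    case (Suc k)
    then show ?case using assms(3)[of "a + int k"] by (simp add: algebra_simps)
  qed (simp add: assms(2))
  moreover have "m dvd (a + int (nat ((j - a) mod m))) - j"
    using assms(1) by (simp add: mod_eq_dvd_iff[symmetric] mod_add_right_eq)
  ultimately show ?thesis using assms(4) by blast
qed

lemma int_subgroup_eq_multiples:
  fixes n :: int and N :: "int \<Rightarrow> bool"
  assumes "0 < n" and "N n" and add: "\<And>a b. N a \<Longrightarrow> N b \<Longrightarrow> N (a + b)"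
    and minus: "\<And>a. N a \<Longrightarrow> N (- a)"
  obtains k where "0 < k" "\<And>c. N c \<longleftrightarrow> k dvd c"
proof -
  define m where "m = (LEAST m::nat. 0 < m \<and> N (int m))"
  have "0 < nat n \<and> N (int (nat n))" using assms by simp
  then have m: "0 < m" "N (int m)" unfolding m_def by (metis (mono_tags, lifting) LeastI)+
  have least: "m \<le> j" if "0 < j" "N (int j)" for j
    unfolding m_def using that by (simp add: Least_le)
  have mult: "N (int m * j)" for j
  proof (induction j rule: int_induct[where k = 0])
    case base
    then show ?case using add[OF m(2) minus[OF m(2)]] by simp
  next
    case (step1 i)
    then show ?case using add[OF m(2), of "int m * i"] by (simp add: algebra_simps)
  next
    case (step2 i)
    then show ?case using add[OF minus[OF m(2)], of "int m * i"] by (simp add: algebra_simps)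
  qed
  have "int m dvd c" if "N c" for c
  proof -
    have "N (c mod int m)"
      using add[OF that minus[OF mult[of "c div int m"]]] by (simp add: minus_mult_div_eq_mod)
    moreover have "0 \<le> c mod int m" "c mod int m < int m" using m(1) by simp_all
    ultimately have "c mod int m = 0" using least[of "nat (c mod int m)"] by fastforce
    then show ?thesis by auto
  qed
  then show ?thesis using that[of "int m"] m(1) mult by (auto elim!: dvdE)
qed

lemma two_torsion_unique:
  fixes d h h' :: int
  assumes "d dvd 2 * h" "\<not> d dvd h" "d dvd 2 * h'" "\<not> d dvd h'"
  shows "d dvd h - h'"
proof -
  obtain q q' where q: "2 * h = d * q" "2 * h' = d * q'" using assms(1,3) by (auto elim!: dvdE)
  have "odd q" "odd q'"
    using assms(2,4) q by (auto elim!: evenE simp: algebra_simps)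
  then obtain r where "q - q' = 2 * r" by (meson dvdE odd_even_add even_diff dvd_add_right_iff)
  then have "2 * (h - h') = 2 * (d * r)" using q by (simp add: algebra_simps flip: distrib_left)
  then have "h - h' = d * r" by (metis mult_left_cancel zero_neq_numeral)
  then show ?thesis by simp
qed

lemma two_torsion_half:
  fixes n v :: int
  assumes "n dvd 2 * v" "\<not> n dvd v"
  obtains m where "n = 2 * m" "n dvd v - m"
proof -
  obtain q where q: "2 * v = n * q" using assms(1) by auto
  have "odd q" using assms(2) q by (auto elim!: evenE)
  then have "even n" using q by (metis dvd_triv_left even_mult_iff)
  then obtain m where m: "n = 2 * m" by auto
  obtain k where "q = 2 * k + 1" using \<open>odd q\<close> by (rule oddE)
  then have "v - m = n * k" using q m by (simp add: algebra_simps)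
  then show ?thesis using that[OF m] by simp
qed

lemma annihilator_subset_imp_multiple:
  fixes n c c' :: int
  assumes "0 < n" and "\<And>m. n dvd m * c \<Longrightarrow> n dvd m * c'"
  obtains z where "n dvd c' - z * c"
proof -
  define g where "g = gcd n c"
  have g: "g dvd n" "g dvd c" "0 < g" using assms(1) by (simp_all add: g_def)
  then obtain m where m: "n = g * m" by auto
  then have "m \<noteq> 0" using assms(1) by auto
  moreover have "n dvd m * c" using g(2) m by (auto simp: mult.commute)
  then have "n dvd m * c'" by (rule assms(2))
  ultimately have "g dvd c'" unfolding m by (simp add: mult.commute)
  then obtain w where w: "c' = g * w" by auto
  obtain u v where uv: "u * n + v * c = g" using bezout_int[of n c] by (auto simp: g_def)
  have "c' - (w * v) * c = n * (w * u)" unfolding w uv[symmetric] by (simp add: algebra_simps)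
  then show ?thesis using that[of "w * v"] by simp
qed

lemma exists_incongruent:
  fixes d :: int
  assumes "finite A" "int (card A) < d"
  shows "\<exists>k. \<forall>a\<in>A. \<not> d dvd k - a"
proof -
  have "card ((\<lambda>a. a mod d) ` A) < card {0..<d}"
    using card_image_le[OF assms(1), of "\<lambda>a. a mod d"] assms(2) by simp
  then have "\<not> {0..<d} \<subseteq> (\<lambda>a. a mod d) ` A" using assms(1) by (meson card_mono finite_imageI not_le)
  then obtain k where "k \<in> {0..<d}" "k \<notin> (\<lambda>a. a mod d) ` A" by blast
  then have "\<forall>a\<in>A. k mod d \<noteq> a mod d" by auto
  then show ?thesis by (auto simp: mod_eq_dvd_iff)
qed

lemma int_progression_cong:
  fixes \<pi> :: "int \<Rightarrow> int"
  assumes "d dvd \<pi> 0 - t" and succ: "\<And>m. d dvd \<pi> (m + 1) - (\<pi> m + q)"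
  shows "d dvd \<pi> m - (t + m * q)"
proof (induction m rule: int_induct[where k = 0])
  case (step1 i)
  with succ[of i] show ?case by algebra
next
  case (step2 i)
  from succ[of "i - 1"] have "d dvd \<pi> i - (\<pi> (i - 1) + q)" by simp
  with step2 show ?case by algebra
qed (simp add: assms(1))

section \<open>The infinite dihedral group modulo \<open>n\<close>\<close>

text \<open>
  Elements of the infinite dihedral group are pairs \<open>(i, e)\<close>, read as in \<^const>\<open>dihedral\<close>; the
  dihedral group of order \<open>2n\<close> is its quotient by the congruence \<open>dih_cong n\<close>. Passing to a quotient
  of the dihedral group then amounts to replacing \<open>n\<close> by a divisor.
\<close>

definition dih_mult :: "int \<times> bool \<Rightarrow> int \<times> bool \<Rightarrow> int \<times> bool" (infixl \<open>\<cdot>\<close> 70) where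
  "g \<cdot> h = (if snd g then fst g - fst h else fst g + fst h, snd g \<noteq> snd h)"

definition dih_cong :: "int \<Rightarrow> int \<times> bool \<Rightarrow> int \<times> bool \<Rightarrow> bool" where
  "dih_cong n g h \<longleftrightarrow> snd g = snd h \<and> n dvd fst g - fst h"

lemma dih_mult_assoc: "g \<cdot> h \<cdot> k = g \<cdot> (h \<cdot> k)"
  by (auto simp: dih_mult_def)

lemma dih_mult_one [simp]: "(0, False) \<cdot> g = g" "g \<cdot> (0, False) = g"
  by (cases g; auto simp: dih_mult_def)+

lemma dih_mult_rotation [simp]: "(i, False) \<cdot> (j, e) = (i + j, e)"
  by (simp add: dih_mult_def)

lemma dih_mult_reflection [simp]: "(i, True) \<cdot> (j, e) = (i - j, \<not> e)"
  by (simp add: dih_mult_def)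

lemma dih_cong_Pair [simp]: "dih_cong n (a, e) (b, f) \<longleftrightarrow> e = f \<and> n dvd a - b"
  by (simp add: dih_cong_def)

lemma dih_cong_refl [simp]: "dih_cong n g g"
  by (simp add: dih_cong_def)

lemma dih_cong_sym: "dih_cong n g h \<Longrightarrow> dih_cong n h g"
  by (auto simp: dih_cong_def dvd_diff_commute)

lemma dih_cong_trans [trans]: "dih_cong n g h \<Longrightarrow> dih_cong n h k \<Longrightarrow> dih_cong n g k"
  unfolding dih_cong_def by algebra

lemma dih_cong_euclidean: "dih_cong n g h \<Longrightarrow> dih_cong n g k \<Longrightarrow> dih_cong n h k"
  using dih_cong_sym dih_cong_trans by blast

lemma dih_cong_dvd_modulus: "dih_cong n g h \<Longrightarrow> m dvd n \<Longrightarrow> dih_cong m g h"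
  by (auto simp: dih_cong_def intro: dvd_trans)

lemma dih_cong_mult:
  assumes "dih_cong n g g'" "dih_cong n h h'"
  shows "dih_cong n (g \<cdot> h) (g' \<cdot> h')"
proof -
  have "n dvd fst g - fst g'" "n dvd fst h - fst h'" using assms by (simp_all add: dih_cong_def)
  then have "n dvd (fst g + fst h) - (fst g' + fst h')" "n dvd (fst g - fst h) - (fst g' - fst h')"
    by algebra+
  then show ?thesis using assms by (simp add: dih_cong_def dih_mult_def)
qed

lemma dih_cong_mult_cancel_left: "dih_cong n (g \<cdot> h) (g \<cdot> h') \<longleftrightarrow> dih_cong n h h'"
  unfolding dih_cong_def dih_mult_def by (auto simp: dvd_diff_commute)

lemma dih_cong_progression:
  assumes "dih_cong n (f 0) (0, False)" and succ: "\<And>m. dih_cong n (f (m + 1)) ((c, False) \<cdot> f m)"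
  shows "dih_cong n (f m) (m * c, False)"
proof (induction m rule: int_induct[where k = 0])
  case (step1 i)
  from dih_cong_trans[OF succ dih_cong_mult[OF dih_cong_refl step1(2)]] show ?case
    by (simp add: algebra_simps)
next
  case (step2 i)
  have "dih_cong n (f i) ((c, False) \<cdot> f (i - 1))" using succ[of "i - 1"] by simp
  then have "dih_cong n ((c, False) \<cdot> f (i - 1)) (i * c, False)"
    using step2(2) by (rule dih_cong_euclidean)
  also have "(i * c, False) = (c, False) \<cdot> ((i - 1) * c, False)" by (simp add: algebra_simps)
  finally show ?case by (simp only: dih_cong_mult_cancel_left)
qed (simp add: assms(1))

section \<open>Cyclically numbered generators and map automorphisms\<close>

locale cyclic_generators =
  fixes n d :: int and x :: "int \<Rightarrow> int \<times> bool" and chi :: "int \<Rightarrow> int"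
  assumes n_pos: "0 < n" and d_pos: "0 < d"
    and x_eq_iff: "\<And>i j. dih_cong n (x i) (x j) \<longleftrightarrow> d dvd i - j"
    and x_mult_x_chi: "\<And>i. dih_cong n (x i \<cdot> x (chi i)) (0, False)"
    and word_induct [case_names cong one step]:
      "\<And>Q g. (\<And>g h. dih_cong n g h \<Longrightarrow> Q g \<Longrightarrow> Q h) \<Longrightarrow> Q (0, False) \<Longrightarrow>
        (\<And>g i. Q g \<Longrightarrow> Q (g \<cdot> x i)) \<Longrightarrow> Q g"
begin

abbreviation eqv :: "int \<times> bool \<Rightarrow> int \<times> bool \<Rightarrow> bool" (infix \<open>\<approx>\<close> 50) where
  "g \<approx> h \<equiv> dih_cong n g h"

abbreviation s :: "int \<Rightarrow> int" where "s i \<equiv> fst (x i)"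

abbreviation is_ref :: "int \<Rightarrow> bool" where "is_ref i \<equiv> snd (x i)"

lemma x_cong: "d dvd i - j \<Longrightarrow> x i \<approx> x j"
  using x_eq_iff by blast

lemma s_cong: "d dvd i - j \<Longrightarrow> n dvd s i - s j"
  using x_cong[of i j] by (simp add: dih_cong_def)

lemma is_ref_cong: "d dvd i - j \<Longrightarrow> is_ref i = is_ref j"
  using x_cong[of i j] by (simp add: dih_cong_def)

lemma x_inj: "x i \<approx> x j \<Longrightarrow> d dvd i - j"
  using x_eq_iff by blast

lemma index_cong: "is_ref i = is_ref j \<Longrightarrow> n dvd s i - s j \<Longrightarrow> d dvd i - j"
  by (intro x_inj) (simp add: dih_cong_def)

lemma x_rotation: "\<not> is_ref i \<Longrightarrow> x i = (s i, False)"
  by (simp add: prod_eq_iff)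

lemma reflection_mult_x: "is_ref i \<Longrightarrow> x i \<cdot> x j = (s i - s j, \<not> is_ref j)"
  by (simp add: dih_mult_def)

lemma rotation_mult_x: "\<not> is_ref i \<Longrightarrow> x i \<cdot> x j = (s i + s j, is_ref j)"
  by (simp add: dih_mult_def)

lemma x_mult_cong: "d dvd i - i' \<Longrightarrow> d dvd j - j' \<Longrightarrow> x i \<cdot> x j \<approx> x i' \<cdot> x j'"
  by (intro dih_cong_mult x_cong)

lemma x_mult_reindex:
  assumes "x i \<cdot> x j \<approx> x k \<cdot> x l" "d dvd i - i'" "d dvd j - j'" "d dvd k - k'" "d dvd l - l'"
  shows "x i' \<cdot> x j' \<approx> x k' \<cdot> x l'"
  using assms(1) x_mult_cong[OF assms(2,3)] x_mult_cong[OF assms(4,5)]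
  by (meson dih_cong_euclidean dih_cong_trans)

lemma is_ref_chi [simp]: "is_ref (chi i) = is_ref i"
  using x_mult_x_chi[of i] by (auto simp: dih_cong_def dih_mult_def)

lemma s_chi: "\<not> is_ref i \<Longrightarrow> n dvd s i + s (chi i)"
  using x_mult_x_chi[of i] by (auto simp: dih_cong_def dih_mult_def)

lemma chi_reflection: "is_ref i \<Longrightarrow> d dvd chi i - i"
  using x_mult_x_chi[of i] by (intro x_inj) (auto simp: dih_cong_def dih_mult_def dvd_diff_commute)

lemma chi_unique:
  assumes "x i \<cdot> x j \<approx> (0, False)"
  shows "d dvd chi i - j"
proof (rule x_inj)
  have "x i \<cdot> x (chi i) \<approx> x i \<cdot> x j"
    using x_mult_x_chi assms dih_cong_sym dih_cong_trans by blast
  then show "x (chi i) \<approx> x j" by (simp only: dih_cong_mult_cancel_left)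
qed

lemma chi_rotation: "\<not> is_ref i \<Longrightarrow> \<not> is_ref j \<Longrightarrow> n dvd s i + s j \<Longrightarrow> d dvd chi i - j"
  by (rule chi_unique) (simp add: rotation_mult_x)

lemma chi_chi: "d dvd chi (chi i) - i"
proof (cases "is_ref i")
  case True
  then have "d dvd chi (chi i) - chi i" "d dvd chi i - i" by (simp_all add: chi_reflection)
  then show ?thesis by algebra
next
  case False
  then show ?thesis using s_chi[of i] by (intro chi_rotation) (auto simp: add.commute)
qed

lemma chi_cong:
  assumes "d dvd i - j"
  shows "d dvd chi i - chi j"
proof (rule chi_unique)
  have "x i \<cdot> x (chi j) \<approx> x j \<cdot> x (chi j)" using assms by (intro x_mult_cong) auto
  then show "x i \<cdot> x (chi j) \<approx> (0, False)" using x_mult_x_chi dih_cong_trans by blast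
qed

lemma chi_inject: "d dvd chi i - chi j \<Longrightarrow> d dvd i - j"
  using chi_cong[of "chi i" "chi j"] chi_chi[of i] chi_chi[of j] by algebra

lemma chi_swap: "d dvd chi i - j \<Longrightarrow> d dvd chi j - i"
  using chi_cong[of "chi i" j] chi_chi[of i] by algebra

lemma common_divisor_dvd_one:
  assumes "m dvd n" "is_ref i0" and rotation: "\<And>i. 0 \<le> i \<Longrightarrow> i < d \<Longrightarrow> \<not> is_ref i \<Longrightarrow> m dvd s i"
    and reflection: "\<And>i. 0 \<le> i \<Longrightarrow> i < d \<Longrightarrow> is_ref i \<Longrightarrow> m dvd s i - s i0"
  shows "m dvd 1"
proof -
  define v where "v g = fst g - (if snd g then s i0 else 0)" for g :: "int \<times> bool"
  have v_x: "m dvd v (x i)" for i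
  proof -
    have i: "d dvd i - i mod d" by simp
    have "m dvd s i - s (i mod d)" using assms(1) s_cong[OF i] by (rule dvd_trans)
    moreover have "m dvd v (x (i mod d))"
      using rotation[of "i mod d"] reflection[of "i mod d"] d_pos by (simp add: v_def)
    ultimately show ?thesis
      using is_ref_cong[OF i] unfolding v_def by (cases "is_ref i") (simp_all, algebra+)
  qed
  have "m dvd v g" for g
  proof (induction g rule: word_induct)
    case (cong g h)
    then have "snd g = snd h" "m dvd fst g - fst h"
      using assms(1) by (auto simp: dih_cong_def intro: dvd_trans)
    then show ?case using cong(2) by (simp add: v_def split: if_splits; algebra)
  next
    case (step g i)
    then show ?case using v_x[of i] by (auto simp: v_def dih_mult_def split: if_splits; algebra)
  qed (simp add: v_def)
  from this[of "(1, False)"] show ?thesis by (simp add: v_def)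
qed

text \<open>
  A map automorphism \<open>f\<close>, preserving (\<open>\<epsilon> = 1\<close>) or reversing (\<open>\<epsilon> = -1\<close>) the orientation, sends the
  neighbour \<open>g x\<^sub>i\<close> of a vertex \<open>g\<close> to the neighbour of \<open>f g\<close> with number \<open>\<epsilon> i + \<pi> g\<close>.
\<close>

definition arc_map :: "int \<Rightarrow> (int \<times> bool \<Rightarrow> int \<times> bool) \<Rightarrow> (int \<times> bool \<Rightarrow> int) \<Rightarrow> bool" where
  "arc_map \<epsilon> f \<pi> \<longleftrightarrow> (\<forall>g h. g \<approx> h \<longrightarrow> f g \<approx> f h) \<and> (\<forall>g i. f (g \<cdot> x i) \<approx> f g \<cdot> x (\<epsilon> * i + \<pi> g))"

lemma arc_map_cong: "arc_map \<epsilon> f \<pi> \<Longrightarrow> g \<approx> h \<Longrightarrow> f g \<approx> f h"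
  unfolding arc_map_def by blast

lemma arc_map_step: "arc_map \<epsilon> f \<pi> \<Longrightarrow> f (g \<cdot> x i) \<approx> f g \<cdot> x (\<epsilon> * i + \<pi> g)"
  unfolding arc_map_def by blast

lemma arc_map_turn_cong:
  assumes f: "arc_map \<epsilon> f \<pi>" and gh: "g \<approx> h"
  shows "d dvd \<pi> g - \<pi> h"
proof (rule x_inj)
  have "f g \<cdot> x (\<pi> g) \<approx> f (g \<cdot> x 0)" using arc_map_step[OF f, of g 0] by (simp add: dih_cong_sym)
  also have "\<dots> \<approx> f (h \<cdot> x 0)" by (intro arc_map_cong[OF f] dih_cong_mult gh dih_cong_refl)
  also have "\<dots> \<approx> f h \<cdot> x (\<pi> h)" using arc_map_step[OF f, of h 0] by simp
  also have "\<dots> \<approx> f g \<cdot> x (\<pi> h)"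
    by (intro dih_cong_mult dih_cong_refl arc_map_cong[OF f] dih_cong_sym[OF gh])
  finally show "x (\<pi> g) \<approx> x (\<pi> h)" by (simp only: dih_cong_mult_cancel_left)
qed

lemma arc_map_turn_step:
  assumes f: "arc_map \<epsilon> f \<pi>"
  shows "d dvd \<pi> (g \<cdot> x i) - (chi (\<epsilon> * i + \<pi> g) - \<epsilon> * chi i)"
proof -
  let ?y = "x (\<epsilon> * i + \<pi> g) \<cdot> x (\<epsilon> * chi i + \<pi> (g \<cdot> x i))"
  have "f g \<approx> f (g \<cdot> x i \<cdot> x (chi i))"
    using x_mult_x_chi[of i] dih_cong_mult[of n g g] unfolding dih_mult_assoc
    by (intro arc_map_cong[OF f]) (metis dih_cong_refl dih_cong_sym dih_mult_one(2))
  also have "\<dots> \<approx> f (g \<cdot> x i) \<cdot> x (\<epsilon> * chi i + \<pi> (g \<cdot> x i))" by (rule arc_map_step[OF f])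
  also have "\<dots> \<approx> f g \<cdot> x (\<epsilon> * i + \<pi> g) \<cdot> x (\<epsilon> * chi i + \<pi> (g \<cdot> x i))"
    by (intro dih_cong_mult dih_cong_refl arc_map_step[OF f])
  finally have "f g \<cdot> (0, False) \<approx> f g \<cdot> ?y" by (simp add: dih_mult_assoc)
  then have "?y \<approx> (0, False)" unfolding dih_cong_mult_cancel_left by (rule dih_cong_sym)
  from chi_unique[OF this] show ?thesis by algebra
qed

lemma arc_map_unique:
  assumes f: "arc_map \<epsilon> f \<pi>" and f': "arc_map \<epsilon> f' \<pi>'"
    and one: "f (0, False) \<approx> f' (0, False)" "d dvd \<pi> (0, False) - \<pi>' (0, False)"
  shows "f g \<approx> f' g" and "d dvd \<pi> g - \<pi>' g"
proof -
  have "f g \<approx> f' g \<and> d dvd \<pi> g - \<pi>' g"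
  proof (induction g rule: word_induct)
    case (cong g h)
    have "f h \<approx> f' h"
      using cong arc_map_cong[OF f cong(1)] arc_map_cong[OF f' cong(1)]
      by (meson dih_cong_euclidean dih_cong_trans)
    moreover have "d dvd \<pi> h - \<pi>' h"
      using cong(2) arc_map_turn_cong[OF f cong(1)] arc_map_turn_cong[OF f' cong(1)] by algebra
    ultimately show ?case ..
  next
    case (step g i)
    let ?a = "\<epsilon> * i + \<pi> g" and ?b = "\<epsilon> * i + \<pi>' g"
    have ab: "d dvd ?a - ?b" using step by simp
    have "f (g \<cdot> x i) \<approx> f g \<cdot> x ?a" by (rule arc_map_step[OF f])
    also have "\<dots> \<approx> f' g \<cdot> x ?b" using step by (intro dih_cong_mult x_cong ab) simp
    also have "\<dots> \<approx> f' (g \<cdot> x i)" by (rule dih_cong_sym[OF arc_map_step[OF f']])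
    finally have "f (g \<cdot> x i) \<approx> f' (g \<cdot> x i)" .
    moreover have "d dvd \<pi> (g \<cdot> x i) - \<pi>' (g \<cdot> x i)"
      using arc_map_turn_step[OF f, of g i] arc_map_turn_step[OF f', of g i] chi_cong[OF ab] by algebra
    ultimately show ?case ..
  qed (use one in blast)
  then show "f g \<approx> f' g" "d dvd \<pi> g - \<pi>' g" by blast+
qed

lemma arc_map_id: "arc_map 1 (\<lambda>g. g) (\<lambda>_. 0)"
  by (simp add: arc_map_def)

lemma arc_map_translate: "arc_map 1 ((\<cdot>) u) (\<lambda>_. 0)"
  by (simp add: arc_map_def dih_mult_assoc dih_cong_mult_cancel_left)

lemma arc_map_comp:
  assumes f: "arc_map \<epsilon> f \<pi>" and f': "arc_map \<epsilon>' f' \<pi>'"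
  shows "arc_map (\<epsilon> * \<epsilon>') (\<lambda>g. f (f' g)) (\<lambda>g. \<epsilon> * \<pi>' g + \<pi> (f' g))"
  unfolding arc_map_def
proof (intro conjI allI impI)
  show "f (f' g) \<approx> f (f' h)" if "g \<approx> h" for g h
    by (intro arc_map_cong[OF f] arc_map_cong[OF f'] that)
  show "f (f' (g \<cdot> x i)) \<approx> f (f' g) \<cdot> x (\<epsilon> * \<epsilon>' * i + (\<epsilon> * \<pi>' g + \<pi> (f' g)))" for g i
  proof -
    have "f (f' (g \<cdot> x i)) \<approx> f (f' g \<cdot> x (\<epsilon>' * i + \<pi>' g))"
      by (intro arc_map_cong[OF f] arc_map_step[OF f'])
    also have "\<dots> \<approx> f (f' g) \<cdot> x (\<epsilon> * (\<epsilon>' * i + \<pi>' g) + \<pi> (f' g))" by (rule arc_map_step[OF f])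
    finally show ?thesis by (simp add: algebra_simps)
  qed
qed

lemma arc_map_translated_arg: "arc_map \<epsilon> f \<pi> \<Longrightarrow> arc_map \<epsilon> (\<lambda>h. f (u \<cdot> h)) (\<lambda>h. \<pi> (u \<cdot> h))"
  using arc_map_comp[OF _ arc_map_translate[of u]] by simp

lemma arc_map_translated: "arc_map \<epsilon> f \<pi> \<Longrightarrow> arc_map \<epsilon> (\<lambda>h. u \<cdot> f h) \<pi>"
  using arc_map_comp[OF arc_map_translate[of u]] by simp

end

section \<open>Rotations about a vertex\<close>

text \<open>\<open>F t\<close> is the automorphism that fixes the vertex \<open>1\<close> and maps \<open>x i\<close> to \<open>x (i + t)\<close>.\<close>

locale vertex_rotations = cyclic_generators +
  fixes F :: "int \<Rightarrow> int \<times> bool \<Rightarrow> int \<times> bool" and P :: "int \<Rightarrow> int \<times> bool \<Rightarrow> int"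
  assumes F_arc_map: "\<And>t. arc_map 1 (F t) (P t)"
    and F_one: "\<And>t. F t (0, False) \<approx> (0, False)"
    and P_one: "\<And>t. d dvd P t (0, False) - t"
begin

lemmas F_cong = arc_map_cong[OF F_arc_map] and P_cong = arc_map_turn_cong[OF F_arc_map]

lemma F_step: "F t (g \<cdot> x i) \<approx> F t g \<cdot> x (i + P t g)"
  using arc_map_step[OF F_arc_map, of t g i] by simp

lemma P_step: "d dvd P t (g \<cdot> x i) - (chi (i + P t g) - chi i)"
  using arc_map_turn_step[OF F_arc_map, of t g i] by simp

lemma
  assumes "d dvd t - t'"
  shows F_index_cong: "F t g \<approx> F t' g" and P_index_cong: "d dvd P t g - P t' g"
proof -
  have "F t (0, False) \<approx> F t' (0, False)" by (metis F_one dih_cong_sym dih_cong_trans)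
  moreover have "d dvd P t (0, False) - P t' (0, False)" using P_one[of t] P_one[of t'] assms by algebra
  ultimately show "F t g \<approx> F t' g" "d dvd P t g - P t' g"
    using arc_map_unique[OF F_arc_map F_arc_map] by blast+
qed

lemma
  shows F_mult: "F t (g \<cdot> h) \<approx> F t g \<cdot> F (P t g) h" and P_mult: "d dvd P t (g \<cdot> h) - P (P t g) h"
proof -
  have "F t (g \<cdot> (0, False)) \<approx> F t g \<cdot> F (P t g) (0, False)"
    using dih_cong_mult[OF dih_cong_refl dih_cong_sym[OF F_one]] by simp
  moreover have "d dvd P t (g \<cdot> (0, False)) - P (P t g) (0, False)"
    using P_one[of "P t g"] by (simp add: dvd_diff_commute)
  ultimately show "F t (g \<cdot> h) \<approx> F t g \<cdot> F (P t g) h" "d dvd P t (g \<cdot> h) - P (P t g) h"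
    using arc_map_unique[OF arc_map_translated_arg[OF F_arc_map] arc_map_translated[OF F_arc_map]]
    by blast+
qed

lemma
  shows F_add: "F (u + t) g \<approx> F u (F t g)" and P_add: "d dvd P (u + t) g - (P t g + P u (F t g))"
proof -
  have comp: "arc_map 1 (\<lambda>g. F u (F t g)) (\<lambda>g. P t g + P u (F t g))"
    using arc_map_comp[OF F_arc_map F_arc_map, of u t] by simp
  have "F u (F t (0, False)) \<approx> (0, False)" by (rule dih_cong_trans[OF F_cong[OF F_one] F_one])
  then have "F (u + t) (0, False) \<approx> F u (F t (0, False))" by (metis F_one dih_cong_sym dih_cong_trans)
  moreover have "d dvd P (u + t) (0, False) - (P t (0, False) + P u (F t (0, False)))"
    using P_one[of "u + t"] P_one[of t] P_one[of u] P_cong[OF F_one, of u t] by algebra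
  ultimately show "F (u + t) g \<approx> F u (F t g)" "d dvd P (u + t) g - (P t g + P u (F t g))"
    using arc_map_unique[OF F_arc_map comp] by blast+
qed

lemma
  shows F_zero: "F 0 g \<approx> g" and P_zero: "d dvd P 0 g"
  using arc_map_unique[OF F_arc_map arc_map_id, of 0] F_one[of 0] P_one[of 0] by auto

lemma F_inverse: "F t (F (- t) g) \<approx> g"
  using F_add[of t "- t" g] F_zero[of g] by simp (metis dih_cong_euclidean)

lemma F_x: "F t (x i) \<approx> x (i + t)"
proof -
  have "F t ((0, False) \<cdot> x i) \<approx> F t (0, False) \<cdot> x (i + P t (0, False))" by (rule F_step)
  also have "\<dots> \<approx> (0, False) \<cdot> x (i + t)" using P_one[of t] by (intro dih_cong_mult F_one x_cong) simp
  finally show ?thesis by simp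
qed

lemma P_x: "d dvd P t (x i) - (chi (i + t) - chi i)"
proof -
  have "d dvd chi (i + P t (0, False)) - chi (i + t)" using P_one[of t] by (intro chi_cong) simp
  then show ?thesis using P_step[of t "(0, False)" i] unfolding dih_mult_one by algebra
qed

lemma F_x_mult: "F t (x i \<cdot> x j) \<approx> x (i + t) \<cdot> x (j + chi (i + t) - chi i)"
proof -
  have "F t (x i \<cdot> x j) \<approx> F t (x i) \<cdot> x (j + P t (x i))" by (rule F_step)
  also have "\<dots> \<approx> x (i + t) \<cdot> x (j + chi (i + t) - chi i)"
    using P_x[of t i] by (intro dih_cong_mult F_x x_cong) algebra
  finally show ?thesis .
qed

lemma P_x_mult: "d dvd P t (x i \<cdot> x j) - (chi (j + chi (i + t) - chi i) - chi j)"
proof -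
  have "d dvd chi (j + P t (x i)) - chi (j + chi (i + t) - chi i)"
    using P_x[of t i] by (intro chi_cong) algebra
  with P_step[of t "x i" j] show ?thesis by algebra
qed

lemma x_mult_transfer:
  assumes "x i \<cdot> x j \<approx> x k \<cdot> x l"
  shows "x (i + t) \<cdot> x (j + chi (i + t) - chi i) \<approx> x (k + t) \<cdot> x (l + chi (k + t) - chi k)"
  using F_cong[OF assms, of t] F_x_mult[of t i j] F_x_mult[of t k l]
  by (meson dih_cong_euclidean dih_cong_trans)

lemma reflection_rotation_transfer:
  assumes "is_ref i" "\<not> is_ref j"
  shows "x (i + t) \<cdot> x (j - i + chi (i + t)) \<approx> x (chi j + t) \<cdot> x (i - j + chi (chi j + t))"
proof (rule x_mult_reindex[OF x_mult_transfer[of i j "chi j" i t]])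
  show "x i \<cdot> x j \<approx> x (chi j) \<cdot> x i"
    using assms s_chi[OF assms(2)] by (simp add: reflection_mult_x rotation_mult_x) algebra
  show "d dvd j + chi (i + t) - chi i - (j - i + chi (i + t))"
    using chi_reflection[OF assms(1)] by algebra
  show "d dvd i + chi (chi j + t) - chi (chi j) - (i - j + chi (chi j + t))"
    using chi_chi[of j] by algebra
qed simp_all

lemma rotation_rotation_transfer:
  assumes "\<not> is_ref j" "\<not> is_ref k"
  shows "x (j + t) \<cdot> x (k + chi (j + t) - chi j) \<approx> x (k + t) \<cdot> x (j + chi (k + t) - chi k)"
  using assms by (intro x_mult_transfer) (simp add: rotation_mult_x)

lemma
  assumes "is_ref i" "is_ref i'"
  shows F_reflection_pair: "F t (s i - s i', False) \<approx> x (i + t) \<cdot> x (i' - i + chi (i + t))"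
    and P_reflection_pair: "d dvd P t (s i - s i', False) - (chi (i' - i + chi (i + t)) - i')"
proof -
  have product: "x i \<cdot> x i' = (s i - s i', False)" using assms by (simp add: reflection_mult_x)
  have index: "d dvd (i' + chi (i + t) - chi i) - (i' - i + chi (i + t))"
    using chi_reflection[OF assms(1)] by algebra
  show "F t (s i - s i', False) \<approx> x (i + t) \<cdot> x (i' - i + chi (i + t))"
    using dih_cong_trans[OF F_x_mult[of t i i', unfolded product] x_mult_cong[OF _ index]] by simp
  show "d dvd P t (s i - s i', False) - (chi (i' - i + chi (i + t)) - i')"
    using P_x_mult[of t i i', unfolded product] chi_cong[OF index] chi_reflection[OF assms(2)]
    by algebra
qed

lemma
  assumes "is_ref i" "is_ref i'" "is_ref (i + t)"
  shows F_reflection_pair_shift: "F t (s i - s i', False) \<approx> x (i + t) \<cdot> x (i' + t)"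
    and P_reflection_pair_shift: "d dvd P t (s i - s i', False) - (chi (i' + t) - i')"
proof -
  have index: "d dvd (i' - i + chi (i + t)) - (i' + t)" using chi_reflection[OF assms(3)] by algebra
  show "F t (s i - s i', False) \<approx> x (i + t) \<cdot> x (i' + t)"
    using dih_cong_trans[OF F_reflection_pair[OF assms(1,2)] x_mult_cong[OF _ index]] by simp
  show "d dvd P t (s i - s i', False) - (chi (i' + t) - i')"
    using P_reflection_pair[OF assms(1,2), of t] chi_cong[OF index] by algebra
qed

lemma
  assumes "is_ref i" "is_ref j" "is_ref (i + t)" "is_ref (j + t)"
  shows F_reflections_shift: "F t (s i - s j, False) \<approx> (s (i + t) - s (j + t), False)"
    and P_reflections_shift: "d dvd P t (s i - s j, False) - t"
  using F_reflection_pair_shift[OF assms(1-3)] P_reflection_pair_shift[OF assms(1-3)] assms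
    chi_reflection[OF assms(4)]
  by (simp add: reflection_mult_x, algebra)

text \<open>
  If \<open>F t\<close> turns the arcs at \<open>a\<^sup>c\<close> by \<open>t + q\<close>, and \<open>F q\<close> fixes the powers of \<open>a\<^sup>c\<close> and turns
  their arcs by \<open>q\<close>, then \<open>F t\<close> is linear on the subgroup generated by \<open>a\<^sup>c\<close>.
\<close>

lemma
  assumes c: "F t (c, False) \<approx> (c', False)" "d dvd P t (c, False) - (t + q)"
    and fixed: "\<And>m. F q (m * c, False) \<approx> (m * c, False)" "\<And>m. d dvd P q (m * c, False) - q"
  shows F_rotation_progression: "F t (m * c, False) \<approx> (m * c', False)"
    and P_rotation_progression: "d dvd P t (m * c, False) - (t + m * q)"
proof -
  have succ: "F t ((m + 1) * c, False) \<approx> (c', False) \<cdot> F t (m * c, False)"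
    "d dvd P t ((m + 1) * c, False) - (P t (m * c, False) + q)" for m
  proof -
    let ?g = "(m * c, False)"
    have succ_multiple: "((m + 1) * c, False) = (c, False) \<cdot> ?g" by (simp add: algebra_simps)
    have "F t ((m + 1) * c, False) \<approx> F t (c, False) \<cdot> F (P t (c, False)) ?g"
      unfolding succ_multiple by (rule F_mult)
    also have "\<dots> \<approx> (c', False) \<cdot> F (t + q) ?g" by (intro dih_cong_mult c F_index_cong)
    also have "\<dots> \<approx> (c', False) \<cdot> F t (F q ?g)" by (intro dih_cong_mult dih_cong_refl F_add)
    also have "\<dots> \<approx> (c', False) \<cdot> F t ?g" by (intro dih_cong_mult dih_cong_refl F_cong fixed)
    finally show "F t ((m + 1) * c, False) \<approx> (c', False) \<cdot> F t ?g" .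
    show "d dvd P t ((m + 1) * c, False) - (P t ?g + q)"
      using P_mult[of t "(c, False)" ?g] P_index_cong[OF c(2), of ?g] P_add[of t q ?g]
        P_cong[OF fixed(1)[of m], of t] fixed(2)[of m] unfolding succ_multiple by algebra
  qed
  show "F t (m * c, False) \<approx> (m * c', False)"
    using F_one succ(1) by (intro dih_cong_progression[of n "\<lambda>m. F t (m * c, False)"]) simp_all
  show "d dvd P t (m * c, False) - (t + m * q)"
    using P_one succ(2) by (intro int_progression_cong[of d "\<lambda>m. P t (m * c, False)"]) simp_all
qed

lemma
  assumes "F t (c, False) \<approx> (c', False)" "d dvd P t (c, False) - t"
  shows F_rotation_mult: "F t (m * c, False) \<approx> (m * c', False)"
    and P_rotation_mult: "d dvd P t (m * c, False) - t"
  using F_rotation_progression[of t c c' 0 m] P_rotation_progression[of t c c' 0 m] assms F_zero P_zero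
  by simp_all

lemma
  assumes "F g v \<approx> v"
  shows F_multiple_fixed: "F (l * g) v \<approx> v" and P_multiple_fixed: "d dvd P (l * g) v - l * P g v"
proof -
  have succ: "F ((l + 1) * g) v \<approx> F (l * g) v" for l
    using dih_cong_trans[OF F_add F_cong[OF assms], of "l * g"] by (simp add: algebra_simps)
  show "F (l * g) v \<approx> v"
  proof (induction l rule: int_induct[where k = 0])
    case base
    then show ?case using F_zero by simp
  next
    case (step1 i)
    with succ[of i] show ?case using dih_cong_trans by blast
  next
    case (step2 i)
    have "F (i * g) v \<approx> F ((i - 1) * g) v" using succ[of "i - 1"] by simp
    then show ?case using step2(2) by (rule dih_cong_euclidean)
  qed
  have "d dvd P ((l + 1) * g) v - (P (l * g) v + P g v)" for l
    using P_add[of "l * g" g v] P_cong[OF assms, of "l * g"] by (simp add: algebra_simps) algebra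
  then show "d dvd P (l * g) v - l * P g v"
    using int_progression_cong[of d "\<lambda>l. P (l * g) v" 0 "P g v" l] P_zero by simp
qed

lemma F_fixed_gcd: "F t v \<approx> v \<longleftrightarrow> F (gcd t d) v \<approx> v"
proof
  assume "F t v \<approx> v"
  moreover obtain a b where ab: "a * t + b * d = gcd t d" using bezout_int by blast
  have "d dvd gcd t d - a * t" unfolding ab[symmetric] by simp
  ultimately show "F (gcd t d) v \<approx> v" using dih_cong_trans[OF F_index_cong F_multiple_fixed] by blast
next
  assume "F (gcd t d) v \<approx> v"
  moreover obtain l where "t = l * gcd t d" by (metis gcd_dvd1 dvdE mult.commute)
  ultimately show "F t v \<approx> v" using F_multiple_fixed by metis
qed

lemma F_fixed_mult:
  assumes "F t v \<approx> v" "F t w \<approx> w"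
  shows "F t (v \<cdot> w) \<approx> v \<cdot> w"
proof -
  define g where "g = gcd t d"
  have fixed: "F g v \<approx> v" "F g w \<approx> w" using assms F_fixed_gcd by (simp_all add: g_def)
  obtain q where q: "d = g * q" unfolding g_def by (metis gcd_dvd2 dvdE)
  have "d dvd P (q * g) v" using P_index_cong[of "q * g" 0 v] P_zero[of v] q by simp algebra
  then have "g * q dvd q * P g v" using P_multiple_fixed[OF fixed(1), of q] q by algebra
  moreover have "q \<noteq> 0" using q d_pos by auto
  ultimately have "g dvd P g v" by (simp add: mult.commute)
  then obtain l where "P g v = l * g" by (metis dvdE mult.commute)
  then have "F (P g v) w \<approx> w" using F_multiple_fixed[OF fixed(2)] by simp
  then have "F g (v \<cdot> w) \<approx> v \<cdot> w" by (rule dih_cong_trans[OF F_mult dih_cong_mult[OF fixed(1)]])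
  then show ?thesis unfolding g_def F_fixed_gcd[of t] .
qed

section \<open>The core of the rotation subgroup\<close>

text \<open>\<open>core c\<close> says that \<open>a\<^sup>c\<close> lies in the core of the group of rotations.\<close>

definition core :: "int \<Rightarrow> bool" where
  "core c \<longleftrightarrow> \<not> snd (F 1 (c, False)) \<and> d dvd P 1 (c, False) - 1"

lemma coreI: "F 1 (c, False) \<approx> (v, False) \<Longrightarrow> d dvd P 1 (c, False) - 1 \<Longrightarrow> core c"
  by (simp add: core_def dih_cong_def)

lemma core_F1: "core c \<Longrightarrow> F 1 (c, False) \<approx> (fst (F 1 (c, False)), False)"
  and core_P1: "core c \<Longrightarrow> d dvd P 1 (c, False) - 1"
  by (simp_all add: core_def dih_cong_def)

lemma core_mult: "core c \<Longrightarrow> core (l * c)"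
  using F_rotation_mult[OF core_F1 core_P1] P_rotation_mult[OF core_F1 core_P1] by (rule coreI)

lemma core_cong:
  assumes "n dvd c - c'"
  shows "core c \<longleftrightarrow> core c'"
proof -
  have pair_cong: "(c, False) \<approx> (c', False)" using assms by simp
  have "d dvd P 1 (c, False) - 1 \<longleftrightarrow> d dvd P 1 (c', False) - 1"
    using dvd_add_right_iff[OF P_cong[OF pair_cong, of 1], of "P 1 (c', False) - 1"] by simp
  then show ?thesis using F_cong[OF pair_cong, of 1] by (simp add: core_def dih_cong_def)
qed

lemma core_zero: "core 0"
  using F_one P_one by (rule coreI)

lemma core_modulus: "core n"
  using core_cong[of n 0] core_zero by simp

lemma core_add:
  assumes "core c" "core c'"
  shows "core (c + c')"
proof (rule coreI)
  let ?g = "(c, False)" and ?h = "(c', False)"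
  have "F 1 (?g \<cdot> ?h) \<approx> F 1 ?g \<cdot> F (P 1 ?g) ?h" by (rule F_mult)
  also have "\<dots> \<approx> (fst (F 1 ?g), False) \<cdot> (fst (F 1 ?h), False)"
    by (intro dih_cong_mult core_F1 assms dih_cong_trans[OF F_index_cong core_F1] core_P1)
  finally show "F 1 (c + c', False) \<approx> (fst (F 1 ?g) + fst (F 1 ?h), False)" by simp
  have "d dvd P 1 (?g \<cdot> ?h) - 1"
    using P_mult[of 1 ?g ?h] P_index_cong[OF core_P1[OF assms(1)], of ?h] core_P1[OF assms(2)]
    by algebra
  then show "d dvd P 1 (c + c', False) - 1" by simp
qed

lemma core_generator:
  obtains k where "0 < k" "k dvd n" "\<And>c. core c \<longleftrightarrow> k dvd c"
  using int_subgroup_eq_multiples[of n core] n_pos core_modulus core_add core_mult[of _ "- 1"]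
  by (metis mult_minus1)

lemma core_gcd:
  assumes "core c"
  shows "core (gcd c n)"
proof -
  obtain u v where uv: "u * c + v * n = gcd c n" using bezout_int by blast
  have "core (u * c + v * n)" by (intro core_add core_mult assms core_modulus)
  then show ?thesis by (simp add: uv)
qed

lemma ex_core_eigenvalue: "\<exists>r. \<forall>c. core c \<longrightarrow> F 1 (c, False) \<approx> (r * c, False)"
proof -
  obtain k where k: "0 < k" "k dvd n" "\<And>c. core c \<longleftrightarrow> k dvd c" by (rule core_generator) blast
  define v where "v = fst (F 1 (k, False))"
  have "core k" by (simp add: k)
  then have multiples: "F 1 (l * k, False) \<approx> (l * v, False)" for l
    unfolding v_def by (intro F_rotation_mult core_F1 core_P1)
  obtain q where q: "n = q * k" using k(2) by (metis dvdE mult.commute)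
  have "F 1 (q * k, False) \<approx> (0, False)"
    using dih_cong_trans[OF F_cong F_one, of "(q * k, False)" 1] q by simp
  with multiples[of q] have "(q * v, False) \<approx> (0, False)" by (rule dih_cong_euclidean)
  then have "n dvd q * v" by simp
  moreover have "q \<noteq> 0" using n_pos q by auto
  ultimately have "k dvd v" using q by simp
  then obtain r where "v = r * k" by (metis dvdE mult.commute)
  then have "F 1 (c, False) \<approx> (r * c, False)" if "core c" for c
    using that multiples k(3) by (auto elim!: dvdE simp: ac_simps)
  then show ?thesis by blast
qed

definition \<omega> :: int where
  "\<omega> = (SOME r. \<forall>c. core c \<longrightarrow> F 1 (c, False) \<approx> (r * c, False))"

lemma F1_core: "core c \<Longrightarrow> F 1 (c, False) \<approx> (\<omega> * c, False)"
  using someI_ex[OF ex_core_eigenvalue] unfolding \<omega>_def by blast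

lemma
  assumes "core c"
  shows F_core_power: "F (int t) (c, False) \<approx> (\<omega> ^ t * c, False)"
    and P_core_power: "d dvd P (int t) (c, False) - int t"
proof -
  have "F (int t) (c, False) \<approx> (\<omega> ^ t * c, False) \<and> d dvd P (int t) (c, False) - int t"
  proof (induction t)
    case 0
    then show ?case using F_zero P_zero by simp
  next
    case (Suc t)
    let ?c = "\<omega> ^ t * c"
    have core: "core ?c" by (rule core_mult[OF assms])
    have Ft: "F (int t) (c, False) \<approx> (?c, False)" using Suc ..
    have "F (1 + int t) (c, False) \<approx> F 1 (?c, False)" by (rule dih_cong_trans[OF F_add F_cong[OF Ft]])
    also have "\<dots> \<approx> (\<omega> * ?c, False)" by (rule F1_core[OF core])
    finally have "F (1 + int t) (c, False) \<approx> (\<omega> * ?c, False)" .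
    moreover have "d dvd P (1 + int t) (c, False) - (1 + int t)"
      using P_cong[OF Ft, of 1] core_P1[OF core] P_add[of 1 "int t" "(c, False)"] conjunct2[OF Suc]
      by algebra
    ultimately show ?case by (simp add: mult.assoc)
  qed
  then show "F (int t) (c, False) \<approx> (\<omega> ^ t * c, False)" "d dvd P (int t) (c, False) - int t" by blast+
qed

lemma
  assumes "core c"
  shows F_core: "F t (c, False) \<approx> (\<omega> ^ nat (t mod d) * c, False)"
    and P_core: "d dvd P t (c, False) - t"
proof -
  define t' where "t' = nat (t mod d)"
  have t': "d dvd t - int t'" using d_pos by (simp add: t'_def mod_eq_dvd_iff[symmetric])
  show "F t (c, False) \<approx> (\<omega> ^ nat (t mod d) * c, False)"
    using dih_cong_trans[OF F_index_cong[OF t'] F_core_power[OF assms]] unfolding t'_def .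
  show "d dvd P t (c, False) - t"
    using P_index_cong[OF t', of "(c, False)"] P_core_power[OF assms, of t'] t' by algebra
qed

lemma rotation_not_core:
  assumes "\<not> is_ref j" "is_ref i"
  shows "\<not> core (s j)"
proof
  assume core: "core (s j)"
  have "F (i - j) (x j) \<approx> (\<omega> ^ nat ((i - j) mod d) * s j, False)"
    using F_core[OF core] x_rotation[OF assms(1)] by simp
  moreover have "F (i - j) (x j) \<approx> x i" using F_x[of "i - j" j] by simp
  ultimately show False using assms(2) by (simp add: dih_cong_def)
qed

lemma rotation_nontrivial: "\<not> is_ref j \<Longrightarrow> is_ref i \<Longrightarrow> \<not> n dvd s j"
  using rotation_not_core[of j i] core_cong[of "s j" 0] core_zero by auto

text \<open>The subgroup generated by \<open>a\<^sup>m\<close> is normal in the whole group, so it can be factored out.\<close>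

lemma F_quotient_cong:
  assumes core: "core m" and "m dvd n" and gh: "dih_cong m g h"
  shows "dih_cong m (F t g) (F t h)"
proof -
  define c where "c = fst g - fst h"
  have c: "core c" using gh core_mult[OF core] by (auto simp: dih_cong_def c_def mult.commute)
  let ?u = "\<omega> ^ nat (t mod d) * c"
  have g: "g = (c, False) \<cdot> h" using gh by (cases g; cases h) (auto simp: c_def)
  have "F t g \<approx> F t (c, False) \<cdot> F (P t (c, False)) h" unfolding g by (rule F_mult)
  also have "\<dots> \<approx> (?u, False) \<cdot> F t h" by (intro dih_cong_mult F_core F_index_cong P_core c)
  finally have "dih_cong m (F t g) ((?u, False) \<cdot> F t h)" using assms(2) by (rule dih_cong_dvd_modulus)
  also have "dih_cong m ((?u, False) \<cdot> F t h) (F t h)"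
    using gh by (cases "F t h") (auto simp: dih_cong_def c_def)
  finally show ?thesis .
qed

lemma x_quotient_shift:
  assumes "core m" "m dvd n" "dih_cong m (x i) (x j)"
  shows "dih_cong m (x (i + t)) (x (j + t))"
  using F_quotient_cong[OF assms] F_x[THEN dih_cong_dvd_modulus, OF assms(2)]
  by (meson dih_cong_euclidean dih_cong_trans)

lemma quotient_order:
  assumes "core k" "k dvd n"
  obtains e where "0 < e" "e dvd d" "\<And>i j. dih_cong k (x i) (x j) \<longleftrightarrow> e dvd i - j"
proof -
  define N where "N p \<longleftrightarrow> dih_cong k (x 0) (x p)" for p
  note shift = x_quotient_shift[OF assms]
  have "N d" unfolding N_def by (rule dih_cong_dvd_modulus[OF x_cong assms(2)]) simp
  moreover have "N (p + q)" if "N p" "N q" for p q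
    using that shift[of 0 q p] unfolding N_def by (metis add.commute add_0 dih_cong_trans)
  moreover have "N (- p)" if "N p" for p
    using shift[of 0 p "- p"] that unfolding N_def by (simp add: dih_cong_sym)
  ultimately obtain e where e: "0 < e" "\<And>p. N p \<longleftrightarrow> e dvd p"
    using int_subgroup_eq_multiples[of d N] d_pos by metis
  have "dih_cong k (x i) (x j) \<longleftrightarrow> N (j - i)" for i j
    using shift[of i j "- i"] shift[of 0 "j - i" i] unfolding N_def by auto
  then show ?thesis using that[of e] e \<open>N d\<close> by (simp add: dvd_diff_commute)
qed

lemma quotient_vertex_rotations:
  assumes k: "0 < k" "core k" "k dvd n"
  shows "\<exists>e. vertex_rotations k e x chi F P"
proof -
  obtain e where e: "0 < e" "e dvd d" "\<And>i j. dih_cong k (x i) (x j) \<longleftrightarrow> e dvd i - j"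
    using quotient_order[OF k(2,3)] by blast
  interpret quot: cyclic_generators k e x chi
  proof
    show "Q g" if "\<And>g h. dih_cong k g h \<Longrightarrow> Q g \<Longrightarrow> Q h" "Q (0, False)" "\<And>g i. Q g \<Longrightarrow> Q (g \<cdot> x i)" for Q g
      by (rule word_induct[of Q]) (use that dih_cong_dvd_modulus[OF _ k(3)] in blast)+
  qed (use k(1) e dih_cong_dvd_modulus[OF x_mult_x_chi k(3)] in auto)
  have "vertex_rotations k e x chi F P"
  proof
    show "quot.arc_map 1 (F t) (P t)" for t
      unfolding quot.arc_map_def
      using F_quotient_cong[OF k(2,3)] F_step dih_cong_dvd_modulus[OF _ k(3)] by simp
    show "dih_cong k (F t (0, False)) (0, False)" for t by (rule dih_cong_dvd_modulus[OF F_one k(3)])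
    show "e dvd P t (0, False) - t" for t using e(2) P_one by (rule dvd_trans)
  qed
  then show ?thesis ..
qed

end

section \<open>Distribution of the reflections\<close>

definition one_in :: "int \<Rightarrow> (int \<Rightarrow> int \<times> bool) \<Rightarrow> (int \<Rightarrow> int) \<Rightarrow> int \<Rightarrow> bool" where
  "one_in p x chi i0 \<longleftrightarrow> (\<forall>i. snd (x i) \<longleftrightarrow> p dvd i - i0) \<and> (\<forall>i. p dvd chi i + i - 2 * i0)"

definition two_in_3 :: "(int \<Rightarrow> int \<times> bool) \<Rightarrow> int \<Rightarrow> bool" where
  "two_in_3 x i0 \<longleftrightarrow> (\<forall>i. snd (x i) \<longleftrightarrow> \<not> 3 dvd i - i0 - 2)"

definition two_in_4 :: "(int \<Rightarrow> int \<times> bool) \<Rightarrow> (int \<Rightarrow> int) \<Rightarrow> int \<Rightarrow> bool" where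
  "two_in_4 x chi i0 \<longleftrightarrow> (\<forall>i. snd (x i) \<longleftrightarrow> 4 dvd i - i0 \<or> 4 dvd i - i0 - 1) \<and>
     (\<forall>i. \<not> snd (x i) \<longrightarrow> 4 dvd chi i + i - 2 * i0 - 5)"

definition reflection_pattern :: "(int \<Rightarrow> int \<times> bool) \<Rightarrow> (int \<Rightarrow> int) \<Rightarrow> int \<Rightarrow> bool" where
  "reflection_pattern x chi i \<longleftrightarrow>
     one_in 2 x chi i \<or> one_in 3 x chi i \<or> two_in_3 x i \<or> two_in_4 x chi i"

subsection \<open>Descents of antiperiodic words\<close>

lemma odd_number_of_changes:
  fixes w :: "int \<Rightarrow> bool"
  shows "odd (card {k \<in> {a..<a + int m}. w k \<noteq> w (k + 1)}) \<longleftrightarrow> w a \<noteq> w (a + int m)"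
proof (induction m)
  case (Suc m)
  let ?C = "\<lambda>m. {k \<in> {a..<a + int m}. w k \<noteq> w (k + 1)}"
  have interval: "{a..<a + int (Suc m)} = insert (a + int m) {a..<a + int m}" by auto
  have "?C (Suc m) = (if w (a + int m) \<noteq> w (a + int m + 1) then insert (a + int m) (?C m) else ?C m)"
    unfolding interval by auto
  moreover have "finite (?C m)" by (rule finite_subset[of _ "{a..<a + int m}"]) auto
  ultimately show ?case using Suc by (simp add: algebra_simps)
qed simp

lemma antiperiodic_shift:
  fixes w :: "int \<Rightarrow> bool" and H :: int
  assumes "\<And>k. w (k + H) \<longleftrightarrow> \<not> w k"
  shows "w (k + H * t) \<longleftrightarrow> (w k \<longleftrightarrow> even t)"
proof (induction t rule: int_induct[where k = 0])
  case (step1 t)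
  then show ?case using assms[of "k + H * t"] by (simp add: algebra_simps)
next
  case (step2 t)
  then show ?case using assms[of "k + H * (t - 1)"] by (auto simp: algebra_simps)
qed simp

text \<open>The number of descents of an antiperiodic word in one period is odd, hence not two.\<close>

lemma antiperiodic_third_descent:
  fixes w :: "int \<Rightarrow> bool" and H :: int
  assumes "0 < H" and anti: "\<And>k. w (k + H) \<longleftrightarrow> \<not> w k"
    and i: "w i" "\<not> w (i + 1)" and j: "w j" "\<not> w (j + 1)" and incongruent: "\<not> 2 * H dvd i - j"
  obtains k where "w k" "\<not> w (k + 1)" "\<not> 2 * H dvd k - i" "\<not> 2 * H dvd k - j"
proof (rule ccontr)
  assume "\<not> thesis"
  then have only: "2 * H dvd k - i \<or> 2 * H dvd k - j" if "w k" "\<not> w (k + 1)" for k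
    using that \<open>\<And>k. w k \<Longrightarrow> \<not> w (k + 1) \<Longrightarrow> \<not> 2 * H dvd k - i \<Longrightarrow> \<not> 2 * H dvd k - j \<Longrightarrow> thesis\<close> by blast
  note shift = antiperiodic_shift[of w, OF anti]
  have residue: "w (k mod H) \<noteq> w (k mod H + 1) \<longleftrightarrow> w k \<noteq> w (k + 1)" for k
  proof -
    have eq: "k mod H = k + H * - (k div H)" "k mod H + 1 = k + 1 + H * - (k div H)"
      by (simp_all add: minus_mult_div_eq_mod[symmetric])
    show ?thesis
      using shift[of k "- (k div H)", folded eq(1)] shift[of "k + 1" "- (k div H)", folded eq(2)]
      by auto
  qed
  have "{k \<in> {0..<H}. w k \<noteq> w (k + 1)} = {i mod H, j mod H}" (is "?C = _")
  proof (intro equalityI subsetI)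
    fix k assume k: "k \<in> ?C"
    then consider "w k" "\<not> w (k + 1)" | "w (k + H)" "\<not> w (k + H + 1)"
      using anti[of k] anti[of "k + 1"] by (auto simp: algebra_simps)
    then have "2 * H dvd k - i \<or> 2 * H dvd k - j \<or> 2 * H dvd k + H - i \<or> 2 * H dvd k + H - j"
      using only by cases blast+
    then have "H dvd k - i \<or> H dvd k - j \<or> H dvd k + H - i \<or> H dvd k + H - j"
      by (auto dest: dvd_mult_right)
    moreover have "H dvd k + H - l \<longleftrightarrow> H dvd k - l" for l
      using dvd_add_right_iff[of H H "k - l"] by (simp add: algebra_simps)
    ultimately have "H dvd k - i \<or> H dvd k - j" by blast
    moreover have "k mod H = k" using k by simp
    ultimately show "k \<in> {i mod H, j mod H}" by (metis insertCI mod_eq_dvd_iff)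
  qed (use residue[of i] residue[of j] i j \<open>0 < H\<close> in auto)
  moreover have "i mod H \<noteq> j mod H"
  proof
    assume "i mod H = j mod H"
    then obtain t where t: "i = j + H * t"
      by (metis dvdE mod_eq_dvd_iff add_diff_cancel_left' diff_add_cancel add.commute)
    then have "even t" using shift[of j t] i j by simp
    then show False using incongruent t by auto
  qed
  ultimately have "card ?C = 2" by simp
  moreover have "odd (card ?C)"
    using odd_number_of_changes[where a = 0 and m = "nat H" and w = w] anti[of 0] \<open>0 < H\<close> by simp
  ultimately show False by simp
qed

subsection \<open>Runs of reflections\<close>

context vertex_rotations
begin

definition boundary :: "int \<Rightarrow> bool" where
  "boundary i \<longleftrightarrow> is_ref i \<and> \<not> is_ref (i + 1)"

definition offset :: "int \<Rightarrow> int" where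
  "offset i = chi (i + 1) - i"

lemma adjacent_reflections_core:
  assumes "is_ref i" "is_ref (i + 1)" "is_ref j" "is_ref (j + 1)"
  shows "core (s i - s j)"
  using F_reflections_shift[of i j 1] P_reflections_shift[of i j 1] assms by (intro coreI)

lemma boundary_core:
  assumes "boundary i" "boundary j" and "d dvd offset i - offset j"
  shows "core (s i - s j)"
proof (rule coreI)
  have changes: "is_ref i" "\<not> is_ref (i + 1)" "is_ref j" "\<not> is_ref (j + 1)"
    using assms by (auto simp: boundary_def)
  have index: "d dvd (j - i + chi (i + 1)) - chi (j + 1)" using assms(3) unfolding offset_def by algebra
  show "d dvd P 1 (s i - s j, False) - 1"
    using P_reflection_pair[OF changes(1,3), of 1] chi_cong[OF index] chi_chi[of "j + 1"] by algebra
  show "F 1 (s i - s j, False) \<approx> (s (i + 1) + s (j - i + chi (i + 1)), False)"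
    using F_reflection_pair[OF changes(1,3), of 1] changes is_ref_cong[OF index]
    by (simp add: rotation_mult_x)
qed

lemma ex_boundary:
  assumes "is_ref y" "\<not> is_ref z"
  shows "\<exists>i. boundary i"
proof (rule ccontr)
  assume "\<nexists>i. boundary i"
  then have "is_ref (k + 1)" if "is_ref k" for k using that by (auto simp: boundary_def)
  with d_pos assms(1) have "is_ref z" by (rule residue_induct) (auto dest: is_ref_cong)
  with assms(2) show False ..
qed

lemma boundary_transfer:
  assumes "boundary k"
  shows "x m \<cdot> x (1 + chi m) \<approx> x (m + offset k) \<cdot> x (chi (m + offset k) - 1)"
  using reflection_rotation_transfer[of k "k + 1" "m - k"] assms
  by (simp add: boundary_def offset_def algebra_simps)

lemma boundary_period:
  assumes "boundary i" "boundary j"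
  shows "x (m + (offset i - offset j)) \<cdot> x (chi (m + (offset i - offset j)) - 1) \<approx> x m \<cdot> x (chi m - 1)"
  using dih_cong_euclidean[OF boundary_transfer[OF assms(1), of "m - offset j"] boundary_transfer[OF assms(2), of "m - offset j"]]
  by (simp add: algebra_simps)

lemma F_fixes_x_mult:
  assumes fixed: "\<And>m. F t (x m \<cdot> x (chi m - 1)) \<approx> x m \<cdot> x (chi m - 1)"
  shows "F t (x i \<cdot> x j) \<approx> x i \<cdot> x j"
proof -
  define Q where "Q j \<longleftrightarrow> F t (x i \<cdot> x j) \<approx> x i \<cdot> x j" for j
  have Q_cong: "Q k" if "x i \<cdot> x j \<approx> x i \<cdot> x k" "Q j" for j k
    using that F_cong[OF that(1)] unfolding Q_def by (meson dih_cong_euclidean dih_cong_trans)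
  have "Q (chi i - k)" for k
    using d_pos
  proof (induction k rule: residue_induct[of d "\<lambda>k. Q (chi i - k)" 0])
    case base
    have "F t (x i \<cdot> x (chi i)) \<approx> (0, False)" by (rule dih_cong_trans[OF F_cong[OF x_mult_x_chi] F_one])
    then have "F t (x i \<cdot> x (chi i)) \<approx> x i \<cdot> x (chi i)"
      using dih_cong_sym[OF x_mult_x_chi] by (rule dih_cong_trans)
    then show ?case by (simp add: Q_def)
  next
    case (step k)
    let ?j = "chi i - k"
    let ?v = "x (chi ?j) \<cdot> x (chi (chi ?j) - 1)"
    have "F t (x i \<cdot> x ?j \<cdot> ?v) \<approx> x i \<cdot> x ?j \<cdot> ?v"
      using F_fixed_mult step fixed unfolding Q_def by blast
    moreover have "x i \<cdot> x ?j \<cdot> ?v = x i \<cdot> (x ?j \<cdot> x (chi ?j) \<cdot> x (chi (chi ?j) - 1))"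
      by (simp add: dih_mult_assoc)
    moreover have "\<dots> \<approx> x i \<cdot> ((0, False) \<cdot> x (?j - 1))"
      using chi_chi[of ?j] by (intro dih_cong_mult dih_cong_refl x_mult_x_chi x_cong) algebra
    ultimately have "F t (x i \<cdot> x (?j - 1)) \<approx> x i \<cdot> x (?j - 1)"
      by simp (meson F_cong dih_cong_euclidean dih_cong_trans)
    then show ?case by (simp add: Q_def diff_diff_eq)
  next
    case (cong k l)
    have "d dvd (chi i - k) - (chi i - l)" using cong(1) by algebra
    then show ?case using Q_cong[OF x_mult_cong cong(2)] by simp
  qed
  from this[of "chi i - j"] show ?thesis by (simp add: Q_def)
qed

lemma translation_of_period:
  assumes "\<And>m. x (m + c) \<cdot> x (chi (m + c) - 1) \<approx> x m \<cdot> x (chi m - 1)"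
  shows "x (j + (chi c - chi 0)) \<approx> x (chi c) \<cdot> x 0 \<cdot> x j"
proof -
  let ?j = "j + (chi c - chi 0)"
  have "F c (x m \<cdot> x (chi m - 1)) \<approx> x m \<cdot> x (chi m - 1)" for m
    using dih_cong_trans[OF F_x_mult[of c m "chi m - 1"]] assms[of m] by simp
  then have "F c (x 0 \<cdot> x j) \<approx> x 0 \<cdot> x j" by (rule F_fixes_x_mult)
  with F_x_mult[of c 0 j] have shift: "x c \<cdot> x ?j \<approx> x 0 \<cdot> x j"
    by (simp add: algebra_simps) (rule dih_cong_euclidean)
  have "x (chi c) \<cdot> x c \<approx> x (chi c) \<cdot> x (chi (chi c))"
    using chi_chi[of c] by (intro x_mult_cong) (simp_all add: dvd_diff_commute)
  then have one: "x (chi c) \<cdot> x c \<approx> (0, False)" using x_mult_x_chi by (rule dih_cong_trans)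
  have "x ?j \<approx> x (chi c) \<cdot> x c \<cdot> x ?j"
    using dih_cong_sym[OF dih_cong_mult[OF one dih_cong_refl]] by simp
  also have "\<dots> \<approx> x (chi c) \<cdot> (x 0 \<cdot> x j)"
    using shift by (simp add: dih_mult_assoc dih_cong_mult_cancel_left)
  finally show ?thesis by (simp add: dih_mult_assoc)
qed

lemma
  assumes translation: "\<And>j. x (j + h) \<approx> (c, False) \<cdot> x j" and "is_ref j" "\<not> is_ref (j + t)"
  shows F_translation: "F t (c, False) \<approx> (- c, False)"
    and P_translation: "d dvd 2 * h \<Longrightarrow> d dvd P t (c, False) - t"
proof -
  have s_h: "n dvd s (j + h) - (c + s j)" and is_ref_h: "is_ref (j + h) = is_ref j" for j
    using translation[of j] by (auto simp: dih_cong_def dih_mult_def)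
  have ref_h: "is_ref (j + h)" using is_ref_h assms(2) by simp
  have rot: "\<not> is_ref (j + h + t)" "\<not> is_ref (chi (j + t) - h)" "\<not> is_ref (chi (j + t) - 2 * h)"
    using assms(3) is_ref_h[of "j + t"] is_ref_h[of "chi (j + t) - h"] is_ref_h[of "chi (j + t) - 2 * h"]
    by (simp_all add: algebra_simps)
  have s_chi_h: "n dvd s (chi (j + t) - h) - (c + s (chi (j + t) - 2 * h))"
    using s_h[of "chi (j + t) - 2 * h"] by simp
  have chi_h: "d dvd chi (j + h + t) - (chi (j + t) - h)"
  proof (rule chi_rotation[OF rot(1,2)])
    show "n dvd s (j + h + t) + s (chi (j + t) - h)"
      using s_h[of "j + t"] s_h[of "chi (j + t) - h"] s_chi[OF assms(3)]
      by (simp add: add.assoc add.commute[of t]) algebra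
  qed
  have index: "d dvd (j - (j + h) + chi (j + h + t)) - (chi (j + t) - 2 * h)" using chi_h by algebra
  have c_pair: "(s (j + h) - s j, False) \<approx> (c, False)" using s_h[of j] by (simp add: algebra_simps)
  have "F t (c, False) \<approx> F t (s (j + h) - s j, False)" by (rule dih_cong_sym[OF F_cong[OF c_pair]])
  also have "\<dots> \<approx> x (j + h + t) \<cdot> x (j - (j + h) + chi (j + h + t))"
    by (rule F_reflection_pair[OF ref_h assms(2)])
  also have "\<dots> \<approx> x (j + h + t) \<cdot> x (chi (j + t) - 2 * h)" by (rule x_mult_cong[OF _ index]) simp
  also have "\<dots> \<approx> (- c, False)"
    using rot s_h[of "j + t"] s_h[of "chi (j + t) - h"] s_chi_h s_chi[OF assms(3)]
    by (simp add: rotation_mult_x add.assoc add.commute[of t]) algebra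
  finally show "F t (c, False) \<approx> (- c, False)" .
  assume "d dvd 2 * h"
  then have "d dvd (j - (j + h) + chi (j + h + t)) - chi (j + t)" using index by algebra
  from chi_cong[OF this] chi_chi[of "j + t"] P_reflection_pair[OF ref_h assms(2), of t] P_cong[OF c_pair, of t]
  show "d dvd P t (c, False) - t" by algebra
qed

lemma fixed_rotation_unique:
  assumes "is_ref i" "\<not> is_ref j" "\<not> is_ref k" "d dvd chi j - j" "d dvd chi k - k"
  shows "d dvd j - k"
proof -
  have "n dvd 2 * s j" if "\<not> is_ref j" "d dvd chi j - j" for j
    using s_chi[OF that(1)] s_cong[OF that(2)] by algebra
  then have "n dvd s j - s k"
    using assms rotation_nontrivial by (intro two_torsion_unique) blast+
  then show ?thesis using assms by (intro index_cong) auto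
qed

end

locale core_free = vertex_rotations +
  assumes core_trivial: "\<And>c. core c \<Longrightarrow> n dvd c"
    and ex_ref: "\<exists>i. is_ref i" and ex_rot: "\<exists>i. \<not> is_ref i"
begin

lemma d_not_dvd_1: "\<not> d dvd 1"
proof
  assume "d dvd 1"
  then have "is_ref i = is_ref j" for i j by (intro is_ref_cong) (meson dvd_trans one_dvd)
  then show False using ex_ref ex_rot by blast
qed

lemma adjacent_reflections_unique:
  assumes "is_ref i" "is_ref (i + 1)" "is_ref j" "is_ref (j + 1)"
  shows "d dvd i - j"
  using core_trivial[OF adjacent_reflections_core[OF assms]] assms by (intro index_cong) auto

lemma no_three_reflections: "is_ref i \<Longrightarrow> is_ref (i + 1) \<Longrightarrow> \<not> is_ref (i + 2)"
  using adjacent_reflections_unique[of i "i + 1"] d_not_dvd_1 by (auto simp: add.assoc)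

lemma boundary_offset_inject:
  assumes "boundary i" "boundary j" "d dvd offset i - offset j"
  shows "d dvd i - j"
  using core_trivial[OF boundary_core[OF assms]] assms by (intro index_cong) (auto simp: boundary_def)

lemma boundary_chi:
  assumes "boundary i"
  shows "is_ref (chi (i + 1) + 1)"
proof (rule ccontr)
  let ?c = "chi (i + 1)"
  assume c: "\<not> is_ref (?c + 1)"
  have i: "is_ref i" "\<not> is_ref (i + 1)" using assms by (auto simp: boundary_def)
  have "x (i + 1) \<cdot> x (1 + ?c) \<approx> x (?c + 1) \<cdot> x (- 1 + chi (?c + 1))"
    using reflection_rotation_transfer[OF i, of 1] by simp
  then have "\<not> is_ref (chi (?c + 1) - 1)" "n dvd s (i + 1) - s (chi (?c + 1) - 1)"
    using i c by (simp_all add: rotation_mult_x algebra_simps)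
  then have "d dvd (i + 1) - (chi (?c + 1) - 1)" using i by (intro index_cong) auto
  then have index: "d dvd (i + 2) - chi (?c + 1)" by algebra
  have rot: "\<not> is_ref (i + 2)" using is_ref_cong[OF index] c by simp
  have x_succ: "x (i + 1) = (s (i + 1), False)" using i by (intro x_rotation) auto
  have "core (s (i + 1))"
  proof (rule coreI)
    show "F 1 (s (i + 1), False) \<approx> (s (i + 2), False)"
      using F_x[of 1 "i + 1"] x_rotation[OF rot] unfolding x_succ[symmetric] by (simp add: add.assoc)
    show "d dvd P 1 (s (i + 1), False) - 1"
      using P_x[of 1 "i + 1"] chi_cong[OF index] chi_chi[of "?c + 1"]
      unfolding x_succ[symmetric] by (simp add: add.assoc) algebra
  qed
  then show False using rotation_not_core i by blast
qed

lemma no_rotational_translation: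
  assumes translation: "\<And>k. x (k + h) \<approx> (v, False) \<cdot> x k" and h: "\<not> d dvd h"
    and i: "boundary i" and aperiodic: "is_ref k" "\<not> is_ref (k + 2)"
  shows False
proof (cases "n dvd 2 * v")
  case True
  have ref_i: "is_ref i" "\<not> is_ref (i + 1)" using i by (auto simp: boundary_def)
  have "x (0 + h + h) \<approx> (v, False) \<cdot> ((v, False) \<cdot> x 0)"
    using dih_cong_trans[OF translation[of "0 + h"] dih_cong_mult[OF dih_cong_refl translation[of 0]]] .
  also have "\<dots> \<approx> x 0" using True by (simp add: dih_cong_def dih_mult_def)
  finally have "d dvd 2 * h" using x_inj by fastforce
  then have "core v"
    using coreI[OF F_translation[OF translation ref_i] P_translation[OF translation ref_i]] by blast
  then have "(v, False) \<cdot> x 0 \<approx> x 0" using core_trivial by (simp add: dih_cong_def dih_mult_def)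
  with translation[of 0] have "x (0 + h) \<approx> x 0" by (rule dih_cong_trans)
  then show False using x_inj h by fastforce
next
  case False
  have ref_i: "is_ref i" "\<not> is_ref (i + 1)" using i by (auto simp: boundary_def)
  have F_1_v: "F 1 (v, False) \<approx> (- v, False)" by (rule F_translation[OF translation ref_i])
  have backwards: "x (j + - h) \<approx> (- v, False) \<cdot> x j" for j
  proof -
    have "(v, False) \<cdot> x (j + - h) \<approx> (v, False) \<cdot> ((- v, False) \<cdot> x j)"
      using dih_cong_sym[OF translation[of "j - h"]] by (simp flip: dih_mult_assoc)
    then show ?thesis by (simp only: dih_cong_mult_cancel_left)
  qed
  have "F 2 (v, False) \<approx> F 1 (- v, False)" using dih_cong_trans[OF F_add F_cong[OF F_1_v], of 1] by simp
  also have "\<dots> \<approx> (v, False)" using F_translation[OF backwards ref_i] by simp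
  finally have "(v, False) \<approx> (- v, False)"
    using F_translation[OF translation aperiodic] dih_cong_euclidean by blast
  then show False using False by simp
qed

lemma two_boundaries_antiperiod:
  assumes i: "boundary i" and j: "boundary j" and incongruent: "\<not> d dvd i - j"
    and aperiodic: "is_ref a" "\<not> is_ref (a + 2)"
  defines "h \<equiv> chi (offset i - offset j) - chi 0"
  shows "d dvd 2 * h" and "\<not> d dvd h" and "is_ref (k + h) \<longleftrightarrow> \<not> is_ref k"
proof -
  have "\<not> d dvd offset i - offset j" using boundary_offset_inject[OF i j] incongruent by blast
  then show h: "\<not> d dvd h" using chi_inject[of "offset i - offset j" 0] by (auto simp: h_def)
  define u where "u = x (chi (offset i - offset j)) \<cdot> x 0"
  have translation: "x (k + h) \<approx> u \<cdot> x k" for k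
    unfolding h_def u_def by (rule translation_of_period[OF boundary_period[OF i j]])
  have u: "snd u"
  proof (rule ccontr)
    assume "\<not> snd u"
    then have "u = (fst u, False)" by (simp add: prod_eq_iff)
    then show False using no_rotational_translation[OF _ h i aperiodic, of "fst u"] translation by metis
  qed
  then show "is_ref (k + h) \<longleftrightarrow> \<not> is_ref k"
    using translation[of k] by (auto simp: dih_cong_def dih_mult_def)
  have "x (0 + h + h) \<approx> u \<cdot> (u \<cdot> x 0)"
    using dih_cong_trans[OF translation[of "0 + h"] dih_cong_mult[OF dih_cong_refl translation[of 0]]] .
  also have "\<dots> = x 0" using u by (simp add: dih_mult_def prod_eq_iff)
  finally show "d dvd 2 * h" using x_inj by fastforce
qed

lemma boundary_unique:
  assumes aperiodic: "is_ref a" "\<not> is_ref (a + 2)" and i: "boundary i" and j: "boundary j"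
  shows "d dvd i - j"
proof (rule ccontr)
  assume incongruent: "\<not> d dvd i - j"
  note antiperiod = two_boundaries_antiperiod[OF i _ _ aperiodic]
  obtain H where H: "d = 2 * H" "d dvd chi (offset i - offset j) - chi 0 - H"
    using two_torsion_half[OF antiperiod(1,2)[OF j incongruent]] .
  have "is_ref (k + H) \<longleftrightarrow> \<not> is_ref k" for k
    using antiperiod(3)[OF j incongruent, of k] is_ref_cong[of "k + (chi (offset i - offset j) - chi 0)" "k + H"] H(2) by simp
  moreover have "0 < H" using d_pos H(1) by simp
  ultimately obtain k where k: "boundary k" "\<not> d dvd k - i" "\<not> d dvd k - j"
    using antiperiodic_third_descent[of H is_ref i j] i j incongruent by (auto simp: boundary_def H(1))
  then have incongruent_k: "\<not> d dvd i - k" by (simp add: dvd_diff_commute)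
  have "d dvd (chi (offset i - offset j) - chi 0) - (chi (offset i - offset k) - chi 0)"
    using antiperiod(1,2)[OF j incongruent] antiperiod(1,2)[OF k(1) incongruent_k]
    by (rule two_torsion_unique)
  then have "d dvd chi (offset i - offset j) - chi (offset i - offset k)" by simp
  then have "d dvd (offset i - offset j) - (offset i - offset k)" by (rule chi_inject)
  then have "d dvd offset k - offset j" by algebra
  then show False using boundary_offset_inject[OF k(1) j] k(3) by blast
qed

end

subsection \<open>Few reflections\<close>

context vertex_rotations
begin

context
  fixes i :: int
  assumes single: "\<And>y. is_ref y \<longleftrightarrow> d dvd y - i"
begin

lemma single_reflection_pair:
  assumes j: "\<not> is_ref j" and k: "\<not> is_ref k" and k_not_j: "\<not> d dvd k - j"
    and k_not_chi_j: "\<not> d dvd k - chi j"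
  shows "d dvd (j + k) - (chi j + chi k)"
proof -
  have i: "is_ref i" using single by simp
  let ?a = "k + chi i - chi j" and ?c = "k + i - j"
  let ?b = "j + chi ?c - chi k"
  have prod: "x i \<cdot> x ?a \<approx> x ?c \<cdot> x ?b"
    using rotation_rotation_transfer[OF j k, of "i - j"] by (simp add: algebra_simps)
  have c: "\<not> is_ref ?c" using k_not_j by (simp add: single)
  have "d dvd ?a - i \<longleftrightarrow> d dvd k - chi j"
    using dvd_add_right_iff[OF chi_reflection[OF i], of "k - chi j"] by (simp add: algebra_simps)
  then have a: "\<not> is_ref ?a" using k_not_chi_j by (simp add: single)
  have b: "is_ref ?b" and s_abc: "n dvd (s i - s ?a) - (s ?c + s ?b)"
    using prod i a c by (simp_all add: reflection_mult_x rotation_mult_x)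
  have b_cong_i: "d dvd ?b - i" using b single by simp
  have "n dvd s ?a + s ?c" using s_abc s_cong[OF b_cong_i] by algebra
  then have "d dvd chi ?a - ?c" using a c by (intro chi_rotation)
  from chi_swap[OF this] b_cong_i chi_reflection[OF i] show ?thesis by algebra
qed

lemma single_reflection_not_fixed:
  assumes "3 \<le> d" and j: "\<not> is_ref j"
  shows "\<not> d dvd chi j - j"
proof
  assume fixed: "d dvd chi j - j"
  have "int (card {i, j}) < d" using assms(1) by (simp add: card_insert_if)
  then obtain k where k: "\<not> is_ref k" "\<not> d dvd k - j"
    using exists_incongruent[of "{i, j}" d] by (auto simp: single)
  have "d dvd k - j" if "d dvd k - chi j" using that fixed by algebra
  with k(2) have "\<not> d dvd k - chi j" by blast
  from single_reflection_pair[OF j k this] fixed have "d dvd chi k - k" by algebra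
  moreover have "is_ref i" using single by simp
  ultimately have "d dvd j - k" using fixed_rotation_unique[OF _ j k(1) fixed] by blast
  then show False using k(2) by (simp add: dvd_diff_commute)
qed

lemma single_reflection_d_le_3: "d \<le> 3"
proof (rule ccontr)
  assume "\<not> d \<le> 3"
  then have d: "3 \<le> d" "4 \<le> d" by simp_all
  have half: "d dvd 2 * (chi j - j)" if j: "\<not> is_ref j" for j
  proof -
    have "int (card {i, j, chi j}) < d" using d by (simp add: card_insert_if)
    then obtain k where k: "\<not> is_ref k" "\<not> d dvd k - j" "\<not> d dvd k - chi j"
      using exists_incongruent[of "{i, j, chi j}" d] by (auto simp: single)
    have chi_k: "\<not> is_ref (chi k)" "\<not> d dvd chi k - j" "\<not> d dvd chi k - chi j"
      using k chi_swap[of k j] chi_inject[of k j] by (auto simp: dvd_diff_commute)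
    show ?thesis
      using single_reflection_pair[OF j k] single_reflection_pair[OF j chi_k] chi_chi[of k] by algebra
  qed
  obtain j where j: "\<not> is_ref j" using exists_incongruent[of "{i}" d] d by (auto simp: single)
  define w where "w = chi j - j"
  have w: "d dvd 2 * w" "\<not> d dvd w"
    using half[OF j] single_reflection_not_fixed[OF d(1) j] by (simp_all add: w_def)
  have rot: "\<not> is_ref (i + w)" using single w(2) by simp
  have "d dvd (chi (i + w) - (i + w)) - w"
    by (rule two_torsion_unique[OF half[OF rot] single_reflection_not_fixed[OF d(1) rot] w])
  then have "d dvd chi (i + w) - i" using w(1) by algebra
  then show False using single rot by (metis is_ref_chi)
qed

lemma single_reflection_pattern:
  assumes "\<not> d dvd 1"
  shows "one_in 2 x chi i \<or> one_in 3 x chi i"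
proof -
  have "d \<noteq> 1" using assms by auto
  then consider (d_2) "d = 2" | (d_3) "d = 3" using single_reflection_d_le_3 d_pos by linarith
  then show ?thesis
  proof cases
    case d_2
    have "2 dvd chi k + k - 2 * i" for k using single[of k] single[of "chi k"] d_2 by auto
    then show ?thesis using single d_2 by (simp add: one_in_def)
  next
    case d_3
    have "3 dvd chi k + k - 2 * i" for k
    proof (cases "is_ref k")
      case True
      then have "3 dvd k - i" "3 dvd chi k - i" using single[of k] single[of "chi k"] d_3 by simp_all
      then show ?thesis by presburger
    next
      case False
      then have "\<not> 3 dvd chi k - i" "\<not> 3 dvd k - i" "\<not> 3 dvd chi k - k"
        using single[of "chi k"] single[of k] single_reflection_not_fixed[of k] d_3 by simp_all
      then show ?thesis by presburger
    qed
    then show ?thesis using single d_3 by (simp add: one_in_def)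
  qed
qed

end

context
  fixes a :: int
  assumes double: "\<And>y. is_ref y \<longleftrightarrow> d dvd y - a \<or> d dvd y - (a + 1)" and d_ge_3: "3 \<le> d"
    and ref_after_chi: "is_ref (chi (a + 2) + 1)"
begin

lemma rotation_a2: "\<not> is_ref (a + 2)"
  using zdvd_not_zless[of 2 d] zdvd_not_zless[of 1 d] d_ge_3 by (simp add: double)

lemma chi_a2: "d dvd chi (a + 2) - (a - 1)"
proof -
  have "\<not> is_ref (chi (a + 2))" using rotation_a2 by simp
  then show ?thesis using ref_after_chi unfolding double by (auto simp: algebra_simps)
qed

lemma double_reflection_d_eq_4:
  assumes "d = 4"
  shows "two_in_4 x chi a"
proof -
  have "4 dvd chi i + i - 2 * a - 5" if "\<not> is_ref i" for i
  proof -
    have "4 dvd i - (a + 2) \<or> 4 dvd i - (a - 1)" using that unfolding double assms by presburger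
    then show ?thesis
    proof
      assume i: "4 dvd i - (a + 2)"
      with chi_cong[of i "a + 2"] chi_a2 show ?thesis unfolding assms by presburger
    next
      assume i: "4 dvd i - (a - 1)"
      with chi_cong[of i "a - 1"] chi_swap[OF chi_a2] show ?thesis unfolding assms by presburger
    qed
  qed
  then show ?thesis using double assms by (auto simp: two_in_4_def algebra_simps)
qed

lemma double_reflection_d_less_5: "d < 5"
proof (rule ccontr)
  assume "\<not> d < 5"
  then have small: "\<not> d dvd 2" "\<not> d dvd 3" "\<not> d dvd 4" using zdvd_not_zless[of _ d] by auto
  have ref: "is_ref a" "is_ref (a + 1)" and rot: "\<not> is_ref (a - 2)"
    using small by (simp_all add: double)
  define g where "g = chi (a - 2) - 1"
  define b where "b = 2 * (a - 2) - chi g"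
  have factored: "x a \<cdot> x (a + 1) \<approx> x (a - 2) \<cdot> x g"
  proof (rule x_mult_reindex[OF reflection_rotation_transfer[OF ref(2) rotation_a2, of "- 1"]])
    show "d dvd chi (a + 2) + - 1 - (a - 2)" using chi_a2 by algebra
    then have "d dvd chi (chi (a + 2) + - 1) - chi (a - 2)" by (rule chi_cong)
    then show "d dvd (a + 1) - (a + 2) + chi (chi (a + 2) + - 1) - g" unfolding g_def by algebra
    show "d dvd a + 2 - (a + 1) + chi (a + 1 + - 1) - (a + 1)" using chi_reflection[OF ref(1)] by simp
  qed simp
  then have g: "\<not> is_ref g" and s_g: "n dvd (s a - s (a + 1)) - (s (a - 2) + s g)"
    using ref rot by (simp_all add: reflection_mult_x rotation_mult_x)
  have commuted: "x a \<cdot> x (a + 1) \<approx> x g \<cdot> x (a - 2)"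
    using factored rot g by (simp add: rotation_mult_x add.commute)
  have "x (a + 1) \<cdot> x (a + 2) \<approx> x (chi (a - 2)) \<cdot> x b"
  proof (rule x_mult_reindex[OF x_mult_transfer[OF commuted, of 1]])
    show "d dvd a + 1 + chi (a + 1) - chi a - (a + 2)"
      using chi_reflection[OF ref(1)] chi_reflection[OF ref(2)] by algebra
    show "d dvd a - 2 + chi (g + 1) - chi g - b"
      using chi_chi[of "a - 2"] by (simp add: g_def b_def) algebra
  qed (simp_all add: g_def)
  then have b: "is_ref b" and s_b: "n dvd (s (a + 1) - s (a + 2)) - (s (chi (a - 2)) + s b)"
    using ref rotation_a2 rot by (simp_all add: reflection_mult_x rotation_mult_x)
  from b consider (first) "d dvd b - a" | (second) "d dvd b - (a + 1)" using double by blast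
  then show False
  proof cases
    case first
    have "n dvd s (a + 2) + s g" using s_g s_b s_cong[OF first] s_chi[OF rot] by algebra
    then have "d dvd chi (a + 2) - g" using rotation_a2 g by (intro chi_rotation)
    then have "d dvd chi (a - 2) - a" using chi_a2 unfolding g_def by algebra
    then have "is_ref (chi (a - 2))" using double by blast
    then show False using rot by simp
  next
    case second
    have "n dvd s (a + 2) - s (a - 2)" using s_b s_cong[OF second] s_chi[OF rot] by algebra
    then have "d dvd (a + 2) - (a - 2)" using rotation_a2 rot by (intro index_cong) auto
    then show False using small by simp
  qed
qed

lemma double_reflection_pattern: "two_in_3 x a \<or> two_in_4 x chi a"
proof (cases "d = 4")
  case False
  then have d: "d = 3" using double_reflection_d_less_5 d_ge_3 by simp
  have "is_ref i \<longleftrightarrow> \<not> 3 dvd i - a - 2" for i unfolding double d by presburger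
  then show ?thesis by (simp add: two_in_3_def)
qed (simp add: double_reflection_d_eq_4)

end

lemma alternating_pattern:
  assumes "is_ref i" "\<not> is_ref (i + 1)" and periodic: "\<And>k. is_ref k \<Longrightarrow> is_ref (k + 2)"
  shows "one_in 2 x chi i"
proof -
  have even_shift: "is_ref (k + 2 * m)" if "is_ref k" for k m
    using d_pos
  proof (induction m rule: residue_induct[of d "\<lambda>m. is_ref (k + 2 * m)" 0])
    case (step m)
    then show ?case using periodic[of "k + 2 * m"] by (simp add: algebra_simps)
  next
    case (cong m m')
    have "d dvd (k + 2 * m) - (k + 2 * m')" using cong(1) by algebra
    then show ?case using is_ref_cong cong(2) by blast
  qed (simp add: that)
  have ref: "is_ref j \<longleftrightarrow> 2 dvd j - i" for j
  proof
    assume j: "is_ref j"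
    show "2 dvd j - i"
    proof (rule ccontr)
      assume "\<not> 2 dvd j - i"
      then have "2 dvd i + 1 - j" by presburger
      then obtain m where "i + 1 - j = 2 * m" ..
      then have "i + 1 = j + 2 * m" by simp
      then show False using even_shift[OF j, of m] assms(2) by simp
    qed
  next
    assume "2 dvd j - i"
    then obtain m where "j - i = 2 * m" ..
    then have "j = i + 2 * m" by simp
    then show "is_ref j" using even_shift[OF assms(1)] by simp
  qed
  have "2 dvd chi k + k - 2 * i" for k
  proof -
    have "2 dvd k - i \<longleftrightarrow> 2 dvd chi k - i" using ref is_ref_chi by blast
    then show ?thesis by presburger
  qed
  then show ?thesis using ref by (simp add: one_in_def)
qed

end

subsection \<open>The patterns\<close>

context core_free
begin

lemma aperiodic_pattern:
  assumes aperiodic: "is_ref a" "\<not> is_ref (a + 2)"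
  shows "\<exists>i. reflection_pattern x chi i"
proof -
  obtain i where i: "boundary i" using ex_boundary ex_ref ex_rot by blast
  have last: "d dvd y - i" if "is_ref y" "\<not> is_ref (y + 1)" for y
    using boundary_unique[OF aperiodic _ i, of y] that unfolding boundary_def by blast
  have last_but_one: "d dvd y - (i - 1)" if "is_ref y" "is_ref (y + 1)" for y
    using last[of "y + 1"] no_three_reflections[OF that] that by (simp add: algebra_simps)
  show ?thesis
  proof (cases "is_ref (i - 1)")
    case False
    have "is_ref y \<longleftrightarrow> d dvd y - i" for y
    proof
      assume y: "is_ref y"
      then have "\<not> is_ref (y + 1)" using last_but_one is_ref_cong False by blast
      then show "d dvd y - i" by (rule last[OF y])
    next
      assume "d dvd y - i"
      then show "is_ref y" using is_ref_cong i unfolding boundary_def by blast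
    qed
    then show ?thesis
      using single_reflection_pattern[OF _ d_not_dvd_1] unfolding reflection_pattern_def by blast
  next
    case True
    have double: "is_ref y \<longleftrightarrow> d dvd y - (i - 1) \<or> d dvd y - (i - 1 + 1)" for y
    proof
      assume "is_ref y"
      then show "d dvd y - (i - 1) \<or> d dvd y - (i - 1 + 1)"
        using last[of y] last_but_one[of y] by (cases "is_ref (y + 1)") simp_all
    next
      assume "d dvd y - (i - 1) \<or> d dvd y - (i - 1 + 1)"
      then show "is_ref y"
        using is_ref_cong[of y "i - 1"] is_ref_cong[of y i] True i unfolding boundary_def by auto
    qed
    have "d \<noteq> 2"
    proof
      assume "d = 2"
      then have "is_ref y" for y unfolding double by presburger
      then show False using ex_rot by blast
    qed
    moreover have "d \<noteq> 1" using d_not_dvd_1 by auto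
    ultimately have "3 \<le> d" using d_pos by linarith
    moreover have "is_ref (chi (i - 1 + 2) + 1)" using boundary_chi[OF i] by (simp add: algebra_simps)
    ultimately show ?thesis
      using double_reflection_pattern[OF double] unfolding reflection_pattern_def by blast
  qed
qed

lemma core_free_pattern: "\<exists>i. reflection_pattern x chi i"
proof (cases "\<forall>k. is_ref k \<longrightarrow> is_ref (k + 2)")
  case True
  obtain i where "boundary i" using ex_boundary ex_ref ex_rot by blast
  then have "one_in 2 x chi i" using True by (intro alternating_pattern) (auto simp: boundary_def)
  then show ?thesis unfolding reflection_pattern_def by blast
qed (use aperiodic_pattern in blast)

end

theorem ex_reflection_pattern:
  assumes "vertex_rotations n d x chi F P" "snd (x i)" "\<not> snd (x j)"
  shows "\<exists>i. reflection_pattern x chi i"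
  using assms
proof (induction "nat n" arbitrary: n d rule: less_induct)
  case less
  interpret vertex_rotations n d x chi F P by fact
  obtain k where k: "0 < k" "k dvd n" "\<And>c. core c \<longleftrightarrow> k dvd c" by (rule core_generator) blast
  show ?case
  proof (cases "k = n")
    case True
    interpret core_free n d x chi F P
      by unfold_locales (use k True less.prems in auto)
    show ?thesis by (rule core_free_pattern)
  next
    case False
    then have "nat k < nat n" using zdvd_imp_le[OF k(2) n_pos] k(1) by simp
    moreover obtain e where "vertex_rotations k e x chi F P"
      using quotient_vertex_rotations[of k] k by auto
    ultimately show ?thesis using less.hyps less.prems by blast
  qed
qed

section \<open>Consequences of the mirror symmetry\<close>

text \<open>\<open>G\<close> is the orientation-reversing automorphism that fixes the vertex \<open>1\<close> and maps \<open>x i\<close> to \<open>x (- i)\<close>.\<close>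

locale mirror_rotations = vertex_rotations +
  fixes G :: "int \<times> bool \<Rightarrow> int \<times> bool" and S :: "int \<times> bool \<Rightarrow> int"
  assumes G_arc_map: "arc_map (- 1) G S" and G_one: "G (0, False) \<approx> (0, False)"
    and S_one: "d dvd S (0, False)"
begin

lemmas G_cong = arc_map_cong[OF G_arc_map] and S_cong = arc_map_turn_cong[OF G_arc_map]

lemma G_step: "G (g \<cdot> x i) \<approx> G g \<cdot> x (S g - i)"
  using arc_map_step[OF G_arc_map, of g i] by simp

lemma S_step: "d dvd S (g \<cdot> x i) - (chi (S g - i) + chi i)"
  using arc_map_turn_step[OF G_arc_map, of g i] by simp

lemma
  shows G_mult: "G (g \<cdot> h) \<approx> G g \<cdot> F (S g) (G h)" and S_mult: "d dvd S (g \<cdot> h) - (S h + P (S g) (G h))"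
proof -
  have comp: "arc_map (- 1) (\<lambda>h. G g \<cdot> F (S g) (G h)) (\<lambda>h. S h + P (S g) (G h))"
    using arc_map_translated[OF arc_map_comp[OF F_arc_map G_arc_map]] by simp
  have "F (S g) (G (0, False)) \<approx> (0, False)" by (rule dih_cong_trans[OF F_cong[OF G_one] F_one])
  then have "G (g \<cdot> (0, False)) \<approx> G g \<cdot> F (S g) (G (0, False))"
    using dih_cong_mult[OF dih_cong_refl dih_cong_sym] by fastforce
  moreover have "d dvd S (g \<cdot> (0, False)) - (S (0, False) + P (S g) (G (0, False)))"
    using S_one P_cong[OF G_one, of "S g"] P_one[of "S g"] unfolding dih_mult_one by algebra
  ultimately show "G (g \<cdot> h) \<approx> G g \<cdot> F (S g) (G h)" "d dvd S (g \<cdot> h) - (S h + P (S g) (G h))"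
    using arc_map_unique[OF arc_map_translated_arg[OF G_arc_map] comp] by blast+
qed

lemma
  shows G_F: "G (F t g) \<approx> F (- t) (G g)" and S_F: "d dvd (S (F t g) - P t g) - (S g + P (- t) (G g))"
proof -
  have GF: "arc_map (- 1) (\<lambda>g. G (F t g)) (\<lambda>g. S (F t g) - P t g)"
    using arc_map_comp[OF G_arc_map F_arc_map, of t] by (simp add: algebra_simps)
  have FG: "arc_map (- 1) (\<lambda>g. F (- t) (G g)) (\<lambda>g. S g + P (- t) (G g))"
    using arc_map_comp[OF F_arc_map G_arc_map, of "- t"] by simp
  have "G (F t (0, False)) \<approx> (0, False)" "F (- t) (G (0, False)) \<approx> (0, False)"
    using dih_cong_trans[OF G_cong[OF F_one] G_one] dih_cong_trans[OF F_cong[OF G_one] F_one] .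
  then have "G (F t (0, False)) \<approx> F (- t) (G (0, False))" by (meson dih_cong_sym dih_cong_trans)
  moreover have "d dvd (S (F t (0, False)) - P t (0, False)) - (S (0, False) + P (- t) (G (0, False)))"
    using P_cong[OF G_one, of "- t"] P_one[of "- t"] S_cong[OF F_one[of t]] P_one[of t] by algebra
  ultimately show "G (F t g) \<approx> F (- t) (G g)" "d dvd (S (F t g) - P t g) - (S g + P (- t) (G g))"
    using arc_map_unique[OF GF FG] by blast+
qed

lemma G_x: "G (x i) \<approx> x (- i)"
proof -
  have "G ((0, False) \<cdot> x i) \<approx> G (0, False) \<cdot> x (S (0, False) - i)" by (rule G_step)
  also have "\<dots> \<approx> (0, False) \<cdot> x (- i)" using S_one by (intro dih_cong_mult G_one x_cong) simp
  finally show ?thesis by simp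
qed

lemma S_x: "d dvd S (x i) - (chi (- i) + chi i)"
proof -
  have "d dvd chi (S (0, False) - i) - chi (- i)" using S_one by (intro chi_cong) simp
  then show ?thesis using S_step[of "(0, False)" i] unfolding dih_mult_one by algebra
qed

lemma G_x_mult: "G (x i \<cdot> x j) \<approx> x (- i) \<cdot> x (chi (- i) + chi i - j)"
proof -
  have "G (x i \<cdot> x j) \<approx> G (x i) \<cdot> x (S (x i) - j)" by (rule G_step)
  also have "\<dots> \<approx> x (- i) \<cdot> x (chi (- i) + chi i - j)"
    using S_x[of i] by (intro dih_cong_mult G_x x_cong) algebra
  finally show ?thesis .
qed

lemma S_x_mult: "d dvd S (x i \<cdot> x j) - (chi (chi (- i) + chi i - j) + chi j)"
proof -
  have "d dvd chi (S (x i) - j) - chi (chi (- i) + chi i - j)"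
    using S_x[of i] by (intro chi_cong) algebra
  with S_step[of "x i" j] show ?thesis by algebra
qed

lemma
  assumes c: "G (c, False) \<approx> (c', False)" "d dvd S (c, False)"
  shows G_rotation_mult: "G (m * c, False) \<approx> (m * c', False)"
    and S_rotation_mult: "d dvd S (m * c, False)"
proof -
  have succ: "G ((m + 1) * c, False) \<approx> (c', False) \<cdot> G (m * c, False)"
    "d dvd S ((m + 1) * c, False) - (S (m * c, False) + 0)" for m
  proof -
    let ?g = "(m * c, False)"
    have succ_multiple: "((m + 1) * c, False) = (c, False) \<cdot> ?g" by (simp add: algebra_simps)
    have S_zero: "d dvd S (c, False) - 0" using c(2) by simp
    have "G ((m + 1) * c, False) \<approx> G (c, False) \<cdot> F (S (c, False)) (G ?g)"
      unfolding succ_multiple by (rule G_mult)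
    also have "\<dots> \<approx> (c', False) \<cdot> F 0 (G ?g)" by (intro dih_cong_mult c(1) F_index_cong S_zero)
    also have "\<dots> \<approx> (c', False) \<cdot> G ?g" by (intro dih_cong_mult dih_cong_refl F_zero)
    finally show "G ((m + 1) * c, False) \<approx> (c', False) \<cdot> G ?g" .
    show "d dvd S ((m + 1) * c, False) - (S ?g + 0)"
      using S_mult[of "(c, False)" ?g] P_index_cong[OF S_zero, of "G ?g"] P_zero[of "G ?g"]
      unfolding succ_multiple by algebra
  qed
  show "G (m * c, False) \<approx> (m * c', False)"
    using G_one succ(1) by (intro dih_cong_progression[of n "\<lambda>m. G (m * c, False)"]) simp_all
  show "d dvd S (m * c, False)"
    using int_progression_cong[of d "\<lambda>m. S (m * c, False)" 0 0] S_one succ(2) by simp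
qed

text \<open>The reflection inverts the rotation about \<open>1\<close>, so both act alike on the abelian core.\<close>

lemma eigenvalue_square_reflected:
  assumes "core c" "G (c, False) \<approx> (c', False)" "d dvd S (c, False)" "core c'"
  shows "n dvd \<omega> * \<omega> * c' - c'"
proof -
  have "(\<omega> * c', False) \<approx> G (\<omega> * c, False)" by (rule dih_cong_sym[OF G_rotation_mult[OF assms(2,3)]])
  also have "\<dots> \<approx> G (F 1 (c, False))" by (rule G_cong[OF dih_cong_sym[OF F1_core[OF assms(1)]]])
  also have "\<dots> \<approx> F (- 1) (G (c, False))" by (rule G_F)
  also have "\<dots> \<approx> F (- 1) (c', False)" by (rule F_cong[OF assms(2)])
  finally have "F 1 (\<omega> * c', False) \<approx> F 1 (F (- 1) (c', False))" by (rule F_cong)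
  also have "\<dots> \<approx> (c', False)" by (rule F_inverse)
  finally have "F 1 (\<omega> * c', False) \<approx> (c', False)" .
  with F1_core[OF core_mult[OF assms(4)]] have "(\<omega> * (\<omega> * c'), False) \<approx> (c', False)"
    by (rule dih_cong_euclidean)
  then show ?thesis by (simp add: mult.assoc)
qed

lemma
  assumes "is_ref 0" "is_ref i" "is_ref (- i)"
  shows G_reflection_pair: "G (s i - s 0, False) \<approx> (s (- i) - s 0, False)"
    and S_reflection_pair: "d dvd S (s i - s 0, False)"
proof -
  have product: "x i \<cdot> x 0 = (s i - s 0, False)" using assms by (simp add: reflection_mult_x)
  have index: "d dvd (chi (- i) + chi i - 0) - 0"
    using chi_reflection[OF assms(2)] chi_reflection[OF assms(3)] by algebra
  have "G (x i \<cdot> x 0) \<approx> x (- i) \<cdot> x 0"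
    by (rule dih_cong_trans[OF G_x_mult x_mult_cong[OF _ index]]) simp
  then show "G (s i - s 0, False) \<approx> (s (- i) - s 0, False)"
    unfolding product using assms by (simp add: reflection_mult_x)
  show "d dvd S (s i - s 0, False)"
    using S_x_mult[of i 0, unfolded product] chi_cong[OF index] chi_reflection[OF assms(1)] by algebra
qed

subsection \<open>Only reflections\<close>

context
  assumes all_ref: "\<And>i. is_ref i"
begin

lemma all_reflections_gap_step: "n dvd s (i + 1) - s (j + 1) - \<omega> * (s i - s j)"
proof -
  have "core (s i - s j)" by (intro adjacent_reflections_core all_ref)
  from dih_cong_euclidean[OF F_reflections_shift F1_core[OF this], OF all_ref all_ref all_ref all_ref]
  show ?thesis by simp
qed

lemma all_reflections_exponent: "n dvd s (int k) - (s 0 + (s 1 - s 0) * (\<Sum>i<k. \<omega> ^ i))"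
proof -
  have scale: "n dvd a - \<omega> * b \<Longrightarrow> n dvd b - c * w \<Longrightarrow> n dvd a - c * (\<omega> * w)" for a b c w
    by algebra
  have gap: "n dvd s (int k + 1) - s (int k) - (s 1 - s 0) * \<omega> ^ k" for k
  proof (induction k)
    case (Suc k)
    from scale[OF all_reflections_gap_step Suc] show ?case by (simp add: add.commute)
  qed simp
  show ?thesis
  proof (induction k)
    case (Suc k)
    with gap[of k] have "n dvd (s (int k + 1) - s (int k) - (s 1 - s 0) * \<omega> ^ k) +
        (s (int k) - (s 0 + (s 1 - s 0) * (\<Sum>i<k. \<omega> ^ i)))" by (rule dvd_add)
    then show ?case by (simp add: algebra_simps)
  qed simp
qed

lemma all_reflections_coprime: "coprime (s 1 - s 0) n"
proof (rule coprimeI)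
  fix m assume m: "m dvd s 1 - s 0" "m dvd n"
  show "is_unit m"
  proof (rule common_divisor_dvd_one[OF m(2) all_ref])
    fix i :: int assume "0 \<le> i"
    then obtain k where k: "i = int k" by (metis zero_le_imp_eq_int)
    have "m dvd s i - (s 0 + (s 1 - s 0) * (\<Sum>i<k. \<omega> ^ i))"
      unfolding k using m(2) all_reflections_exponent by (rule dvd_trans)
    with m(1) show "m dvd s i - s 0" by algebra
  qed (simp add: all_ref)
qed

lemma all_reflections_eigenvalue_square: "n dvd \<omega>\<^sup>2 - 1"
proof -
  have "core (s i - s j)" for i j by (intro adjacent_reflections_core all_ref)
  then have "n dvd \<omega> * \<omega> * (s (- 1) - s 0) - (s (- 1) - s 0)"
    using eigenvalue_square_reflected[OF _ G_reflection_pair S_reflection_pair, of 1] all_ref by simp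
  then have "n dvd (\<omega>\<^sup>2 - 1) * (s 1 - s 0)" using all_reflections_gap_step[of 0 "- 1"] by simp algebra
  then show ?thesis
    using all_reflections_coprime by (simp add: coprime_dvd_mult_left_iff coprime_commute)
qed

end

end

subsection \<open>Reflections at the multiples of \<open>p\<close>\<close>

text \<open>
  For \<open>\<delta> = s p - s 0\<close> the relation \<open>R a\<^sup>\<delta> R\<^sup>-\<^sup>1 = a\<^sup>\<zeta>\<^sup>\<delta> R\<^sup>\<tau>\<close> holds in the group generated by the dihedral
  group and the rotation \<open>R\<close> about \<open>1\<close>, because the cyclic group of rotations of the dihedral group has
  only one subgroup of each order. Comparing it with its mirror image restricts \<open>\<zeta>\<close> and \<open>\<tau>\<close>.
\<close>

locale periodic_reflections = mirror_rotations +
  fixes p :: int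
  assumes p_gt_1: "1 < p" and pattern: "one_in p x chi 0"
begin

lemma is_ref_iff: "is_ref i \<longleftrightarrow> p dvd i"
  using pattern by (simp add: one_in_def)

lemma p_dvd_chi_add: "p dvd chi i + i"
  using pattern by (simp add: one_in_def)

definition \<delta> :: int where "\<delta> = s p - s 0"

definition \<delta>' :: int where "\<delta>' = s 0 - s (- p)"

definition \<tau> :: int where "\<tau> = chi (chi (p + 1) - p) - 1"

lemma F_p_\<delta>': "F p (\<delta>', False) \<approx> (\<delta>, False)" and P_p_\<delta>': "d dvd P p (\<delta>', False) - p"
  using F_reflections_shift[of 0 "- p" p] P_reflections_shift[of 0 "- p" p]
  by (simp_all add: \<delta>_def \<delta>'_def is_ref_iff)

lemma ex_p_factor: "\<exists>r. n dvd \<delta> - r * \<delta>'"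
proof -
  have "n dvd m * \<delta>" if "n dvd m * \<delta>'" for m
  proof -
    have "F p (m * \<delta>', False) \<approx> F p (0, False)" using that by (intro F_cong) simp
    then have "F p (m * \<delta>', False) \<approx> (0, False)" using F_one by (rule dih_cong_trans)
    from dih_cong_euclidean[OF F_rotation_mult[OF F_p_\<delta>' P_p_\<delta>'] this] show ?thesis by simp
  qed
  then show ?thesis using annihilator_subset_imp_multiple[OF n_pos] by blast
qed

definition \<mu> :: int where "\<mu> = (SOME r. n dvd \<delta> - r * \<delta>')"

lemma \<delta>_eq: "n dvd \<delta> - \<mu> * \<delta>'"
  unfolding \<mu>_def by (rule someI_ex[OF ex_p_factor])

lemma F_p_\<delta>: "F p (\<delta>, False) \<approx> (\<mu> * \<delta>, False)"
proof -
  have "F p (\<delta>, False) \<approx> F p (\<mu> * \<delta>', False)" using \<delta>_eq by (intro F_cong) simp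
  also have "\<dots> \<approx> (\<mu> * \<delta>, False)" by (rule F_rotation_mult[OF F_p_\<delta>' P_p_\<delta>'])
  finally show ?thesis .
qed

lemma P_p_\<delta>: "d dvd P p (\<delta>, False) - p"
  using P_reflections_shift[of p 0 p] by (simp add: \<delta>_def is_ref_iff)

lemma G_\<delta>: "G (\<delta>, False) \<approx> (- \<delta>', False)" and S_\<delta>: "d dvd S (\<delta>, False)"
  using G_reflection_pair[of p] S_reflection_pair[of p] by (simp_all add: \<delta>_def \<delta>'_def is_ref_iff)

lemma \<delta>'_eq: "n dvd \<delta>' - \<mu> * \<delta>"
proof -
  have "(\<mu> * - \<delta>', False) \<approx> G (\<mu> * \<delta>, False)" by (rule dih_cong_sym[OF G_rotation_mult[OF G_\<delta> S_\<delta>]])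
  also have "\<dots> \<approx> G (F p (\<delta>, False))" by (rule G_cong[OF dih_cong_sym[OF F_p_\<delta>]])
  also have "\<dots> \<approx> F (- p) (G (\<delta>, False))" by (rule G_F)
  also have "\<dots> \<approx> F (- p) (- \<delta>', False)" by (rule F_cong[OF G_\<delta>])
  finally have "F p (\<mu> * - \<delta>', False) \<approx> F p (F (- p) (- \<delta>', False))" by (rule F_cong)
  also have "\<dots> \<approx> (- \<delta>', False)" by (rule F_inverse)
  finally have "F p (- \<mu> * \<delta>', False) \<approx> (- \<delta>', False)" by simp
  from dih_cong_euclidean[OF F_rotation_mult[OF F_p_\<delta>' P_p_\<delta>'] this] show ?thesis by simp
qed

lemma \<mu>_square: "n dvd (\<mu> * \<mu> - 1) * \<delta>"
  using \<delta>_eq \<delta>'_eq by algebra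

lemma not_ref_p_1: "\<not> is_ref (p + 1)" and not_ref_chi: "\<not> is_ref (chi (p + 1) - p)"
proof -
  have "\<not> p dvd 1" using p_gt_1 by auto
  then show *: "\<not> is_ref (p + 1)" by (simp add: is_ref_iff)
  have "is_ref (p + 1)" if "is_ref (chi (p + 1) - p)"
  proof -
    have "p dvd chi (p + 1)" using that unfolding is_ref_iff by algebra
    then show ?thesis using is_ref_iff is_ref_chi by blast
  qed
  with * show "\<not> is_ref (chi (p + 1) - p)" by blast
qed

lemma p_dvd_\<tau>: "p dvd \<tau>"
  using p_dvd_chi_add[of "chi (p + 1) - p"] p_dvd_chi_add[of "p + 1"] unfolding \<tau>_def by algebra

lemma F_1_\<delta>: "F 1 (\<delta>, False) \<approx> (s (p + 1) + s (chi (p + 1) - p), False)"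
  and P_1_\<delta>: "d dvd P 1 (\<delta>, False) - (1 + \<tau>)"
  using F_reflection_pair[of p 0 1] P_reflection_pair[of p 0 1] not_ref_p_1 not_ref_chi
  by (simp_all add: \<delta>_def \<tau>_def is_ref_iff rotation_mult_x)

lemma reflection_\<tau>_step:
  assumes "p dvd i"
  shows "n dvd (s i - s 1) - (s (chi (p + 1) - p) + s (i + \<tau>))"
proof -
  have ref: "is_ref (i + p)" "is_ref i" using assms by (simp_all add: is_ref_iff)
  have "x i \<cdot> x 1 \<approx> x (chi (p + 1) - p) \<cdot> x (i + \<tau>)"
  proof (rule x_mult_reindex[OF reflection_rotation_transfer[OF ref(1) not_ref_p_1, of "- p"]])
    show "d dvd p + 1 - (i + p) + chi (i + p + - p) - 1" using chi_reflection[OF ref(2)] by simp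
  qed (simp_all add: \<tau>_def)
  then show ?thesis using ref(2) not_ref_chi by (simp add: reflection_mult_x rotation_mult_x)
qed

lemma F_\<tau>_\<delta>: "F \<tau> (\<delta>, False) \<approx> (\<delta>, False)" and P_\<tau>_\<delta>: "d dvd P \<tau> (\<delta>, False) - \<tau>"
proof -
  have "n dvd s (p + \<tau>) - s \<tau> - \<delta>"
    using reflection_\<tau>_step[of 0] reflection_\<tau>_step[of p] by (simp add: \<delta>_def) algebra
  then show "F \<tau> (\<delta>, False) \<approx> (\<delta>, False)"
    using dih_cong_trans[OF F_reflections_shift[of p 0 \<tau>]] p_dvd_\<tau> by (simp add: \<delta>_def is_ref_iff)
  show "d dvd P \<tau> (\<delta>, False) - \<tau>"
    using P_reflections_shift[of p 0 \<tau>] p_dvd_\<tau> by (simp add: \<delta>_def is_ref_iff)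
qed

lemmas F_1_mult_\<delta> = F_rotation_progression[OF F_1_\<delta> P_1_\<delta> F_rotation_mult[OF F_\<tau>_\<delta> P_\<tau>_\<delta>] P_rotation_mult[OF F_\<tau>_\<delta> P_\<tau>_\<delta>]]
  and P_1_mult_\<delta> = P_rotation_progression[OF F_1_\<delta> P_1_\<delta> F_rotation_mult[OF F_\<tau>_\<delta> P_\<tau>_\<delta>] P_rotation_mult[OF F_\<tau>_\<delta> P_\<tau>_\<delta>]]

lemma
  assumes "n dvd m * \<delta>"
  shows F_1_\<delta>_annihilated: "n dvd m * (s (p + 1) + s (chi (p + 1) - p))"
    and \<tau>_annihilated: "d dvd m * \<tau>"
proof -
  have zero: "(m * \<delta>, False) \<approx> (0, False)" using assms by simp
  from dih_cong_euclidean[OF F_1_mult_\<delta> dih_cong_trans[OF F_cong[OF zero] F_one]]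
  show "n dvd m * (s (p + 1) + s (chi (p + 1) - p))" by simp
  show "d dvd m * \<tau>" using P_cong[OF zero, of 1] P_1_mult_\<delta>[of m] P_one[of 1] by algebra
qed

lemma ex_F_1_factor: "\<exists>z. n dvd s (p + 1) + s (chi (p + 1) - p) - z * \<delta>"
  using annihilator_subset_imp_multiple[OF n_pos F_1_\<delta>_annihilated] by blast

definition \<zeta> :: int where "\<zeta> = (SOME z. n dvd s (p + 1) + s (chi (p + 1) - p) - z * \<delta>)"

lemma \<zeta>_eq: "n dvd s (p + 1) + s (chi (p + 1) - p) - \<zeta> * \<delta>"
  unfolding \<zeta>_def by (rule someI_ex[OF ex_F_1_factor])

lemma F_1_mult_\<zeta>: "F 1 (m * \<delta>, False) \<approx> (m * \<zeta> * \<delta>, False)"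
proof (rule dih_cong_trans[OF F_1_mult_\<delta>])
  show "(m * (s (p + 1) + s (chi (p + 1) - p)), False) \<approx> (m * \<zeta> * \<delta>, False)"
    using \<zeta>_eq by simp algebra
qed

lemma F_1_\<zeta>: "F 1 (\<delta>, False) \<approx> (\<zeta> * \<delta>, False)"
  using F_1_mult_\<zeta>[of 1] by simp

lemma
  shows F_m1_\<delta>: "F (- 1) (- \<mu> * \<delta>, False) \<approx> (- \<mu> * \<zeta> * \<delta>, False)"
    and P_m1_\<delta>: "d dvd P (- 1) (- \<mu> * \<delta>, False) + (1 + \<tau>)"
proof -
  have G_\<delta>_\<mu>: "G (\<delta>, False) \<approx> (- \<mu> * \<delta>, False)"
    using dih_cong_trans[OF G_\<delta>, of "(- \<mu> * \<delta>, False)"] \<delta>'_eq by (simp add: dvd_diff_commute)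
  have "F (- 1) (- \<mu> * \<delta>, False) \<approx> F (- 1) (G (\<delta>, False))" by (rule F_cong[OF dih_cong_sym[OF G_\<delta>_\<mu>]])
  also have "\<dots> \<approx> G (F 1 (\<delta>, False))" using G_F[of 1 "(\<delta>, False)"] by (rule dih_cong_sym)
  also have "\<dots> \<approx> G (\<zeta> * \<delta>, False)" by (rule G_cong[OF F_1_\<zeta>])
  also have "\<dots> \<approx> (\<zeta> * (- \<mu> * \<delta>), False)" by (rule G_rotation_mult[OF G_\<delta>_\<mu> S_\<delta>])
  finally show "F (- 1) (- \<mu> * \<delta>, False) \<approx> (- \<mu> * \<zeta> * \<delta>, False)" by (simp add: algebra_simps)
  show "d dvd P (- 1) (- \<mu> * \<delta>, False) + (1 + \<tau>)"
    using S_F[of 1 "(\<delta>, False)"] S_cong[OF F_1_\<zeta>] S_rotation_mult[OF G_\<delta>_\<mu> S_\<delta>, of \<zeta>] P_1_\<delta> S_\<delta>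
      P_cong[OF G_\<delta>_\<mu>, of "- 1"] by algebra
qed

lemma \<zeta>_square: "n dvd (\<zeta> * \<zeta> - 1) * \<delta>"
proof -
  have "F 1 (F (- 1) (- \<mu> * \<delta>, False)) \<approx> (- \<mu> * \<zeta> * \<zeta> * \<delta>, False)"
    by (rule dih_cong_trans[OF F_cong[OF F_m1_\<delta>] F_1_mult_\<zeta>])
  from dih_cong_euclidean[OF this F_inverse] have "n dvd - \<mu> * \<zeta> * \<zeta> * \<delta> - - \<mu> * \<delta>" by simp
  with \<mu>_square show ?thesis by algebra
qed

lemma \<tau>_relation: "d dvd (1 + \<zeta> * \<mu>) * \<tau>"
  using P_add[of 1 "- 1" "(- \<mu> * \<delta>, False)"] P_zero[of "(- \<mu> * \<delta>, False)"] P_m1_\<delta> P_cong[OF F_m1_\<delta>, of 1]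
    P_1_mult_\<delta>[of "- \<mu> * \<zeta>"] by simp algebra

lemma F_2_\<delta>: "F 2 (\<delta>, False) \<approx> (\<zeta> * \<zeta> * \<delta>, False)"
  using dih_cong_trans[OF F_add[of 1 1] dih_cong_trans[OF F_cong[OF F_1_\<zeta>] F_1_mult_\<zeta>]] by simp

lemma P_2_\<delta>: "d dvd P 2 (\<delta>, False) - (2 + \<tau> + \<zeta> * \<tau>)"
  using P_add[of 1 1 "(\<delta>, False)"] P_cong[OF F_1_\<zeta>, of 1] P_1_\<delta> P_1_mult_\<delta>[of \<zeta>] by simp algebra

end

lemma (in mirror_rotations) one_in_3_core:
  assumes "one_in 3 x chi 0"
  shows "core (s 3 - s 0)" and "n dvd \<omega> * \<omega> * (s 3 - s 0) - (s 3 - s 0)"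
proof -
  interpret periodic_reflections n d x chi F P G S 3
    by unfold_locales (use assms in simp_all)
  have "F 3 (\<delta>, False) \<approx> (\<zeta> * \<zeta> * \<zeta> * \<delta>, False)"
    using dih_cong_trans[OF F_add[of 1 2] dih_cong_trans[OF F_cong[OF F_2_\<delta>] F_1_mult_\<zeta>]] by simp
  from dih_cong_euclidean[OF this F_p_\<delta>] have "n dvd \<zeta> * \<zeta> * \<zeta> * \<delta> - \<mu> * \<delta>" by simp
  with \<zeta>_square have "n dvd (\<mu> - \<zeta>) * \<delta>" by algebra
  then have \<tau>_\<mu>_\<zeta>: "d dvd (\<zeta> * \<zeta> - 1) * \<tau>" "d dvd (\<mu> - \<zeta>) * \<tau>"
    using \<tau>_annihilated \<zeta>_square by blast+
  have "d dvd P 3 (\<delta>, False) - (3 + \<tau> + \<zeta> * \<tau> + \<zeta> * \<zeta> * \<tau>)"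
    using P_add[of 1 2 "(\<delta>, False)"] P_cong[OF F_2_\<delta>, of 1] P_2_\<delta> P_1_mult_\<delta>[of "\<zeta> * \<zeta>"] by simp algebra
  then have "d dvd (1 + \<zeta> + \<zeta> * \<zeta>) * \<tau>" using P_p_\<delta> by algebra
  moreover have "d dvd 2 * \<tau>" using \<tau>_relation \<tau>_\<mu>_\<zeta> by algebra
  ultimately have "d dvd \<zeta> * \<tau>" using \<tau>_\<mu>_\<zeta>(1) by algebra
  then have "d dvd \<tau>" using \<tau>_\<mu>_\<zeta>(1) by algebra
  then have "d dvd P 1 (\<delta>, False) - 1" using P_1_\<delta> by algebra
  with F_1_\<zeta> have core: "core \<delta>" by (rule coreI)
  then show "core (s 3 - s 0)" by (simp add: \<delta>_def)
  have "n dvd \<zeta> * \<delta> - \<omega> * \<delta>" using dih_cong_euclidean[OF F_1_\<zeta> F1_core[OF core]] by simp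
  then have "n dvd \<omega> * \<omega> * \<delta> - \<delta>" using \<zeta>_square by algebra
  then show "n dvd \<omega> * \<omega> * (s 3 - s 0) - (s 3 - s 0)" by (simp add: \<delta>_def)
qed

subsection \<open>A core element as the gap between two reflections\<close>

context vertex_rotations
begin

lemma F_core_parity:
  assumes core: "core c" and square: "n dvd \<omega> * \<omega> * c - c"
  shows "F t (c, False) \<approx> (if even t then c else \<omega> * c, False)"
proof -
  have "F 2 (c, False) \<approx> (\<omega> * \<omega> * c, False)"
    using F_core_power[OF core, of 2] by (simp add: power2_eq_square)
  also have "\<dots> \<approx> (c, False)" using square by simp
  finally have even: "F (u * 2) (c, False) \<approx> (c, False)" for u by (rule F_multiple_fixed)
  show ?thesis
  proof (cases "even t")
    case True
    then show ?thesis using even[of "t div 2"] by simp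
  next
    case False
    then have t: "1 + t div 2 * 2 = t" by presburger
    have "F t (c, False) \<approx> F 1 (c, False)" using dih_cong_trans[OF F_add F_cong[OF even]] t by metis
    also have "\<dots> \<approx> (\<omega> * c, False)" by (rule F1_core[OF core])
    finally show ?thesis using False by simp
  qed
qed

text \<open>
  A rotation \<open>x j\<close> centralizes \<open>a\<^sup>c\<close> while a reflection \<open>x 0\<close> inverts it; the automorphism \<open>F (- j)\<close>
  turns the first relation into the second.
\<close>

lemma core_conjugation:
  assumes core: "core c" and ref: "is_ref 0" and rot: "\<not> is_ref j"
    and u: "F (- j) (c, False) \<approx> (u, False)" and v: "F (- chi j) (c, False) \<approx> (v, False)"
  shows "n dvd u + v"
proof -
  have F_x_j: "F (- j) (x j) \<approx> x 0" using F_x[of "- j" j] by simp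
  have turn: "d dvd P (- j) (x j) - - chi j"
    using P_x[of "- j" j] chi_reflection[OF ref] by simp algebra
  have "F (- j) ((c, False) \<cdot> x j) \<approx> F (- j) (c, False) \<cdot> F (P (- j) (c, False)) (x j)" by (rule F_mult)
  also have "\<dots> \<approx> (u, False) \<cdot> x 0"
    by (intro dih_cong_mult u dih_cong_trans[OF F_index_cong F_x_j] P_core core)
  finally have left: "F (- j) ((c, False) \<cdot> x j) \<approx> (u, False) \<cdot> x 0" .
  have "F (- j) (x j \<cdot> (c, False)) \<approx> F (- j) (x j) \<cdot> F (P (- j) (x j)) (c, False)" by (rule F_mult)
  also have "\<dots> \<approx> x 0 \<cdot> (v, False)"
    by (intro dih_cong_mult F_x_j dih_cong_trans[OF F_index_cong v] turn)
  finally have right: "F (- j) (x j \<cdot> (c, False)) \<approx> x 0 \<cdot> (v, False)" .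
  have "(c, False) \<cdot> x j = x j \<cdot> (c, False)" using rot by (simp add: dih_mult_def)
  with left right have "(u, False) \<cdot> x 0 \<approx> x 0 \<cdot> (v, False)" using dih_cong_euclidean by metis
  then show ?thesis using ref by (simp add: dih_cong_def dih_mult_def)
qed

lemma
  assumes core: "core c" and square: "n dvd \<omega> * \<omega> * c - c" and ref: "is_ref 0" and rot: "\<not> is_ref j"
  shows core_even_chi_annihilated: "even (j + chi j) \<Longrightarrow> n dvd 2 * c"
    and eigenvalue_eq_minus_one: "n dvd \<omega> * c + c"
proof -
  have sum: "n dvd (if even j then c else \<omega> * c) + (if even (chi j) then c else \<omega> * c)"
    using core_conjugation[OF core ref rot F_core_parity[OF core square] F_core_parity[OF core square]] by simp
  show two: "n dvd 2 * c" if "even (j + chi j)"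
  proof (cases "even j")
    case True
    then show ?thesis using sum that by simp
  next
    case False
    then have "n dvd \<omega> * c + \<omega> * c" using sum that by simp
    then show ?thesis using square by algebra
  qed
  show "n dvd \<omega> * c + c"
  proof (cases "even (j + chi j)")
    case True
    show ?thesis
    proof (cases "even \<omega>")
      case True
      then obtain k where k: "\<omega> = 2 * k" by blast
      have "n dvd \<omega> * c" using two[OF \<open>even (j + chi j)\<close>] unfolding k by algebra
      then show ?thesis using square by algebra
    next
      case False
      then obtain k where k: "\<omega> = 2 * k + 1" by (rule oddE)
      show ?thesis using two[OF \<open>even (j + chi j)\<close>] unfolding k by algebra
    qed
  next
    case False
    then show ?thesis using sum by (cases "even j") (simp_all add: add.commute)
  qed
qed

end

lemma (in mirror_rotations) gap_eigenvalue_square: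
  assumes ref: "is_ref 0" "is_ref p" "is_ref (- p)" and core: "core (s p - s 0)" "core (s (- p) - s 0)"
  shows "n dvd \<omega> * \<omega> * (s p - s 0) - (s p - s 0)"
proof -
  let ?c = "s p - s 0" and ?c' = "s (- p) - s 0"
  have square: "n dvd \<omega> * \<omega> * ?c' - ?c'"
    by (rule eigenvalue_square_reflected[OF core(1) G_reflection_pair S_reflection_pair core(2)]) (use ref in auto)
  define r where "r = \<omega> ^ nat (p mod d)"
  have "F p (s 0 - s (- p), False) \<approx> (?c, False)" using F_reflections_shift[of 0 "- p" p] ref by simp
  moreover have "F p (s 0 - s (- p), False) \<approx> (r * (s 0 - s (- p)), False)"
    using F_core[OF core_mult[OF core(2), of "- 1"]] by (simp add: r_def)
  ultimately have "(?c, False) \<approx> (r * (s 0 - s (- p)), False)" by (rule dih_cong_euclidean)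
  then have "n dvd ?c - r * (s 0 - s (- p))" by simp
  with square show ?thesis by algebra
qed

locale core_gap = mirror_rotations +
  fixes p :: int
  assumes ref_0: "is_ref 0" and ref_p: "is_ref p" and ex_rotation: "\<exists>j. \<not> is_ref j"
    and gap_core: "core (s p - s 0)" and gap_square: "n dvd \<omega> * \<omega> * (s p - s 0) - (s p - s 0)"
begin

definition \<delta> :: int where "\<delta> = s p - s 0"

lemma core_\<delta>: "core \<delta>" and square_\<delta>: "n dvd \<omega> * \<omega> * \<delta> - \<delta>"
  using gap_core gap_square by (simp_all add: \<delta>_def)

lemma \<omega>_\<delta>: "n dvd \<omega> * \<delta> + \<delta>"
  using eigenvalue_eq_minus_one[OF core_\<delta> square_\<delta> ref_0] ex_rotation by blast

lemma chi_gap: "d dvd chi (p + t) - (p + chi t)"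
proof -
  have "d dvd chi (0 - p + chi (p + t)) - t"
    using P_reflection_pair[OF ref_p ref_0, of t] P_core[OF gap_core, of t] by algebra
  then have "d dvd chi t - (0 - p + chi (p + t))" by (rule chi_swap)
  then show ?thesis by algebra
qed

lemma F_\<delta>: "F t (\<delta>, False) \<approx> (s (p + t) - s t, False)"
proof -
  have index: "d dvd (0 - p + chi (p + t)) - chi t" using chi_gap[of t] by algebra
  have "F t (\<delta>, False) \<approx> x (p + t) \<cdot> x (0 - p + chi (p + t))"
    unfolding \<delta>_def by (rule F_reflection_pair[OF ref_p ref_0])
  also have "\<dots> \<approx> x (p + t) \<cdot> x (chi t)" by (rule x_mult_cong[OF _ index]) simp
  finally have prod: "F t (\<delta>, False) \<approx> x (p + t) \<cdot> x (chi t)" .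
  moreover have "\<not> snd (F t (\<delta>, False))" using F_core[OF core_\<delta>, of t] by (simp add: dih_cong_def)
  ultimately have same: "is_ref (p + t) = is_ref t" by (auto simp: dih_cong_def dih_mult_def)
  have "x (p + t) \<cdot> x (chi t) \<approx> (s (p + t) - s t, False)"
  proof (cases "is_ref t")
    case True
    then show ?thesis
      using same s_cong[OF chi_reflection[OF True]] by (simp add: reflection_mult_x dvd_diff_commute)
  next
    case False
    then show ?thesis using same s_chi[OF False] by (simp add: rotation_mult_x algebra_simps)
  qed
  with prod show ?thesis by (rule dih_cong_trans)
qed

lemma s_gap: "n dvd s (p + t) - s t - (if even t then \<delta> else - \<delta>)"
proof (cases "even t")
  case True
  then show ?thesis using dih_cong_euclidean[OF F_\<delta> F_core_parity[OF core_\<delta> square_\<delta>], of t] by simp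
next
  case False
  then have "n dvd s (p + t) - s t - \<omega> * \<delta>"
    using dih_cong_euclidean[OF F_\<delta> F_core_parity[OF core_\<delta> square_\<delta>], of t] by simp
  then have "n dvd s (p + t) - s t + \<delta>" using \<omega>_\<delta> by algebra
  then show ?thesis using False by simp
qed

lemma chi_gap_mult: "d dvd chi (t + p * k) - (chi t + k * p)"
  using chi_gap[of "t + p * m" for m]
  by (intro int_progression_cong[of d "\<lambda>k. chi (t + p * k)"]) (simp_all add: algebra_simps)

lemma s_gap_mult:
  assumes "even p"
  shows "n dvd s (t + p * k) - (s t + k * (if even t then \<delta> else - \<delta>))"
proof (rule int_progression_cong[of n "\<lambda>k. s (t + p * k)"])
  show "n dvd s (t + p * (m + 1)) - (s (t + p * m) + (if even t then \<delta> else - \<delta>))" for m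
    using s_gap[of "t + p * m"] assms by (simp add: algebra_simps split: if_splits)
qed simp

end

lemma coprime_3_iff: "coprime k 3 \<longleftrightarrow> \<not> 3 dvd (k::int)"
  using prime_imp_coprime[of 3 k] coprime_absorb_right[of 3 k] by (auto simp: coprime_commute)

section \<open>Two reflections in four\<close>

locale two_in_four = mirror_rotations +
  assumes pattern: "two_in_4 x chi 0"
begin

lemma is_ref_iff: "is_ref i \<longleftrightarrow> 4 dvd i \<or> 4 dvd i - 1"
  using pattern by (simp add: two_in_4_def)

lemma four_dvd_chi: "\<not> is_ref i \<Longrightarrow> 4 dvd chi i + i - 5"
  using pattern by (auto simp: two_in_4_def)

lemma is_ref_numerals: "is_ref 0" "is_ref 1" "is_ref 4" "is_ref 5" "is_ref (- 4)" "is_ref (- 3)"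
    "\<not> is_ref 2" "\<not> is_ref 3" "\<not> is_ref 6" "\<not> is_ref (- 1)"
  by (simp_all add: is_ref_iff)

lemma gap_core_4: "core (s 4 - s 0)" "core (s (- 4) - s 0)"
  by (rule adjacent_reflections_core; simp add: is_ref_iff)+

sublocale core_gap n d x chi F P G S 4
proof
  show "n dvd \<omega> * \<omega> * (s 4 - s 0) - (s 4 - s 0)"
    by (rule gap_eigenvalue_square) (use is_ref_numerals gap_core_4 in auto)
qed (use is_ref_numerals gap_core_4 in auto)

definition \<kappa> :: int where "\<kappa> = (chi 2 + 1) div 4"

lemma chi_2: "chi 2 = 4 * \<kappa> - 1"
proof -
  have "4 dvd chi 2 + 1" using four_dvd_chi[OF is_ref_numerals(7)] by presburger
  then show ?thesis by (auto simp: \<kappa>_def)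
qed

lemma chi_m1: "d dvd chi (- 1) - (2 - 4 * \<kappa>)"
  using chi_gap_mult[of "4 * \<kappa> - 1" "- \<kappa>"] chi_chi[of 2] unfolding chi_2 by simp algebra

lemma s_chi_2: "n dvd s (4 * \<kappa> - 1) + s 2"
  using s_chi[of 2] is_ref_numerals by (simp add: chi_2 add.commute)

lemma ref_4\<kappa>: "is_ref (4 * \<kappa>)"
  by (simp add: is_ref_iff)

definition w :: int where "w = s 0 - s 1 + s 2"

lemma w_eq_mult: "(w, False) = (s 0 - s 1, False) \<cdot> x 2"
  using is_ref_numerals by (simp add: w_def dih_mult_def)

lemma
  shows F_1_w: "F 1 (w, False) \<approx> (s 1 - s 2 - s (4 * \<kappa>), False)" and core_w: "core w"
proof -
  let ?v = "(s 0 - s 1, False)"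
  have F_v: "F 1 ?v \<approx> x 1 \<cdot> x 2" and P_v: "d dvd P 1 ?v - (chi 2 - 1)"
    using F_reflection_pair_shift[of 0 1 1] P_reflection_pair_shift[of 0 1 1] is_ref_numerals
    by simp_all
  have index: "d dvd 2 + P 1 ?v - 4 * \<kappa>" using P_v unfolding chi_2 by algebra
  have "F 1 (w, False) \<approx> F 1 ?v \<cdot> x (2 + P 1 ?v)" unfolding w_eq_mult by (rule F_step)
  also have "\<dots> \<approx> x 1 \<cdot> x 2 \<cdot> x (4 * \<kappa>)" by (intro dih_cong_mult F_v x_cong index)
  also have "\<dots> = (s 1 - s 2 - s (4 * \<kappa>), False)"
    using is_ref_numerals ref_4\<kappa> by (simp add: dih_mult_def)
  finally show F_w: "F 1 (w, False) \<approx> (s 1 - s 2 - s (4 * \<kappa>), False)" .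
  have "d dvd P 1 (w, False) - 1"
    using P_step[of 1 ?v 2] chi_cong[OF index] chi_reflection[OF ref_4\<kappa>]
    unfolding w_eq_mult[symmetric] chi_2 by algebra
  with F_w show "core w" by (rule coreI)
qed

lemma \<omega>_w: "n dvd \<omega> * w + w + \<kappa> * \<delta>"
proof -
  have "n dvd (s 1 - s 2 - s (4 * \<kappa>)) - \<omega> * w"
    using dih_cong_euclidean[OF F_1_w F1_core[OF core_w]] by simp
  moreover have "n dvd s (4 * \<kappa>) - (s 0 + \<kappa> * \<delta>)" using s_gap_mult[of 0 \<kappa>] by simp
  ultimately show ?thesis unfolding w_def by algebra
qed

lemma \<omega>_square_w: "n dvd \<omega> * \<omega> * w - w - 2 * \<kappa> * \<delta>"
  using \<omega>_w \<omega>_\<delta> by algebra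

lemma four_\<kappa>_\<delta>: "n dvd 4 * \<kappa> * \<delta> - 3 * \<delta>"
proof -
  let ?v = "(s 0 - s 1, False)"
  have F_v: "F 4 ?v \<approx> (s 4 - s 5, False)" and P_v: "d dvd P 4 ?v - 4"
    using F_reflections_shift[of 0 1 4] P_reflections_shift[of 0 1 4] is_ref_numerals by simp_all
  have "F 4 (w, False) \<approx> F 4 ?v \<cdot> x (2 + P 4 ?v)" unfolding w_eq_mult by (rule F_step)
  also have "\<dots> \<approx> (s 4 - s 5, False) \<cdot> x 6" using P_v by (intro dih_cong_mult F_v x_cong) simp
  also have "\<dots> = (s 4 - s 5 + s 6, False)" using is_ref_numerals by (simp add: dih_mult_def)
  finally have F_w: "F 4 (w, False) \<approx> (s 4 - s 5 + s 6, False)" .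
  have "F 4 (w, False) \<approx> (\<omega> ^ 4 * w, False)" using F_core_power[OF core_w, of 4] by simp
  from dih_cong_euclidean[OF F_w this] have "n dvd (s 4 - s 5 + s 6) - \<omega> ^ 4 * w" by simp
  moreover have "n dvd s 4 - s 0 - \<delta>" "n dvd s 5 - s 1 + \<delta>" "n dvd s 6 - s 2 - \<delta>"
    using s_gap[of 0] s_gap[of 1] s_gap[of 2] by simp_all
  moreover have "n dvd \<omega> ^ 4 * w - w - 4 * \<kappa> * \<delta>" using \<omega>_square_w square_\<delta> by algebra
  ultimately show ?thesis unfolding w_def by algebra
qed

lemma
  shows G_w: "G (w, False) \<approx> (w - 2 * \<kappa> * \<delta>, False)" and S_w: "d dvd S (w, False)"
proof -
  let ?v = "(s 0 - s 1, False)"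
  have v: "x 0 \<cdot> x 1 = ?v" using is_ref_numerals by (simp add: reflection_mult_x)
  have index: "d dvd (chi (- 0) + chi 0 - 1) - (- 1)"
    using chi_reflection[OF is_ref_numerals(1)] by simp
  have G_v: "G ?v \<approx> x 0 \<cdot> x (- 1)"
    using dih_cong_trans[OF G_x_mult[of 0 1] x_mult_cong[OF _ index]] by (simp add: v)
  have "d dvd S ?v - (3 - 4 * \<kappa>)"
    using S_x_mult[of 0 1] chi_cong[OF index] chi_m1 chi_reflection[OF is_ref_numerals(2)]
    unfolding v by algebra
  then have index': "d dvd (S ?v - 2) - (1 - 4 * \<kappa>)" by algebra
  have ref: "is_ref (1 - 4 * \<kappa>)" by (simp add: is_ref_iff)
  have "G (w, False) \<approx> G ?v \<cdot> x (S ?v - 2)" unfolding w_eq_mult by (rule G_step)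
  also have "\<dots> \<approx> x 0 \<cdot> x (- 1) \<cdot> x (1 - 4 * \<kappa>)" by (intro dih_cong_mult G_v x_cong index')
  also have "\<dots> = (s 0 - s (- 1) - s (1 - 4 * \<kappa>), False)"
    using is_ref_numerals ref by (simp add: dih_mult_def)
  also have "\<dots> \<approx> (w - 2 * \<kappa> * \<delta>, False)"
    using s_gap_mult[of "4 * \<kappa> - 1" "- \<kappa>"] s_gap_mult[of 1 "- \<kappa>"] s_chi_2 by (simp add: w_def) algebra
  finally show "G (w, False) \<approx> (w - 2 * \<kappa> * \<delta>, False)" .
  show "d dvd S (w, False)"
    using S_step[of ?v 2] chi_cong[OF index'] chi_reflection[OF ref]
    unfolding w_eq_mult[symmetric] chi_2 by algebra
qed

lemma two_\<kappa>_\<delta>: "n dvd 2 * \<kappa> * \<delta>"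
proof -
  have "core (w - 2 * \<kappa> * \<delta>)" using core_add[OF core_w core_mult[OF core_\<delta>, of "- 2 * \<kappa>"]] by simp
  from eigenvalue_square_reflected[OF core_w G_w S_w this] \<omega>_square_w square_\<delta> show ?thesis by algebra
qed

lemma three_\<delta>: "n dvd 3 * \<delta>"
  using four_\<kappa>_\<delta> two_\<kappa>_\<delta> by algebra

lemma s_0_s_1: "n dvd (s 0 - s 1) - 2 * s 2"
proof -
  have prod: "x 0 \<cdot> x 1 \<approx> x (2 + 4 * (\<kappa> - 1)) \<cdot> x (2 + 4 * (2 * \<kappa> - 2))"
  proof (rule x_mult_reindex[OF reflection_rotation_transfer[OF is_ref_numerals(2,7), of "- 1"]])
    show "d dvd 2 - 1 + chi (1 + - 1) - 1" using chi_reflection[OF is_ref_numerals(1)] by simp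
    show "d dvd chi 2 + - 1 - (2 + 4 * (\<kappa> - 1))" by (simp add: chi_2)
    show "d dvd 1 - 2 + chi (chi 2 + - 1) - (2 + 4 * (2 * \<kappa> - 2))"
      using chi_gap_mult[of 2 "\<kappa> - 1"] by (simp add: chi_2 algebra_simps)
  qed simp
  have "\<not> is_ref (2 + 4 * (\<kappa> - 1))" by (simp add: is_ref_iff) presburger
  with prod have "n dvd (s 0 - s 1) - (s (2 + 4 * (\<kappa> - 1)) + s (2 + 4 * (2 * \<kappa> - 2)))"
    using is_ref_numerals by (simp add: reflection_mult_x rotation_mult_x)
  moreover have "n dvd s (2 + 4 * (\<kappa> - 1)) - (s 2 + (\<kappa> - 1) * \<delta>)"
    "n dvd s (2 + 4 * (2 * \<kappa> - 2)) - (s 2 + (2 * \<kappa> - 2) * \<delta>)"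
    using s_gap_mult[of 2 "\<kappa> - 1"] s_gap_mult[of 2 "2 * \<kappa> - 2"] by simp_all
  ultimately show ?thesis using three_\<delta> by algebra
qed

lemma w_eq: "n dvd w - 3 * s 2"
  using s_0_s_1 unfolding w_def by algebra

lemma three_dvd_n: "3 dvd n" and three_dvd_\<delta>: "3 dvd \<delta>"
proof -
  obtain k where k: "k dvd n" "\<And>c. core c \<longleftrightarrow> k dvd c" by (rule core_generator) blast
  have "k dvd w - 3 * s 2" "k dvd w" using dvd_trans[OF k(1) w_eq] k(2) core_w by blast+
  then have k_3: "k dvd 3 * s 2" by algebra
  have "3 dvd k"
  proof (rule ccontr)
    assume "\<not> 3 dvd k"
    then have "k dvd s 2" using k_3 by (simp add: coprime_dvd_mult_right_iff coprime_3_iff)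
    then show False using rotation_not_core[of 2 0] is_ref_numerals k(2) by blast
  qed
  then show "3 dvd n" "3 dvd \<delta>" using k core_\<delta> dvd_trans by blast+
qed

lemma common_divisor_s_2_\<delta>:
  assumes m: "m dvd s 2" "m dvd \<delta>" "m dvd n"
  shows "m dvd 1"
proof (rule common_divisor_dvd_one[OF m(3) is_ref_numerals(1)])
  have shift: "m dvd s (t + 4 * k) - s t" for t k
  proof -
    have "m dvd s (t + 4 * k) - (s t + k * (if even t then \<delta> else - \<delta>))"
      using m(3) s_gap_mult[of t k] dvd_trans by fastforce
    moreover have "m dvd (if even t then \<delta> else - \<delta>)" using m(2) by simp
    ultimately show ?thesis by algebra
  qed
  have m_dvd: "m dvd s (4 * \<kappa> - 1)" "m dvd s 1 - s 0"
    using dvd_trans[OF m(3) s_chi_2] dvd_trans[OF m(3) s_0_s_1] m(1) by algebra+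
  fix j
  {
    assume "\<not> is_ref j"
    then have "4 dvd j - 2 \<or> 4 dvd j - (4 * \<kappa> - 1)" unfolding is_ref_iff by presburger
    then obtain t k where t: "t = 2 \<or> t = 4 * \<kappa> - 1" "j = t + 4 * k"
      by (metis dvdE diff_add_cancel add.commute)
    then have "m dvd s t" using m(1) m_dvd(1) by auto
    with shift[of t k] show "m dvd s j" unfolding t(2) by algebra
  next
    assume "is_ref j"
    then obtain t k where t: "t = 0 \<or> t = 1" "j = t + 4 * k"
      unfolding is_ref_iff by (metis dvdE diff_add_cancel add.commute add_0)
    then have "m dvd s t - s 0" using m_dvd(2) by auto
    with shift[of t k] show "m dvd s j - s 0" unfolding t(2) by algebra
  }
qed

lemma coprime_s_2: "coprime (s 2) n"
proof (rule coprimeI)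
  fix m assume m: "m dvd s 2" "m dvd n"
  show "is_unit m"
  proof (cases "3 dvd m")
    case True
    then have "is_unit (3::int)"
      using common_divisor_s_2_\<delta>[of 3] three_dvd_\<delta> three_dvd_n m dvd_trans by blast
    then show ?thesis by simp
  next
    case False
    moreover have "m dvd 3 * \<delta>" using m(2) three_\<delta> by (rule dvd_trans)
    ultimately have "m dvd \<delta>" by (simp add: coprime_dvd_mult_right_iff coprime_3_iff)
    then show ?thesis using common_divisor_s_2_\<delta> m by blast
  qed
qed

text \<open>The mirror image of \<open>a\<^sup>\<delta>\<close> is its inverse, but \<open>\<delta>\<close> is a multiple of \<open>w\<close>, and \<open>a\<^sup>w\<close> is its own mirror image.\<close>

lemma \<delta>_zero: "n dvd \<delta>"
proof -
  obtain c where c: "\<delta> = 3 * c" using three_dvd_\<delta> by auto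
  obtain t where "[s 2 * t = 1] (mod n)" using coprime_s_2 cong_solve_coprime_int by blast
  then have "n dvd s 2 * t - 1" by (simp add: cong_iff_dvd_diff)
  then have "n dvd t * w - 3" using w_eq by algebra
  then have \<delta>_w: "n dvd \<delta> - t * c * w" unfolding c by algebra
  have "G (\<delta>, False) \<approx> (s (- 4) - s 0, False)"
    unfolding \<delta>_def by (rule G_reflection_pair) (use is_ref_numerals in auto)
  also have "\<dots> \<approx> (- \<delta>, False)" using s_gap[of "- 4"] by (simp add: algebra_simps dvd_diff_commute)
  finally have "G (\<delta>, False) \<approx> (- \<delta>, False)" .
  moreover have "G (\<delta>, False) \<approx> (\<delta>, False)"
  proof -
    have G_w': "G (w, False) \<approx> (w, False)" using dih_cong_trans[OF G_w, of "(w, False)"] two_\<kappa>_\<delta> by simp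
    have "G (\<delta>, False) \<approx> G (t * c * w, False)" using \<delta>_w by (intro G_cong) simp
    also have "\<dots> \<approx> (t * c * w, False)" by (rule G_rotation_mult[OF G_w' S_w])
    also have "\<dots> \<approx> (\<delta>, False)" using \<delta>_w by (simp add: dvd_diff_commute)
    finally show ?thesis .
  qed
  ultimately have "(- \<delta>, False) \<approx> (\<delta>, False)" by (rule dih_cong_euclidean)
  then have "n dvd - \<delta> - \<delta>" by simp
  from dvd_add[OF three_\<delta> this] show ?thesis by simp
qed

lemma d_eq_4: "d = 4"
proof -
  have "4 dvd d" using is_ref_cong[of d 0] is_ref_cong[of "1 + d" 1] is_ref_numerals
    unfolding is_ref_iff by simp presburger
  moreover have "d dvd 4 - 0" using \<delta>_zero is_ref_numerals unfolding \<delta>_def by (intro index_cong) auto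
  ultimately show ?thesis using d_pos by (simp add: zdvd_antisym_nonneg)
qed

lemma s_1: "n dvd s 1 - (s 0 - 2 * s 2)"
  using s_0_s_1 by algebra

lemma s_3: "n dvd s 3 + s 2"
proof -
  have "d dvd (4 * \<kappa> - 1) - 3" by (simp add: d_eq_4)
  from s_cong[OF this] s_chi_2 show ?thesis by algebra
qed

end

section \<open>Two reflections in three\<close>

lemma (in core_gap) three_gap_order:
  assumes "p = 3" "3 dvd d" "is_ref 6"
  shows "d = 3 \<or> d = 6"
proof -
  have "n dvd s 6 - s 0" using s_gap[of 0] s_gap[of 3] by (simp add: assms(1)) algebra
  then have d: "d dvd 6 - 0" using assms(3) ref_0 by (intro index_cong) auto
  obtain k where k: "d = 3 * k" using assms(2) by auto
  have "d \<le> 6" using d by (simp add: zdvd_imp_le)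
  then have "k = 1 \<or> k = 2" using k d_pos by linarith
  then show ?thesis using k by auto
qed

locale two_in_three = mirror_rotations +
  assumes pattern: "two_in_3 x 0"
begin

lemma is_ref_iff: "is_ref i \<longleftrightarrow> \<not> 3 dvd i - 2"
  using pattern by (simp add: two_in_3_def)

lemma is_ref_numerals: "is_ref 0" "is_ref 1" "is_ref 3" "is_ref 4" "is_ref (- 3)" "\<not> is_ref 2" "\<not> is_ref 5"
  by (simp_all add: is_ref_iff)

lemma gap_core_3: "core (s 3 - s 0)" "core (s (- 3) - s 0)"
  by (rule adjacent_reflections_core; simp add: is_ref_iff)+

sublocale core_gap n d x chi F P G S 3
proof
  show "n dvd \<omega> * \<omega> * (s 3 - s 0) - (s 3 - s 0)"
    by (rule gap_eigenvalue_square) (use is_ref_numerals gap_core_3 in auto)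
qed (use is_ref_numerals gap_core_3 in auto)

lemma d_3_or_6: "d = 3 \<or> d = 6"
proof (rule three_gap_order)
  show "3 dvd d" using is_ref_cong[of "2 + d" 2] is_ref_numerals unfolding is_ref_iff by simp
qed (simp_all add: is_ref_iff)

lemma three_dvd_chi_2: "3 dvd chi 2 - 2"
  using is_ref_iff is_ref_chi is_ref_numerals(6) by blast

lemma x_0_x_1:
  assumes "d dvd chi 2 - 1 - i"
  shows "x 0 \<cdot> x 1 \<approx> x i \<cdot> x (chi i - 1)"
proof (rule x_mult_reindex[OF reflection_rotation_transfer[OF is_ref_numerals(2,6), of "- 1"]])
  show "d dvd 2 - 1 + chi (1 + - 1) - 1" using chi_reflection[OF is_ref_numerals(1)] by simp
  show "d dvd chi 2 + - 1 - i" using assms by simp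
  then have "d dvd chi (chi 2 + - 1) - chi i" by (rule chi_cong)
  then show "d dvd 1 - 2 + chi (chi 2 + - 1) - (chi i - 1)" by algebra
qed simp

lemma index_0_to_5:
  assumes "0 \<le> i" "i < d"
  shows "i = 0 \<or> i = 1 \<or> i = 2 \<or> i = 3 \<or> i = 4 \<or> i = 5"
  using assms d_3_or_6 by linarith

lemma two_in_three_3:
  assumes d: "d = 3"
  shows "n = 2" and "odd (s 1 - s 0)" and "odd (s 2)"
proof -
  have chi_2: "d dvd chi 2 - 2" using three_dvd_chi_2 by (simp add: d)
  then have "n dvd 2 * s 2" using s_chi[OF is_ref_numerals(6)] s_cong[OF chi_2] by algebra
  note s_2 = this rotation_nontrivial[OF is_ref_numerals(6,1)]
  have "x 0 \<cdot> x 1 \<approx> x 1 \<cdot> x 0"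
  proof (rule x_mult_reindex[OF x_0_x_1[of 1]])
    show "d dvd chi 1 - 1 - 0" using chi_reflection[OF is_ref_numerals(2)] by simp
  qed (use chi_2 in simp_all)
  then have "n dvd 2 * (s 1 - s 0)" using is_ref_numerals by (simp add: reflection_mult_x) algebra
  moreover have "\<not> n dvd s 1 - s 0"
  proof
    assume "n dvd s 1 - s 0"
    then have "d dvd 1 - 0" using is_ref_numerals by (intro index_cong) auto
    then show False by (simp add: d)
  qed
  ultimately have s_1: "n dvd (s 1 - s 0) - s 2" "\<not> n dvd s 1 - s 0"
    using two_torsion_unique[OF _ _ s_2] by blast+
  obtain m where m: "n = 2 * m" "n dvd s 2 - m" using two_torsion_half[OF s_2] .
  have "m dvd 1"
  proof (rule common_divisor_dvd_one[OF _ is_ref_numerals(1)])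
    show m_dvd_n: "m dvd n" by (simp add: m)
    have m_2: "m dvd s 2" using dvd_trans[OF m_dvd_n m(2)] by algebra
    moreover have "m dvd s 1 - s 0" using dvd_trans[OF m_dvd_n s_1(1)] m_2 by algebra
    ultimately show "m dvd s i" if "0 \<le> i" "i < d" "\<not> is_ref i" for i
      using index_0_to_5[OF that(1,2)] that is_ref_numerals d by auto
    show "m dvd s i - s 0" if "0 \<le> i" "i < d" "is_ref i" for i
      using index_0_to_5[OF that(1,2)] that is_ref_numerals d \<open>m dvd s 1 - s 0\<close> by auto
  qed
  then show n: "n = 2" using m n_pos by simp
  show "odd (s 1 - s 0)" "odd (s 2)" using s_1(2) s_2(2) n by simp_all
qed

context
  assumes d: "d = 6"
begin

lemma chi_2: "d dvd chi 2 - 5"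
proof -
  have "6 dvd chi 2 - 2 \<or> 6 dvd chi 2 - 5" using three_dvd_chi_2 by presburger
  moreover have False if "6 dvd chi 2 - 2"
  proof -
    have "d dvd chi 2 - 2" using that d by simp
    moreover from this have "d dvd chi 5 - 5" using chi_gap[of 2] by simp algebra
    ultimately have "d dvd 2 - 5" by (rule fixed_rotation_unique[OF is_ref_numerals(1,6,7)])
    then show False by (simp add: d)
  qed
  ultimately show ?thesis using d by auto
qed

lemma s_5: "n dvd s 5 + s 2"
  using s_chi[OF is_ref_numerals(6)] s_cong[OF chi_2] by algebra

lemma \<delta>_s_2: "n dvd \<delta> + 2 * s 2"
  using s_5 s_gap[of 2] by simp algebra

lemma s_3: "n dvd s 3 - (s 0 - 2 * s 2)"
  using \<delta>_s_2 unfolding \<delta>_def by algebra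

lemma two_in_three_half:
  obtains m where "n = 2 * m" "n dvd s 1 - (s 0 + m - 2 * s 2)"
proof -
  define v where "v = s 1 - s 0 + 2 * s 2"
  have "x 0 \<cdot> x 1 \<approx> x 4 \<cdot> x 3"
  proof (rule x_mult_reindex[OF x_0_x_1[of 4]])
    show "d dvd chi 4 - 1 - 3" using chi_reflection[OF is_ref_numerals(4)] by simp
  qed (use chi_2 in simp_all)
  then have "n dvd (s 0 - s 1) - (s 4 - s 3)" using is_ref_numerals by (simp add: reflection_mult_x)
  moreover have "n dvd s 4 - s 1 + \<delta>" using s_gap[of 1] by simp
  ultimately have "n dvd 2 * v" using \<delta>_s_2 unfolding v_def \<delta>_def by algebra
  moreover have "\<not> n dvd v"
  proof
    assume "n dvd v"
    then have "n dvd s 1 - s 3" using \<delta>_s_2 unfolding v_def \<delta>_def by algebra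
    then have "d dvd 1 - 3" using is_ref_numerals by (intro index_cong) auto
    then show False by (simp add: d)
  qed
  ultimately obtain m where m: "n = 2 * m" "n dvd v - m" using two_torsion_half by metis
  have "n dvd s 1 - (s 0 + m - 2 * s 2)" using m(2) unfolding v_def by algebra
  with m(1) show ?thesis by (rule that)
qed

context
  fixes m :: int
  assumes n_eq: "n = 2 * m" and s_1: "n dvd s 1 - (s 0 + m - 2 * s 2)"
begin

lemma s_4: "n dvd s 4 - (s 0 + m)"
proof -
  have "n dvd s 4 - s 1 + \<delta>" using s_gap[of 1] by simp
  then show ?thesis using s_1 \<delta>_s_2 by algebra
qed

lemma common_divisor_s_2_m:
  assumes g: "g dvd s 2" "g dvd m"
  shows "g dvd 1"
proof (rule common_divisor_dvd_one[OF _ is_ref_numerals(1)])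
  show g_dvd_n: "g dvd n" using g(2) n_eq by simp
  note g_dvd = g_dvd_n[THEN dvd_trans]
  have refs: "g dvd s 1 - s 0" "g dvd s 3 - s 0" "g dvd s 4 - s 0"
    using g_dvd[OF s_1] g_dvd[OF s_3] g_dvd[OF s_4] g by algebra+
  have rots: "g dvd s 5" using g_dvd[OF s_5] g(1) by algebra
  show "g dvd s i" if "0 \<le> i" "i < d" "\<not> is_ref i" for i
    using index_0_to_5[OF that(1,2)] that is_ref_numerals g(1) rots by auto
  show "g dvd s i - s 0" if "0 \<le> i" "i < d" "is_ref i" for i
    using index_0_to_5[OF that(1,2)] that is_ref_numerals refs by auto
qed

lemma core_2: "core 2"
proof -
  have "gcd \<delta> n dvd 2 * s 2" "gcd \<delta> n dvd 2 * m"
    using dvd_trans[OF gcd_dvd2[of \<delta> n] \<delta>_s_2] n_eq by (simp_all add: dvd_add_right_iff)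
  then have "gcd \<delta> n dvd gcd (2 * s 2) (2 * m)" by simp
  also have "gcd (2 * s 2) (2 * m) = 2 * gcd (s 2) m" by (simp add: gcd_mult_left)
  also have "gcd (s 2) m = 1"
    using common_divisor_s_2_m[of "gcd (s 2) m"] by (simp add: is_unit_gcd_iff)
  finally obtain l where "2 = l * gcd \<delta> n" by (metis dvdE mult.commute mult_1_right)
  then show ?thesis using core_mult[OF core_gcd[OF core_\<delta>], of l] by simp
qed

lemma odd_s_2: "odd (s 2)"
proof
  assume "even (s 2)"
  then obtain l where "s 2 = l * 2" by (metis evenE mult.commute)
  then show False using core_mult[OF core_2, of l] rotation_not_core[OF is_ref_numerals(6,1)] by simp
qed

lemma odd_m: "odd m"
proof -
  have even_n: "2 dvd n" using n_eq by simp
  have "odd (s 1 - s 0)"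
  proof
    assume "even (s 1 - s 0)"
    then have "dih_cong 2 (x 1) (x 0)" using is_ref_numerals by (simp add: dih_cong_def)
    from x_quotient_shift[OF core_2 even_n this, of 1] show False
      using is_ref_numerals by (simp add: dih_cong_def)
  qed
  then show ?thesis using dvd_trans[OF even_n s_1] by auto
qed

lemma coprime_s_2: "coprime (s 2) n"
proof -
  have "coprime (s 2) m" using common_divisor_s_2_m by (intro coprimeI) auto
  then show ?thesis using odd_s_2 n_eq by (simp add: coprime_right_2_iff_odd)
qed

lemma m_gt_1: "1 < m"
proof -
  have "m \<noteq> 1"
  proof
    assume "m = 1"
    then have "n dvd s 3 - s 0" using \<delta>_s_2 n_eq unfolding \<delta>_def by simp
    then have "d dvd 3 - 0" using is_ref_numerals by (intro index_cong) auto
    then show False by (simp add: d)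
  qed
  then show ?thesis using n_eq n_pos by linarith
qed

end

end

end

section \<open>One reflection in three\<close>

locale one_in_three = mirror_rotations +
  assumes pattern: "one_in 3 x chi 0"
begin

lemma is_ref_iff: "is_ref i \<longleftrightarrow> 3 dvd i" and three_dvd_chi: "3 dvd chi i + i"
  using pattern by (simp_all add: one_in_def)

lemma is_ref_numerals: "is_ref 0" "is_ref 3" "\<not> is_ref 1" "\<not> is_ref 2" "\<not> is_ref 4" "\<not> is_ref 5"
  by (simp_all add: is_ref_iff)

sublocale core_gap n d x chi F P G S 3
  by unfold_locales (use is_ref_numerals one_in_3_core[OF pattern] in auto)

lemma d_3_or_6: "d = 3 \<or> d = 6"
proof (rule three_gap_order)
  show "3 dvd d" using is_ref_cong[of d 0] unfolding is_ref_iff by simp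
qed (simp_all add: is_ref_iff)

lemma x_2_mult:
  assumes "d dvd chi 2 + 1 - i" "d dvd chi 1 + 2 - j" "d dvd chi j - 1 - k" and "\<not> 3 dvd j"
  shows "n dvd (s 2 + s i) - (s j + s k)"
proof -
  have "x 2 \<cdot> x i \<approx> x j \<cdot> x k"
  proof (rule x_mult_reindex[OF reflection_rotation_transfer[OF is_ref_numerals(1,3), of 2]])
    show "d dvd 1 - 0 + chi (0 + 2) - i" using assms(1) by (simp add: add.commute)
    have "d dvd chi (chi 1 + 2) - chi j" by (rule chi_cong[OF assms(2)])
    then show "d dvd 0 - 1 + chi (chi 1 + 2) - k" using assms(3) by algebra
  qed (use assms(2) in simp_all)
  then show ?thesis using is_ref_numerals assms(4) by (simp add: rotation_mult_x is_ref_iff)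
qed

lemma
  assumes chi_1: "d dvd chi 1 - 2"
  shows s_2: "n dvd s 2 + s 1" and four_s_1: "n dvd 4 * s 1 - 2 * \<delta>"
proof -
  show s_2: "n dvd s 2 + s 1" using s_chi[OF is_ref_numerals(3)] s_cong[OF chi_1] by algebra
  have "d dvd chi 2 + 1 - 2" using chi_swap[OF chi_1] by simp
  moreover have "d dvd chi 1 + 2 - 4" using chi_1 by simp
  moreover have "d dvd chi 4 - 1 - 4" using chi_gap[of 1] chi_1 by simp algebra
  ultimately have "n dvd (s 2 + s 2) - (s 4 + s 4)" by (rule x_2_mult) simp
  moreover have "n dvd s 4 - s 1 + \<delta>" using s_gap[of 1] by simp
  ultimately show "n dvd 4 * s 1 - 2 * \<delta>" using s_2 by algebra
qed

lemma index_0_to_5: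
  assumes "0 \<le> i" "i < d"
  shows "i = 0 \<or> i = 1 \<or> i = 2 \<or> i = 3 \<or> i = 4 \<or> i = 5"
  using assms d_3_or_6 by linarith

lemma one_in_three_3:
  assumes d: "d = 3"
  shows "n = 4" and "coprime (s 1) n" and "n dvd s 2 + s 1"
proof -
  have chi_1: "d dvd chi 1 - 2" using three_dvd_chi[of 1] d by presburger
  show s_2: "n dvd s 2 + s 1" by (rule s_2[OF chi_1])
  have "n dvd \<delta>" using s_cong[of 3 0] by (simp add: d \<delta>_def)
  with four_s_1[OF chi_1] have n_4: "n dvd 4 * s 1" by algebra
  show coprime: "coprime (s 1) n"
  proof (rule coprimeI)
    fix g assume g: "g dvd s 1" "g dvd n"
    have "g dvd s 2" using dvd_trans[OF g(2) s_2] g(1) by algebra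
    show "is_unit g"
    proof (rule common_divisor_dvd_one[OF g(2) is_ref_numerals(1)])
      show "g dvd s i" if "0 \<le> i" "i < d" "\<not> is_ref i" for i
        using index_0_to_5[OF that(1,2)] that is_ref_numerals g(1) \<open>g dvd s 2\<close> d by auto
      show "g dvd s i - s 0" if "0 \<le> i" "i < d" "is_ref i" for i
        using index_0_to_5[OF that(1,2)] that is_ref_numerals d by auto
    qed
  qed
  have "n dvd 4" using n_4 coprime by (simp add: coprime_dvd_mult_left_iff coprime_commute)
  moreover have "\<not> n dvd 2"
  proof
    assume "n dvd 2"
    then have "n dvd 2 * s 1" by simp
    then have "n dvd s 1 - s 2" using s_2 by algebra
    then have "d dvd 1 - 2" using is_ref_numerals by (intro index_cong) auto
    then show False by (simp add: d)
  qed
  moreover have "n \<le> 4" using \<open>n dvd 4\<close> by (simp add: zdvd_imp_le)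
  moreover have "n \<noteq> 3" using \<open>n dvd 4\<close> by auto
  ultimately show "n = 4" using n_pos by (cases "n = 1 \<or> n = 2") auto
qed

context
  assumes d: "d = 6"
begin

lemma \<delta>_nonzero: "\<not> n dvd \<delta>"
proof
  assume "n dvd \<delta>"
  then have "d dvd 3 - 0" using is_ref_numerals unfolding \<delta>_def by (intro index_cong) auto
  then show False by (simp add: d)
qed

lemma chi_1: "d dvd chi 1 - 2"
proof (rule ccontr)
  assume "\<not> d dvd chi 1 - 2"
  then have chi_1: "d dvd chi 1 - 5" using three_dvd_chi[of 1] d by presburger
  then have "even (1 + chi 1)" using d by presburger
  then have two_\<delta>: "n dvd 2 * \<delta>"
    by (rule core_even_chi_annihilated[OF core_\<delta> square_\<delta> is_ref_numerals(1,3)])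
  have chi_4: "d dvd chi 4 - 2" using chi_gap[of 1] chi_1 unfolding d by simp presburger
  have "d dvd chi 2 + 1 - 5" using chi_swap[OF chi_4] by simp
  moreover have "d dvd chi 1 + 2 - 1" using chi_1 unfolding d by presburger
  moreover have "d dvd chi 1 - 1 - 4" using chi_1 by simp
  ultimately have "n dvd (s 2 + s 5) - (s 1 + s 4)" by (rule x_2_mult) simp
  moreover have s_5: "n dvd s 1 + s 5" using s_chi[OF is_ref_numerals(3)] s_cong[OF chi_1] by algebra
  moreover have s_4: "n dvd s 4 - s 1 + \<delta>" and "n dvd s 5 - s 2 - \<delta>"
    using s_gap[of 1] s_gap[of 2] by simp_all
  ultimately have "n dvd 2 * (2 * s 1)" by algebra
  moreover have "\<not> n dvd 2 * s 1"
  proof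
    assume "n dvd 2 * s 1"
    then have "n dvd s 1 - s 5" using s_5 by algebra
    then have "d dvd 1 - 5" using is_ref_numerals by (intro index_cong) auto
    then show False by (simp add: d)
  qed
  ultimately have "n dvd 2 * s 1 - \<delta>" using two_\<delta> \<delta>_nonzero by (rule two_torsion_unique)
  then have "n dvd s 4 - s 5" using s_4 s_5 by algebra
  then have "d dvd 4 - 5" using is_ref_numerals by (intro index_cong) auto
  then show False by (simp add: d)
qed

lemma one_in_three_half:
  obtains m where "n = 2 * m" "n dvd \<delta> - 2 * s 1 - m"
proof -
  have "n dvd 2 * (\<delta> - 2 * s 1)" using four_s_1[OF chi_1] by algebra
  moreover have "\<not> n dvd \<delta> - 2 * s 1"
  proof
    assume "n dvd \<delta> - 2 * s 1"
    moreover have "n dvd s 4 - s 1 + \<delta>" using s_gap[of 1] by simp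
    ultimately have "n dvd s 4 - s 2" using s_2[OF chi_1] by algebra
    then have "d dvd 4 - 2" using is_ref_numerals by (intro index_cong) auto
    then show False by (simp add: d)
  qed
  ultimately show ?thesis by (rule two_torsion_half) (rule that)
qed

context
  fixes m :: int
  assumes n_eq: "n = 2 * m" and half: "n dvd \<delta> - 2 * s 1 - m"
begin

lemma two_m: "n dvd 2 * m"
  by (simp add: n_eq)

lemma s_1: "n dvd s 1 - (m + s 5)"
proof -
  have "n dvd s 5 - s 2 - \<delta>" using s_gap[of 2] by simp
  then show ?thesis using half s_2[OF chi_1] two_m by algebra
qed

lemma s_2': "n dvd s 2 - (m - s 5)"
  using s_1 s_2[OF chi_1] two_m by algebra

lemma s_3: "n dvd s 3 - (s 0 + m + 2 * s 5)"
  using half s_1 two_m unfolding \<delta>_def by algebra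

lemma s_4: "n dvd s 4 + s 5"
proof -
  have "n dvd s 4 - s 1 + \<delta>" using s_gap[of 1] by simp
  then show ?thesis using half s_1 two_m by algebra
qed

lemma common_divisor_s_5_m:
  assumes g: "g dvd s 5" "g dvd m"
  shows "g dvd 1"
proof (rule common_divisor_dvd_one[OF _ is_ref_numerals(1)])
  show g_dvd_n: "g dvd n" using g(2) n_eq by simp
  note g_dvd = g_dvd_n[THEN dvd_trans]
  have rots: "g dvd s 1" "g dvd s 2" "g dvd s 4"
    using g_dvd[OF s_1] g_dvd[OF s_2'] g_dvd[OF s_4] g by algebra+
  have refs: "g dvd s 3 - s 0" using g_dvd[OF s_3] g by algebra
  show "g dvd s i" if "0 \<le> i" "i < d" "\<not> is_ref i" for i
    using index_0_to_5[OF that(1,2)] that is_ref_numerals g(1) rots by auto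
  show "g dvd s i - s 0" if "0 \<le> i" "i < d" "is_ref i" for i
    using index_0_to_5[OF that(1,2)] that is_ref_numerals refs by auto
qed

lemma four_dvd_m_add: "4 dvd m + 2 * s 5"
proof -
  define k where "k = gcd \<delta> n"
  have k: "k dvd n" "core k" "k dvd \<delta>" using core_gcd[OF core_\<delta>] by (simp_all add: k_def)
  have k_m: "k dvd m + 2 * s 5" using dvd_trans[OF k(1) s_3] k(3) unfolding \<delta>_def by algebra
  moreover have "k dvd 2 * m" using k(1) n_eq by simp
  ultimately have "k dvd 2 * (2 * s 5)" by algebra
  moreover have "\<not> k dvd 2 * s 5"
  proof
    assume "k dvd 2 * s 5"
    then have "k dvd s 1 - s 2" using dvd_trans[OF k(1) s_1] dvd_trans[OF k(1) s_2'] by algebra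
    then have "dih_cong k (x 1) (x 2)" using is_ref_numerals by (simp add: dih_cong_def)
    from x_quotient_shift[OF k(2,1) this, of 1] show False
      using is_ref_numerals by (simp add: dih_cong_def)
  qed
  ultimately obtain h where h: "k = 2 * h" "k dvd 2 * s 5 - h" by (rule two_torsion_half)
  then have "even h" by (metis dvd_diff_right_iff dvd_triv_left dvd_trans)
  then have "4 dvd k" using h(1) by auto
  then show ?thesis using k_m by (rule dvd_trans)
qed

lemma odd_s_5: "odd (s 5)"
proof
  assume "even (s 5)"
  moreover from this have "even m" using four_dvd_m_add by presburger
  ultimately show False using common_divisor_s_5_m[of 2] by simp
qed

lemma four_dvd_m_diff: "4 dvd m - 2"
  using four_dvd_m_add odd_s_5 by presburger

lemma coprime_s_5: "coprime (s 5) n"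
proof -
  have "coprime (s 5) m" using common_divisor_s_5_m by (intro coprimeI) auto
  then show ?thesis using odd_s_5 n_eq by (simp add: coprime_right_2_iff_odd)
qed

lemma m_gt_2: "2 < m"
proof -
  have "m \<noteq> 2"
  proof
    assume "m = 2"
    then have "n dvd m + 2 * s 5" using four_dvd_m_add n_eq by simp
    then have "n dvd \<delta>" using s_3 unfolding \<delta>_def by algebra
    then show False using \<delta>_nonzero by simp
  qed
  moreover have "0 < m" using n_eq n_pos by simp
  ultimately show ?thesis using four_dvd_m_diff by presburger
qed

end

end

end

section \<open>Alternating reflections and rotations\<close>

locale one_in_two = periodic_reflections n d x chi F P G S 2 for n d x chi F P G S
begin

lemma even_d: "even d"
  using is_ref_cong[of d 0] is_ref_iff[of d] is_ref_iff[of 0] by simp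

lemma \<zeta>_\<tau>: "d dvd (1 + \<zeta>) * \<tau>"
  using P_2_\<delta> P_p_\<delta> by algebra

lemma F_2_\<delta>_fixed: "F 2 (\<delta>, False) \<approx> (\<delta>, False)"
  using dih_cong_trans[OF F_2_\<delta>, of "(\<delta>, False)"] \<zeta>_square by (simp add: algebra_simps)

lemma s_even: "n dvd s (2 * j) - (s 0 + j * \<delta>)"
proof (rule int_progression_cong[of n "\<lambda>j. s (2 * j)"])
  show "n dvd s (2 * (j + 1)) - (s (2 * j) + \<delta>)" for j
  proof -
    have "F (2 * j) (\<delta>, False) \<approx> (s (2 + 2 * j) - s (0 + 2 * j), False)"
      unfolding \<delta>_def by (rule F_reflections_shift) (simp_all add: is_ref_iff)
    moreover have "F (2 * j) (\<delta>, False) \<approx> (\<delta>, False)"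
      using F_multiple_fixed[OF F_2_\<delta>_fixed, of j] by (simp add: mult.commute)
    ultimately have "(s (2 + 2 * j) - s (0 + 2 * j), False) \<approx> (\<delta>, False)" by (rule dih_cong_euclidean)
    then show ?thesis by (simp add: algebra_simps)
  qed
qed simp

lemma mult_\<delta>_iff: "n dvd j * \<delta> \<longleftrightarrow> d dvd 2 * j"
proof
  assume "n dvd j * \<delta>"
  then have "n dvd s (2 * j) - s 0" using s_even[of j] by algebra
  then have "d dvd 2 * j - 0" by (intro index_cong) (simp_all add: is_ref_iff)
  then show "d dvd 2 * j" by simp
next
  assume "d dvd 2 * j"
  then have "n dvd s (2 * j) - s 0" by (intro s_cong) simp
  then show "n dvd j * \<delta>" using s_even[of j] by algebra
qed

lemma chi_add_constant:
  assumes j: "odd j" and k: "odd k"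
  shows "d dvd (k + chi k) - (j + chi j)"
proof -
  have rot: "\<not> is_ref j" "\<not> is_ref k" and ref: "is_ref 0" "is_ref (k - j)"
    using j k by (simp_all add: is_ref_iff)
  have "even (k - chi j)" "even (k - j)" "even (k - chi k)"
    using j k p_dvd_chi_add[of j] p_dvd_chi_add[of k] by presburger+
  then obtain a b c where abc: "k - chi j = 2 * a" "k - j = 2 * b" "k - chi k = 2 * c" by (metis evenE)
  have "x 0 \<cdot> x (k - chi j) \<approx> x (k - j) \<cdot> x (k - chi k)"
  proof (rule x_mult_reindex[OF rotation_rotation_transfer[OF rot, of "- j"]])
    show "d dvd k + chi (j + - j) - chi j - (k - chi j)" using chi_reflection[OF ref(1)] by simp
    show "d dvd j + chi (k + - j) - chi k - (k - chi k)" using chi_reflection[OF ref(2)] by simp algebra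
  qed simp_all
  then have "n dvd (s 0 - s (2 * a)) - (s (2 * b) - s (2 * c))"
    using ref unfolding abc by (simp add: reflection_mult_x)
  then have "n dvd (a + b - c) * \<delta>" using s_even[of a] s_even[of b] s_even[of c] by algebra
  then have "d dvd 2 * (a + b - c)" by (simp add: mult_\<delta>_iff)
  moreover have "2 * (a + b - c) = (k + chi k) - (j + chi j)" using abc by simp
  ultimately show ?thesis by simp
qed

text \<open>
  The constant \<open>y = chi j + j\<close> is determined modulo \<open>d\<close>. It can be chosen divisible by \<open>4\<close>, since
  otherwise \<open>4\<close> divides \<open>d\<close> and there are two odd fixed points \<open>y / 2\<close> and \<open>(y + d) / 2\<close> of \<open>chi\<close>.
\<close>

lemma ex_center: "\<exists>a. even a \<and> (\<forall>j. odd j \<longrightarrow> d dvd chi j + j - 2 * a)"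
proof -
  define y where "y = chi 1 + 1"
  have y: "d dvd chi j + j - y" if "odd j" for j
    using chi_add_constant[of 1 j] that by (simp add: y_def add.commute)
  have "even y" using p_dvd_chi_add[of 1] by (simp add: y_def)
  have "4 dvd y \<or> 4 dvd d \<or> 4 dvd y + d" using \<open>even y\<close> even_d by presburger
  then consider (dvd) "4 dvd y" | (not_dvd) "\<not> 4 dvd y" "4 dvd d" | (dvd_add) "4 dvd y + d" by blast
  then show ?thesis
  proof cases
    case dvd
    then obtain a where "y = 4 * a" ..
    then show ?thesis using y by (intro exI[of _ "2 * a"]) simp
  next
    case not_dvd
    obtain j where j: "y = 2 * j" using \<open>even y\<close> by blast
    then have "odd j" using not_dvd(1) by presburger
    obtain e where e: "d = 4 * e" using not_dvd(2) by blast
    have odds: "odd j" "odd (j + 2 * e)" using \<open>odd j\<close> by simp_all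
    have "d dvd j - (j + 2 * e)"
    proof (rule fixed_rotation_unique[of 0])
      show "d dvd chi j - j" using y[OF odds(1)] j by (simp add: algebra_simps)
      have "d dvd chi (j + 2 * e) + (j + 2 * e) - y - 4 * e"
        using dvd_diff[OF y[OF odds(2)], of "4 * e"] e by simp
      then show "d dvd chi (j + 2 * e) - (j + 2 * e)" by (simp add: j algebra_simps)
    qed (use odds in \<open>simp_all add: is_ref_iff\<close>)
    then have "d dvd 2 * e" by simp
    then have "d \<le> 2 * e" using d_pos e by (intro zdvd_imp_le) auto
    then show ?thesis using d_pos e by simp
  next
    case dvd_add
    then obtain a where a: "y + d = 4 * a" ..
    have "d dvd chi j + j - 2 * (2 * a)" if "odd j" for j
    proof -
      have "d dvd chi j + j - y - d" using y[OF that] by (rule dvd_diff) simp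
      then show ?thesis using a by (simp add: algebra_simps)
    qed
    then show ?thesis by (intro exI[of _ "2 * a"]) simp
  qed
qed

context
  assumes chi_odd: "\<And>j. odd j \<Longrightarrow> d dvd chi j + j"
begin

lemma s_uminus:
  assumes "odd j"
  shows "n dvd s (- j) + s j"
proof -
  have "d dvd chi j - (- j)" using chi_odd[OF assms] by simp
  moreover have "n dvd s j + s (chi j)" using assms by (intro s_chi) (simp add: is_ref_iff)
  ultimately show ?thesis using s_cong[of "chi j" "- j"] by algebra
qed

lemma s_odd_step:
  assumes j: "odd j"
  shows "n dvd s (j + 2) - s (j - 2) - 2 * \<delta>"
proof -
  have types: "is_ref 0" "is_ref 2" "is_ref (- 2)" "\<not> is_ref j" "\<not> is_ref (j + 2)" "\<not> is_ref (- (j - 2))"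
    using j by (simp_all add: is_ref_iff)
  have "x 2 \<cdot> x (j + 2) \<approx> x (- (j - 2)) \<cdot> x (- 2)"
  proof (rule x_mult_reindex[OF reflection_rotation_transfer[OF types(1,4), of 2]])
    show "d dvd j - 0 + chi (0 + 2) - (j + 2)" using chi_reflection[OF types(2)] by simp
    show index: "d dvd chi j + 2 - (- (j - 2))" using chi_odd[OF j] by simp
    have "d dvd chi (- (j - 2)) + - (j - 2)" using chi_odd j by simp
    with chi_cong[OF index] show "d dvd 0 - j + chi (chi j + 2) - - 2" by algebra
  qed simp
  then have "n dvd (s 2 - s (j + 2)) - (s (- (j - 2)) + s (- 2))"
    using types by (simp add: reflection_mult_x rotation_mult_x)
  moreover have "n dvd s (- (j - 2)) + s (j - 2)" by (rule s_uminus) (use j in simp)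
  moreover have "n dvd s (- 2) - (s 0 - \<delta>)" "s 2 = s 0 + \<delta>"
    using s_even[of "- 1"] by (simp_all add: \<delta>_def)
  ultimately show ?thesis by algebra
qed

lemma s_1_mod_4: "n dvd s (1 + 4 * k) - (s 1 + k * (2 * \<delta>))"
proof (rule int_progression_cong[of n "\<lambda>k. s (1 + 4 * k)"])
  show "n dvd s (1 + 4 * (k + 1)) - (s (1 + 4 * k) + 2 * \<delta>)" for k
    using s_odd_step[of "3 + 4 * k"] by (simp add: algebra_simps)
qed simp

lemma s_3_mod_4: "n dvd s (4 * k - 1) - (k * (2 * \<delta>) - s 1)"
proof -
  have "n dvd s (- (1 - 4 * k)) + s (1 - 4 * k)" by (rule s_uminus) simp
  with s_1_mod_4[of "- k"] show ?thesis by simp algebra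
qed

lemma odd_mod_4_cases:
  assumes "odd (j :: int)"
  obtains (one) k where "j = 1 + 4 * k" | (three) k where "j = 4 * k - 1"
proof -
  have "\<exists>k. j = 1 + 4 * k \<or> j = 4 * k - 1" using assms by presburger
  then show ?thesis using that by blast
qed

lemma \<tau>_eq_4: "d dvd \<tau> - 4" and s_3_add: "n dvd s 3 + s (chi 3 - 2) + 2 * s 1"
proof -
  have index: "d dvd (chi 3 - 2) - (- 5)" using chi_odd[of 3] by (simp add: add.commute)
  have "d dvd chi (- 5) - 5" using chi_odd[of "- 5"] by simp
  with chi_cong[OF index] show "d dvd \<tau> - 4" unfolding \<tau>_def by simp algebra
  show "n dvd s 3 + s (chi 3 - 2) + 2 * s 1"
    using s_3_mod_4[of 1] s_3_mod_4[of "- 1"] s_cong[OF index] by simp algebra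
qed

definition \<eta> :: int where "\<eta> = - \<zeta>"

lemma \<eta>_\<delta>: "n dvd 2 * s 1 - \<eta> * \<delta>"
  using s_3_add \<zeta>_eq unfolding \<eta>_def by simp algebra

lemma \<eta>_square: "n dvd (\<eta> * \<eta> - 1) * \<delta>"
  using \<zeta>_square by (simp add: \<eta>_def)

lemma four_\<eta>: "d dvd 4 * (\<eta> - 1)"
  using \<zeta>_\<tau> \<tau>_eq_4 unfolding \<eta>_def by algebra

lemma \<delta>_s_1: "n dvd \<delta> - 2 * \<eta> * s 1"
  using \<eta>_\<delta> \<eta>_square by algebra

lemma coprime_s_1: "coprime (s 1) n"
proof (rule coprimeI)
  fix g assume g: "g dvd s 1" "g dvd n"
  note g_dvd = g(2)[THEN dvd_trans]
  have g_\<delta>: "g dvd \<delta>" using g_dvd[OF \<delta>_s_1] g(1) by algebra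
  show "is_unit g"
  proof (rule common_divisor_dvd_one[OF g(2)])
    show "is_ref 0" by (simp add: is_ref_iff)
    show "g dvd s j" if "\<not> is_ref j" for j
    proof -
      have "odd j" using that by (simp add: is_ref_iff)
      then show ?thesis
      proof (cases rule: odd_mod_4_cases)
        case (one k)
        show ?thesis using g_dvd[OF s_1_mod_4[of k]] g(1) g_\<delta> unfolding one by algebra
      next
        case (three k)
        show ?thesis using g_dvd[OF s_3_mod_4[of k]] g(1) g_\<delta> unfolding three by algebra
      qed
    qed
    show "g dvd s j - s 0" if "is_ref j" for j
    proof -
      obtain k where j: "j = 2 * k" using \<open>is_ref j\<close> by (auto simp: is_ref_iff)
      show ?thesis using g_dvd[OF s_even[of k]] g_\<delta> unfolding j by algebra
    qed
  qed
qed

lemma dvd_2_mult_iff: "d dvd 2 * j \<longleftrightarrow> n dvd 2 * j"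
proof -
  have "n dvd 2 * (\<eta> * \<eta> - 1) * s 1" using \<eta>_\<delta> \<delta>_s_1 by algebra
  then have two_\<eta>_square: "n dvd 2 * (\<eta> * \<eta> - 1)"
    using coprime_s_1 by (simp add: coprime_dvd_mult_left_iff coprime_commute)
  have "n dvd j * \<delta> \<longleftrightarrow> n dvd 2 * j * \<eta> * s 1"
  proof
    show "n dvd 2 * j * \<eta> * s 1" if "n dvd j * \<delta>" using that \<delta>_s_1 by algebra
    show "n dvd j * \<delta>" if "n dvd 2 * j * \<eta> * s 1" using that \<delta>_s_1 by algebra
  qed
  also have "\<dots> \<longleftrightarrow> n dvd 2 * j * \<eta>"
    using coprime_s_1 by (simp add: coprime_dvd_mult_left_iff coprime_commute)
  also have "\<dots> \<longleftrightarrow> n dvd 2 * j"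
  proof
    show "n dvd 2 * j" if "n dvd 2 * j * \<eta>" using that two_\<eta>_square by algebra
  qed simp
  finally show ?thesis by (simp add: mult_\<delta>_iff)
qed

lemma s_odd:
  assumes "n dvd 2 * \<delta> - 4 * s 1" and "odd j"
  shows "n dvd s j - j * s 1"
  using assms(2)
proof (cases rule: odd_mod_4_cases)
  case (one k)
  show ?thesis using s_1_mod_4[of k] assms(1) unfolding one by algebra
next
  case (three k)
  show ?thesis using s_3_mod_4[of k] assms(1) unfolding three by algebra
qed

lemma n_eq_d:
  assumes "n dvd 2 * \<delta> - 4 * s 1"
  shows "n = d"
proof -
  obtain e where "d = 2 * e" using even_d by auto
  then have "n dvd d" using dvd_2_mult_iff[of e] by simp
  moreover have "even n"
  proof (rule ccontr)
    assume "odd n"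
    then have "n dvd s n - n * s 1" by (rule s_odd[OF assms])
    then have "n dvd s n" by algebra
    then show False using rotation_nontrivial[of n 0] \<open>odd n\<close> by (simp add: is_ref_iff)
  qed
  then obtain e where "n = 2 * e" by auto
  then have "d dvd n" using dvd_2_mult_iff[of e] by simp
  ultimately show ?thesis using n_pos d_pos by (simp add: zdvd_antisym_nonneg)
qed

lemma s_even_linear:
  assumes "d dvd 2 * (\<eta> - 1)"
  shows "n dvd \<delta> - 2 * s 1"
proof -
  have "n dvd (\<eta> - 1) * \<delta>" using assms by (simp add: mult_\<delta>_iff)
  then show ?thesis using \<eta>_\<delta> by algebra
qed

lemma s_even_twisted:
  assumes "\<not> d dvd 2 * (\<eta> - 1)"
  obtains e where "d = 2 * e" "8 dvd d" "n dvd d" "n dvd \<delta> - (2 + e) * s 1"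
proof -
  obtain e where e: "d = 2 * e" using even_d by auto
  have "2 * e dvd 2 * (2 * (\<eta> - 1))" using four_\<eta> e by simp
  then have "e dvd 2 * (\<eta> - 1)" by (simp only: dvd_mult_cancel_left) simp
  moreover have "\<not> e dvd \<eta> - 1" using assms unfolding e dvd_mult_cancel_left by simp
  ultimately obtain f where f: "e = 2 * f" "e dvd \<eta> - 1 - f" by (rule two_torsion_half)
  have "2 * e dvd 2 * (\<eta> * \<eta> - 1)" using \<eta>_square mult_\<delta>_iff e by blast
  then have "e dvd \<eta> * \<eta> - 1" by (simp only: dvd_mult_cancel_left) simp
  then have "e dvd f * f + 2 * f" using f(2) by algebra
  then have "2 * f dvd f * f" by (simp add: f(1))
  moreover have "f \<noteq> 0" using e f(1) d_pos by auto
  ultimately have "8 dvd d" using e f(1) by auto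
  moreover have "n dvd d" using dvd_2_mult_iff[of e] e by simp
  moreover have "n dvd \<delta> - (2 + e) * s 1"
  proof -
    have "2 * e dvd 2 * (\<eta> - 1 - f)" using f(2) by (intro mult_dvd_mono) simp_all
    then have "d dvd 2 * \<eta> - (2 + e)" by (simp add: e f(1) algebra_simps)
    then have "n dvd 2 * \<eta> - (2 + e)" using \<open>n dvd d\<close> dvd_trans by blast
    then show ?thesis using \<delta>_s_1 by algebra
  qed
  ultimately show ?thesis using that[OF e] by blast
qed

lemma centered_exponents:
  shows "n = d" and "coprime (s 1) n" and "\<And>j. odd j \<Longrightarrow> n dvd s j - j * s 1"
    and "(\<forall>i. n dvd s (2 * i) - (s 0 + 2 * i * s 1)) \<or>
      8 dvd n \<and> (\<forall>i. n dvd s (2 * i) - (s 0 + i * (2 + n div 2) * s 1))"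
proof -
  have "n dvd 2 * \<delta> - 4 * s 1 \<and> ((\<forall>i. n dvd s (2 * i) - (s 0 + 2 * i * s 1)) \<or>
      8 dvd d \<and> (\<forall>i. n dvd s (2 * i) - (s 0 + i * (2 + d div 2) * s 1)))"
  proof (cases "d dvd 2 * (\<eta> - 1)")
    case True
    have "n dvd s (2 * i) - (s 0 + 2 * i * s 1)" for i
      using s_even[of i] s_even_linear[OF True] by algebra
    moreover have "n dvd 2 * \<delta> - 4 * s 1" using s_even_linear[OF True] by algebra
    ultimately show ?thesis by blast
  next
    case False
    then obtain e where e: "d = 2 * e" "8 dvd d" "n dvd d" "n dvd \<delta> - (2 + e) * s 1"
      by (rule s_even_twisted)
    have "n dvd s (2 * i) - (s 0 + i * (2 + e) * s 1)" for i using s_even[of i] e(4) by algebra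
    moreover have "n dvd 2 * \<delta> - 4 * s 1" using e(3,4) unfolding e(1) by algebra
    ultimately show ?thesis using e(1,2) by simp
  qed
  then show "n = d" "coprime (s 1) n" "\<And>j. odd j \<Longrightarrow> n dvd s j - j * s 1"
    "(\<forall>i. n dvd s (2 * i) - (s 0 + 2 * i * s 1)) \<or>
      8 dvd n \<and> (\<forall>i. n dvd s (2 * i) - (s 0 + i * (2 + n div 2) * s 1))"
    using n_eq_d s_odd coprime_s_1 by blast+
qed

end

end

section \<open>Renumbering the generators\<close>

context cyclic_generators
begin

lemma cyclic_generators_shift: "cyclic_generators n d (\<lambda>i. x (i + a)) (\<lambda>i. chi (i + a) - a)"
proof
  show "Q g" if "\<And>g h. g \<approx> h \<Longrightarrow> Q g \<Longrightarrow> Q h" "Q (0, False)" "\<And>g i. Q g \<Longrightarrow> Q (g \<cdot> x (i + a))" for Q g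
  proof (induction g rule: word_induct)
    case (step g i)
    then show ?case using that(3)[of g "i - a"] by simp
  qed (use that(1,2) in blast)+
qed (use n_pos d_pos x_eq_iff x_mult_x_chi in simp_all)

lemma arc_map_shift:
  assumes "arc_map \<epsilon> f \<pi>"
  shows "cyclic_generators.arc_map n (\<lambda>i. x (i + a)) \<epsilon> f (\<lambda>g. \<pi> g + (\<epsilon> - 1) * a)"
proof -
  interpret shifted: cyclic_generators n d "\<lambda>i. x (i + a)" "\<lambda>i. chi (i + a) - a"
    by (rule cyclic_generators_shift)
  show ?thesis
    unfolding shifted.arc_map_def
    using arc_map_cong[OF assms] arc_map_step[OF assms, of _ "i + a" for i] by (simp add: algebra_simps)
qed

end

context vertex_rotations
begin

lemma vertex_rotations_shift: "vertex_rotations n d (\<lambda>i. x (i + a)) (\<lambda>i. chi (i + a) - a) F P"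
proof -
  interpret shifted: cyclic_generators n d "\<lambda>i. x (i + a)" "\<lambda>i. chi (i + a) - a"
    by (rule cyclic_generators_shift)
  show ?thesis by unfold_locales (use arc_map_shift[OF F_arc_map, of a] F_one P_one in simp_all)
qed

text \<open>
  A reflection that fixes \<open>1\<close> can be composed with a rotation about \<open>1\<close>, so the mirror axis may be
  assumed to pass through any of the arcs at \<open>1\<close>.
\<close>

lemma ex_mirror_rotations_shift:
  assumes G: "arc_map (- 1) G S" and G_one: "G (0, False) \<approx> (0, False)"
  shows "\<exists>G S. mirror_rotations n d (\<lambda>i. x (i + a)) (\<lambda>i. chi (i + a) - a) F P G S"
proof -
  define t where "t = 2 * a - S (0, False)"
  have "arc_map (- 1) (\<lambda>g. F t (G g)) (\<lambda>g. S g + P t (G g))" using arc_map_comp[OF F_arc_map G] by simp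
  moreover have "F t (G (0, False)) \<approx> (0, False)" by (rule dih_cong_trans[OF F_cong[OF G_one] F_one])
  moreover have "d dvd S (0, False) + P t (G (0, False)) - 2 * a"
    using P_cong[OF G_one, of t] P_one[of t] unfolding t_def by algebra
  ultimately have "mirror_rotations n d (\<lambda>i. x (i + a)) (\<lambda>i. chi (i + a) - a) F P
      (\<lambda>g. F t (G g)) (\<lambda>g. S g + P t (G g) + (- 1 - 1) * a)"
    using arc_map_shift[of "- 1"] vertex_rotations_shift
    by (intro mirror_rotations.intro mirror_rotations_axioms.intro) simp_all
  then show ?thesis by blast
qed

end

lemma one_in_shift:
  assumes "one_in p x chi b" "p dvd a - b"
  shows "one_in p (\<lambda>i. x (i + a)) (\<lambda>i. chi (i + a) - a) 0"
proof -
  have "snd (x (i + a)) \<longleftrightarrow> p dvd i" for i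
  proof -
    have "snd (x (i + a)) \<longleftrightarrow> p dvd i + (a - b)" using assms(1) by (simp add: one_in_def algebra_simps)
    then show ?thesis using assms(2) by (simp add: dvd_add_left_iff)
  qed
  moreover have "p dvd chi (i + a) - a + i" for i
  proof -
    have "p dvd chi (i + a) + (i + a) - 2 * b" using assms(1) by (simp add: one_in_def)
    then show ?thesis using assms(2) by algebra
  qed
  ultimately show ?thesis by (simp add: one_in_def)
qed

lemma two_in_3_shift: "two_in_3 x a \<Longrightarrow> two_in_3 (\<lambda>i. x (i + a)) 0"
  by (simp add: two_in_3_def algebra_simps)

lemma two_in_4_shift:
  assumes "two_in_4 x chi a"
  shows "two_in_4 (\<lambda>i. x (i + a)) (\<lambda>i. chi (i + a) - a) 0"
proof -
  have "4 dvd chi (i + a) - a + i - 5" if "\<not> snd (x (i + a))" for i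
  proof -
    have "4 dvd chi (i + a) + (i + a) - 2 * a - 5" using assms that unfolding two_in_4_def by blast
    then show ?thesis by (simp add: algebra_simps)
  qed
  then show ?thesis using assms by (simp add: two_in_4_def)
qed

section \<open>Cayley maps with numbered generators\<close>

lemma cyclic_on_numbering:
  assumes "cyclic_on p X"
  obtains z :: "int \<Rightarrow> 'a"
  where "range z = X" "\<And>i j. z i = z j \<longleftrightarrow> int (card X) dvd i - j" "\<And>i. p (z i) = z (i + 1)"
proof -
  obtain x where x: "x \<in> X" "X = orbit p x" using assms unfolding cyclic_on_def by blast
  define m where "m = funpow_dist1 p x x"
  have x_orbit: "x \<in> orbit p x" using x by simp
  have inj: "inj_on (\<lambda>k. (p ^^ k) x) {0..<m}" unfolding m_def by (rule inj_on_funpow_dist1[OF x_orbit])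
  have image: "X = (\<lambda>k. (p ^^ k) x) ` {0..<m}"
    unfolding m_def using x(2) orbit_conv_funpow_dist1[OF x_orbit] by simp
  then have card_X: "card X = m" using card_image[OF inj] by simp
  have m_pos: "0 < m" by (simp add: m_def)
  have period: "(p ^^ m) x = x" unfolding m_def by (rule funpow_dist1_prop[OF x_orbit])
  define z where "z i = (p ^^ nat (i mod int m)) x" for i
  have residue: "nat (i mod int m) \<in> {0..<m}" for i using m_pos by (simp add: nat_less_iff)
  have "z i = z j \<longleftrightarrow> i mod int m = j mod int m" for i j
    unfolding z_def inj_on_eq_iff[OF inj residue residue] using m_pos by (simp add: eq_nat_nat_iff)
  moreover have "range z = X"
  proof -
    have "z (int k) = (p ^^ k) x" if "k < m" for k using that by (simp add: z_def)
    then have "X \<subseteq> range z" unfolding image by (auto simp: image_iff) metis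
    then show ?thesis using cyclic_on_funpow_in[OF assms x(1)] by (auto simp: z_def)
  qed
  moreover have "p (z i) = z (i + 1)" for i
  proof -
    define k where "k = nat (i mod int m)"
    have k: "k < m" "i mod int m = int k" using m_pos by (simp_all add: k_def nat_less_iff)
    then have "(i + 1) mod int m = int (Suc k) mod int m"
      by (metis mod_add_left_eq add.commute of_nat_Suc)
    also have "\<dots> = int (if Suc k = m then 0 else Suc k)"
      using k(1) unfolding zmod_int[symmetric] by auto
    finally have "nat ((i + 1) mod int m) = (if Suc k = m then 0 else Suc k)" by simp
    then show ?thesis using period by (auto simp: z_def k_def[symmetric])
  qed
  ultimately show ?thesis using that[of z] by (simp add: card_X mod_eq_dvd_iff)
qed

lemma cycle_of_list_nth:
  assumes "distinct ys" "k < length ys"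
  shows "cycle_of_list ys (ys ! k) = ys ! (Suc k mod length ys)"
  using arg_cong[OF cyclic_rotation[OF assms(1), of 1], of "\<lambda>zs. zs ! k"] assms(2)
  by (simp add: nth_rotate1)

lemma
  fixes z :: "int \<Rightarrow> 'a"
  assumes "ys \<noteq> []" and nth: "\<And>k. k < length ys \<Longrightarrow> ys ! k = z (int k)"
    and z_eq_iff: "\<And>i j. z i = z j \<longleftrightarrow> int (length ys) dvd i - j"
  shows distinct_periodic_list: "distinct ys" and set_periodic_list: "set ys = range z"
    and cycle_of_periodic_list: "cycle_of_list ys (z i) = z (i + 1)"
proof -
  let ?d = "int (length ys)"
  have d_pos: "0 < ?d" using assms(1) by simp
  show dist: "distinct ys" unfolding distinct_conv_nth by (simp add: nth z_eq_iff flip: mod_eq_dvd_iff)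
  have less: "nat (i mod ?d) < length ys" for i using d_pos by (simp add: nat_less_iff)
  have nth_residue: "ys ! nat (i mod ?d) = z i" for i
    using d_pos by (simp add: nth[OF less] z_eq_iff mod_eq_dvd_iff[symmetric])
  show "set ys = range z"
  proof
    show "set ys \<subseteq> range z" using nth by (auto simp: set_conv_nth)
    show "range z \<subseteq> set ys" using less nth_residue by (metis image_subsetI nth_mem)
  qed
  have "Suc (nat (i mod ?d)) mod length ys = nat ((i + 1) mod ?d)"
  proof -
    have "int (Suc (nat (i mod ?d)) mod length ys) = (i + 1) mod ?d"
      using d_pos by (simp add: zmod_int mod_simps add.commute)
    then show ?thesis by simp
  qed
  then show "cycle_of_list ys (z i) = z (i + 1)"
    using cycle_of_list_nth[OF dist less, of i] by (simp only: nth_residue)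
qed

lemma CM_pres_iso:
  assumes "group G" "group H" and f: "f \<in> iso G H" and X: "X \<subseteq> carrier G" "p ` X \<subseteq> X"
    and q: "\<And>y. y \<in> X \<Longrightarrow> f (p y) = q (f y)"
  shows "pres_iso (CM G X p) (CM H (f ` X) q) f"
proof -
  interpret group_hom G H f using assms by (auto simp: group_hom_def group_hom_axioms_def iso_def)
  have bij: "bij_betw f (carrier G) (carrier H)" using f by (simp add: iso_def)
  have "f y \<in> f ` X \<longleftrightarrow> y \<in> X" if "y \<in> carrier G" for y
    using bij that X(1) by (auto simp: bij_betw_def inj_on_def)
  then have "inv\<^bsub>G\<^esub> v \<otimes>\<^bsub>G\<^esub> w \<in> X \<longleftrightarrow> inv\<^bsub>H\<^esub> f v \<otimes>\<^bsub>H\<^esub> f w \<in> f ` X"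
    if "v \<in> carrier G" "w \<in> carrier G" for v w
    using that by (metis G.inv_closed G.m_closed hom_inv hom_mult)
  then have "adj (CM G X p) v w \<longleftrightarrow> adj (CM H (f ` X) q) (f v) (f w)"
    if "v \<in> carrier G" "w \<in> carrier G" for v w
    using that by (simp add: CM_def)
  moreover have "f (rot (CM G X p) v w) = rot (CM H (f ` X) q) (f v) (f w)"
    if "v \<in> carrier G" "w \<in> carrier G" "adj (CM G X p) v w" for v w
  proof -
    have y: "inv\<^bsub>G\<^esub> v \<otimes>\<^bsub>G\<^esub> w \<in> X" using that(3) by (simp add: CM_def)
    then have "p (inv\<^bsub>G\<^esub> v \<otimes>\<^bsub>G\<^esub> w) \<in> carrier G" using X by blast
    then show ?thesis using that q[OF y] by (simp add: CM_def)
  qed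
  ultimately show ?thesis using bij by (simp add: pres_iso_def graph_iso_def CM_def)
qed

locale numbered_cayley_map = group G for G (structure) +
  fixes X :: "'a set" and p :: "'a \<Rightarrow> 'a" and d :: int and z :: "int \<Rightarrow> 'a"
  assumes data: "cayley_map_data G X p" and d_pos: "0 < d" and range_z: "range z = X"
    and z_eq_iff: "\<And>i j. z i = z j \<longleftrightarrow> d dvd i - j" and p_z: "\<And>i. p (z i) = z (i + 1)"
begin

abbreviation M :: "'a omap" where "M \<equiv> CM G X p"

lemma verts_M: "verts M = carrier G"
  by (simp add: CM_def)

lemma z_in: "z i \<in> X"
  using range_z by blast

lemma z_closed [simp]: "z i \<in> carrier G"
  using z_in data by (auto simp: cayley_map_data_def)

lemma z_neq_one: "z i \<noteq> \<one>"
  using z_in[of i] data by (auto simp: cayley_map_data_def)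

lemma ex_index: "y \<in> X \<Longrightarrow> \<exists>i. y = z i"
  using range_z by blast

lemma ex_inv_z: "\<exists>j. z j = inv z i"
  using ex_index[of "inv z i"] z_in[of i] data by (force simp: cayley_map_data_def)

lemma inv_mult_z: "g \<in> carrier G \<Longrightarrow> inv g \<otimes> (g \<otimes> z i) = z i"
  by (simp add: m_assoc[symmetric])

lemma adj_iff: "adj M v w \<longleftrightarrow> v \<in> carrier G \<and> (\<exists>i. w = v \<otimes> z i)"
proof -
  have "w = v \<otimes> z i" if "v \<in> carrier G" "w \<in> carrier G" "inv v \<otimes> w = z i" for i
    using that by (metis inv_solve_left z_closed)
  then show ?thesis using ex_index[of "inv v \<otimes> w"] z_in by (auto simp: CM_def inv_mult_z)
qed

lemma adj_mult_z: "g \<in> carrier G \<Longrightarrow> adj M g (g \<otimes> z i)"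
  unfolding adj_iff by blast

lemma rot_mult_z: "v \<in> carrier G \<Longrightarrow> rot M v (v \<otimes> z i) = v \<otimes> z (i + 1)"
  by (simp add: CM_def inv_mult_z p_z)

lemma carrier_induct [consumes 1, case_names one step]:
  assumes "g \<in> carrier G" and one: "Q \<one>" and step: "\<And>g i. g \<in> carrier G \<Longrightarrow> Q g \<Longrightarrow> Q (g \<otimes> z i)"
  shows "Q g"
proof -
  have X: "X \<subseteq> carrier G" "generate G X = carrier G" "\<And>y. y \<in> X \<Longrightarrow> inv y \<in> X"
    using data by (auto simp: cayley_map_data_def)
  have stepX: "Q (g \<otimes> y)" if "g \<in> carrier G" "Q g" "y \<in> X" for g y
    using step ex_index that by blast
  have "Q (g \<otimes> h)" if "h \<in> generate G X" "g \<in> carrier G" "Q g" for g h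
    using that
  proof (induction h arbitrary: g rule: generate.induct)
    case (eng h1 h2)
    then have "h1 \<in> carrier G" "h2 \<in> carrier G" using X(2) by auto
    moreover have "Q (g \<otimes> h1 \<otimes> h2)" using eng calculation by blast
    ultimately show ?case using eng by (simp add: m_assoc)
  qed (use stepX X(3) in auto)
  from this[of g \<one>] show ?thesis using assms(1) one by (simp add: X(2))
qed

definition maps_arcs :: "int \<Rightarrow> ('a \<Rightarrow> 'a) \<Rightarrow> ('a \<Rightarrow> int) \<Rightarrow> bool" where
  "maps_arcs \<epsilon> f \<pi> \<longleftrightarrow> (\<forall>g\<in>carrier G. f g \<in> carrier G \<and> (\<forall>i. f (g \<otimes> z i) = f g \<otimes> z (\<epsilon> * i + \<pi> g)))"

lemma maps_arcs_closed: "maps_arcs \<epsilon> f \<pi> \<Longrightarrow> g \<in> carrier G \<Longrightarrow> f g \<in> carrier G"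
  by (simp add: maps_arcs_def)

lemma maps_arcs_step: "maps_arcs \<epsilon> f \<pi> \<Longrightarrow> g \<in> carrier G \<Longrightarrow> f (g \<otimes> z i) = f g \<otimes> z (\<epsilon> * i + \<pi> g)"
  by (simp add: maps_arcs_def)

lemma maps_arcs_translate: "u \<in> carrier G \<Longrightarrow> maps_arcs 1 ((\<otimes>) u) (\<lambda>_. 0)"
  by (simp add: maps_arcs_def m_assoc)

lemma maps_arcs_comp:
  "maps_arcs \<epsilon> f \<pi> \<Longrightarrow> maps_arcs \<epsilon>' f' \<pi>' \<Longrightarrow>
    maps_arcs (\<epsilon> * \<epsilon>') (\<lambda>g. f (f' g)) (\<lambda>g. \<epsilon> * \<pi>' g + \<pi> (f' g))"
  by (simp add: maps_arcs_def algebra_simps)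

lemma
  assumes "graph_iso M M f" and "g \<in> carrier G"
  shows graph_iso_closed: "f g \<in> carrier G" and graph_iso_neighbour: "\<exists>j. f (g \<otimes> z i) = f g \<otimes> z j"
proof -
  show "f g \<in> carrier G" using assms by (auto simp: graph_iso_def verts_M bij_betw_def)
  have "adj M (f g) (f (g \<otimes> z i))"
    using assms adj_mult_z[OF assms(2), of i] by (simp add: graph_iso_def verts_M)
  then show "\<exists>j. f (g \<otimes> z i) = f g \<otimes> z j" by (simp add: adj_iff)
qed

lemma graph_iso_maps_arcs:
  assumes f: "graph_iso M M f"
    and turn: "\<And>g i j. g \<in> carrier G \<Longrightarrow> f (g \<otimes> z i) = f g \<otimes> z j \<Longrightarrow> f (g \<otimes> z (i + 1)) = f g \<otimes> z (j + \<epsilon>)"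
  shows "\<exists>\<pi>. maps_arcs \<epsilon> f \<pi>"
proof -
  note closed = graph_iso_closed[OF f]
  have "\<exists>t. \<forall>i. f (g \<otimes> z i) = f g \<otimes> z (\<epsilon> * i + t)" if g: "g \<in> carrier G" for g
  proof -
    have "\<exists>j. f (g \<otimes> z i) = f g \<otimes> z j" for i by (rule graph_iso_neighbour[OF f g])
    then obtain \<sigma> where \<sigma>: "\<And>i. f (g \<otimes> z i) = f g \<otimes> z (\<sigma> i)" by metis
    have "f g \<otimes> z (\<sigma> (i + 1)) = f g \<otimes> z (\<sigma> i + \<epsilon>)" for i using turn[OF g \<sigma>] by (simp add: \<sigma>)
    then have "d dvd \<sigma> (i + 1) - (\<sigma> i + \<epsilon>)" for i using closed[OF g] by (simp add: z_eq_iff)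
    then have "d dvd \<sigma> i - (\<sigma> 0 + i * \<epsilon>)" for i by (intro int_progression_cong) simp_all
    then have "z (\<sigma> i) = z (\<epsilon> * i + \<sigma> 0)" for i unfolding z_eq_iff by (metis add.commute mult.commute)
    then show ?thesis using \<sigma> by metis
  qed
  then obtain \<pi> where "\<forall>g\<in>carrier G. \<forall>i. f (g \<otimes> z i) = f g \<otimes> z (\<epsilon> * i + \<pi> g)" by metis
  then show ?thesis using closed unfolding maps_arcs_def by blast
qed

lemma pres_iso_maps_arcs:
  assumes "pres_iso M M f"
  shows "\<exists>\<pi>. maps_arcs 1 f \<pi>"
proof (rule graph_iso_maps_arcs)
  show f: "graph_iso M M f" using assms by (simp add: pres_iso_def)
  fix g i j assume g: "g \<in> carrier G" and j: "f (g \<otimes> z i) = f g \<otimes> z j"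
  have "f (rot M g (g \<otimes> z i)) = rot M (f g) (f (g \<otimes> z i))"
    using assms g adj_mult_z[OF g, of i] by (simp add: pres_iso_def verts_M)
  then show "f (g \<otimes> z (i + 1)) = f g \<otimes> z (j + 1)" 
    using g graph_iso_closed[OF f g] by (simp add: j rot_mult_z)
qed

lemma rev_iso_maps_arcs:
  assumes "rev_iso M M f"
  shows "\<exists>\<pi>. maps_arcs (- 1) f \<pi>"
proof (rule graph_iso_maps_arcs)
  show f: "graph_iso M M f" using assms by (simp add: rev_iso_def)
  fix g i j assume g: "g \<in> carrier G" and j: "f (g \<otimes> z i) = f g \<otimes> z j"
  note fg = graph_iso_closed[OF f g]
  obtain k where k: "f (g \<otimes> z (i + 1)) = f g \<otimes> z k" using graph_iso_neighbour[OF f g] by blast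
  have "rot M (f g) (f (rot M g (g \<otimes> z i))) = f (g \<otimes> z i)"
    using assms g adj_mult_z[OF g, of i] by (simp add: rev_iso_def verts_M)
  then have "f g \<otimes> z (k + 1) = f g \<otimes> z j" using g fg by (simp add: rot_mult_z k j)
  then have "d dvd k + 1 - j" using fg by (simp add: z_eq_iff)
  then have "d dvd k - (j + - 1)" by algebra
  then have "z k = z (j + - 1)" by (simp only: z_eq_iff)
  then show "f (g \<otimes> z (i + 1)) = f g \<otimes> z (j + - 1)" by (simp add: k)
qed

lemma maps_arcs_preimage:
  assumes f: "maps_arcs \<epsilon> f \<pi>" and \<epsilon>: "\<epsilon> * \<epsilon> = 1" and g: "g \<in> carrier G"
  shows "\<exists>i. f (g \<otimes> z i) = f g \<otimes> z j"
proof -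
  have "\<epsilon> * (\<epsilon> * (j - \<pi> g)) + \<pi> g = j" using \<epsilon> by (simp add: mult.assoc[symmetric])
  then show ?thesis using maps_arcs_step[OF f g] by metis
qed

lemma maps_arcs_surj:
  assumes f: "maps_arcs \<epsilon> f \<pi>" and \<epsilon>: "\<epsilon> * \<epsilon> = 1"
  shows "f ` carrier G = carrier G"
proof
  show "f ` carrier G \<subseteq> carrier G" using maps_arcs_closed[OF f] by blast
  have "f \<one> \<otimes> g \<in> f ` carrier G" if "g \<in> carrier G" for g
    using that
  proof (induction g rule: carrier_induct)
    case (step g i)
    then obtain v where v: "v \<in> carrier G" "f \<one> \<otimes> g = f v" by blast
    obtain j where "f (v \<otimes> z j) = f v \<otimes> z i" using maps_arcs_preimage[OF f \<epsilon> v(1)] by blast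
    then have "f \<one> \<otimes> (g \<otimes> z i) = f (v \<otimes> z j)"
      using v(2) step(1) maps_arcs_closed[OF f] by (simp add: m_assoc[symmetric])
    then show ?case using v(1) by simp
  qed (use maps_arcs_closed[OF f] in simp)
  then have "f \<one> \<otimes> (inv (f \<one>) \<otimes> w) \<in> f ` carrier G" if "w \<in> carrier G" for w
    using maps_arcs_closed[OF f] that by simp
  then show "carrier G \<subseteq> f ` carrier G"
    using maps_arcs_closed[OF f, of \<one>] by (auto simp: m_assoc[symmetric])
qed

lemma maps_arcs_graph_iso:
  assumes f: "maps_arcs \<epsilon> f \<pi>" and \<epsilon>: "\<epsilon> * \<epsilon> = 1"
  shows "graph_iso M M f"
proof -
  have "finite (carrier G)" using data by (simp add: cayley_map_data_def)
  moreover note maps_arcs_surj[OF f \<epsilon>]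
  ultimately have bij: "bij_betw f (carrier G) (carrier G)"
    by (simp add: bij_betw_def eq_card_imp_inj_on)
  have "(\<exists>i. w = v \<otimes> z i) \<longleftrightarrow> (\<exists>i. f w = f v \<otimes> z i)" if v: "v \<in> carrier G" and w: "w \<in> carrier G" for v w
  proof
    assume "\<exists>i. f w = f v \<otimes> z i"
    then obtain i where "f w = f (v \<otimes> z i)" using maps_arcs_preimage[OF f \<epsilon> v] by metis
    moreover have "inj_on f (carrier G)" using bij by (simp add: bij_betw_def)
    ultimately have "w = v \<otimes> z i" using v w by (simp add: inj_on_eq_iff)
    then show "\<exists>i. w = v \<otimes> z i" by blast
  qed (use maps_arcs_step[OF f v] in blast)
  then show ?thesis using bij maps_arcs_closed[OF f] by (simp add: graph_iso_def verts_M adj_iff)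
qed

lemma maps_arcs_pres_iso:
  assumes f: "maps_arcs 1 f \<pi>"
  shows "pres_iso M M f"
  unfolding pres_iso_def
proof (intro conjI ballI impI)
  show "graph_iso M M f" by (rule maps_arcs_graph_iso[OF f]) simp
  show "f (rot M v w) = rot M (f v) (f w)" if "adj M v w" for v w
    using that maps_arcs_closed[OF f] maps_arcs_step[OF f]
    by (auto simp: adj_iff rot_mult_z algebra_simps)
qed

lemma maps_arcs_rev_iso:
  assumes f: "maps_arcs (- 1) f \<pi>"
  shows "rev_iso M M f"
  unfolding rev_iso_def
proof (intro conjI ballI impI)
  show "graph_iso M M f" by (rule maps_arcs_graph_iso[OF f]) simp
  show "rot M (f v) (f (rot M v w)) = f w" if "adj M v w" for v w
    using that maps_arcs_closed[OF f] maps_arcs_step[OF f] by (auto simp: adj_iff rot_mult_z)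
qed

lemma ex_vertex_rotation:
  assumes "regular_map M"
  shows "\<exists>f \<pi>. maps_arcs 1 f \<pi> \<and> f \<one> = \<one> \<and> d dvd \<pi> \<one> - t"
proof -
  have arc: "(\<one>, {\<one>, z i}) \<in> arcs M" for i
    using adj_iff[of \<one> "z i"] unfolding arcs_def verts_M by auto
  obtain f where f: "pres_iso M M f" "f \<one> = \<one>" "f ` {\<one>, z 0} = {\<one>, z t}"
    using bspec[OF bspec[OF assms[unfolded regular_map_def] arc[of 0], unfolded prod.case] arc[of t]] by auto
  obtain \<pi> where \<pi>: "maps_arcs 1 f \<pi>" using pres_iso_maps_arcs[OF f(1)] by blast
  have "f (z 0) = z t" using f(2,3) z_neq_one[of t] by auto
  then have "z (\<pi> \<one>) = z t" using maps_arcs_step[OF \<pi>, of \<one> 0] f(2) by simp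
  then show ?thesis using \<pi> f(2) z_eq_iff by blast
qed

lemma regular_mapI:
  assumes f: "maps_arcs 1 f \<pi>" and one: "f \<one> = \<one>" "\<pi> \<one> = 1"
  shows "regular_map M"
proof -
  have f_z: "f (z i) = z (i + 1)" for i using maps_arcs_step[OF f, of \<one> i] one by simp
  have rotation: "\<exists>\<pi>'. maps_arcs 1 (f ^^ k) \<pi>' \<and> (f ^^ k) \<one> = \<one> \<and> (\<forall>i. (f ^^ k) (z i) = z (i + int k))" for k
  proof (induction k)
    case 0
    have "maps_arcs 1 (f ^^ 0) (\<lambda>_. 0)" by (simp add: maps_arcs_def)
    then show ?case by fastforce
  next
    case (Suc k)
    then obtain \<pi>' where \<pi>': "maps_arcs 1 (f ^^ k) \<pi>'" "(f ^^ k) \<one> = \<one>" "\<forall>i. (f ^^ k) (z i) = z (i + int k)"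
      by blast
    show ?case using maps_arcs_comp[OF f \<pi>'(1)] \<pi>'(2,3) one(1) by (auto simp: o_def f_z algebra_simps)
  qed
  have "\<exists>h. pres_iso M M h \<and> h v = v' \<and> h ` {v, v \<otimes> z i} = {v', v' \<otimes> z j}"
    if v: "v \<in> carrier G" "v' \<in> carrier G" for v v' i j
  proof -
    define k where "k = nat ((j - i) mod d)"
    have k: "z (i + int k) = z j"
      unfolding z_eq_iff using d_pos by (simp add: k_def mod_eq_dvd_iff[symmetric] mod_simps)
    obtain \<pi>' where \<pi>': "maps_arcs 1 (f ^^ k) \<pi>'" "(f ^^ k) \<one> = \<one>" "\<forall>i. (f ^^ k) (z i) = z (i + int k)"
      using rotation by blast
    define h where "h g = v' \<otimes> (f ^^ k) (inv v \<otimes> g)" for g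
    have "pres_iso M M h"
      using maps_arcs_comp[OF maps_arcs_translate[OF v(2)]
        maps_arcs_comp[OF \<pi>'(1) maps_arcs_translate[OF inv_closed[OF v(1)]]]]
      unfolding h_def by (intro maps_arcs_pres_iso) simp
    then show ?thesis using v \<pi>'(2,3) k by (auto simp: h_def inv_mult_z)
  qed
  then show ?thesis unfolding regular_map_def arcs_def verts_M adj_iff by fast
qed

lemma numbered_cayley_map_shift: "numbered_cayley_map G X p d (\<lambda>i. z (i + a))"
proof unfold_locales
  have "z i = z (i - a + a)" for i by simp
  then show "range (\<lambda>i. z (i + a)) = X" unfolding range_z[symmetric] by blast
qed (use data d_pos z_eq_iff p_z in \<open>simp_all add: ac_simps\<close>)

lemma isomorphic_CM_cycle:
  assumes "group H" and f: "f \<in> iso G H" and len: "int (length ys) = d"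
    and nth: "\<And>k. k < length ys \<Longrightarrow> ys ! k = f (z (a + int k))"
  shows "M \<simeq>\<^sub>m CM_cycle H ys"
proof -
  have inj: "f (z i) = f (z j) \<longleftrightarrow> d dvd i - j" for i j
    using f z_eq_iff[of i j] inj_on_eq_iff[of f "carrier G" "z i" "z j"]
    by (simp add: iso_def bij_betw_def)
  have "ys \<noteq> []" using d_pos len by auto
  then have set_ys: "set ys = range (\<lambda>i. f (z (a + i)))"
    and cycle: "cycle_of_list ys (f (z (a + i))) = f (z (a + (i + 1)))" for i
    using set_periodic_list[of ys "\<lambda>i. f (z (a + i))"] cycle_of_periodic_list[of ys "\<lambda>i. f (z (a + i))"]
      nth inj len by simp_all
  have index: "\<exists>i. y = z (a + i)" if "y \<in> X" for y
    using ex_index[OF that] by (metis add.commute diff_add_cancel)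
  then have "set ys = f ` X" unfolding set_ys using z_in by blast
  moreover have "f (p y) = cycle_of_list ys (f y)" if "y \<in> X" for y
    using index[OF that] cycle by (auto simp: p_z add.assoc)
  moreover have "X \<subseteq> carrier G" "p ` X \<subseteq> X" using z_closed z_in p_z range_z by auto
  ultimately have "pres_iso M (CM H (set ys) (cycle_of_list ys)) f"
    using CM_pres_iso[OF is_group assms(1) f, of X p "cycle_of_list ys"] by simp
  then show ?thesis unfolding map_isomorphic_def CM_cycle_def by blast
qed

end

lemma ex_numbered_cayley_map:
  assumes "cayley_map_data G X p"
  shows "\<exists>z. numbered_cayley_map G X p (int (card X)) z"
proof -
  have X: "group G" "finite X" "cyclic_on p X"
    using assms by (auto simp: cayley_map_data_def intro: finite_cyclic_on)
  obtain z where z: "range z = X" "\<And>i j. z i = z j \<longleftrightarrow> int (card X) dvd i - j" "\<And>i. p (z i) = z (i + 1)"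
    using cyclic_on_numbering[OF X(3)] by blast
  have "X \<noteq> {}" using z(1) by blast
  then show ?thesis
    using assms X z by (auto simp: numbered_cayley_map_def numbered_cayley_map_axioms_def card_gt_0_iff)
qed

lemma numbered_cayley_map_cycle:
  fixes G (structure)
  assumes "group G" and finite: "finite (carrier G)" and "ys \<noteq> []"
    and nth: "\<And>k. k < length ys \<Longrightarrow> ys ! k = z (int k)"
    and z_eq_iff: "\<And>i j. z i = z j \<longleftrightarrow> int (length ys) dvd i - j"
    and closed: "\<And>i. z i \<in> carrier G - {\<one>}" and inverse: "\<And>i. \<exists>j. z j = inv z i"
    and gen: "carrier G \<subseteq> generate G (range z)"
  shows "distinct ys" and "numbered_cayley_map G (set ys) (cycle_of_list ys) (int (length ys)) z"
proof -
  interpret group G by fact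
  let ?d = "int (length ys)"
  have d_pos: "0 < ?d" using assms(3) by simp
  show "distinct ys" by (rule distinct_periodic_list[OF assms(3) nth z_eq_iff])
  have range_z: "set ys = range z" by (rule set_periodic_list[OF assms(3) nth z_eq_iff])
  have p_z: "cycle_of_list ys (z i) = z (i + 1)" for i
    by (rule cycle_of_periodic_list[OF assms(3) nth z_eq_iff])
  have funpow: "(cycle_of_list ys ^^ k) (z i) = z (i + int k)" for k i
    by (induction k) (simp_all add: p_z algebra_simps)
  have "range z \<subseteq> orbit (cycle_of_list ys) (z 0)"
  proof clarify
    fix i
    have "(cycle_of_list ys ^^ (nat (i mod ?d) + length ys)) (z 0) = z i"
      unfolding funpow z_eq_iff using d_pos by (simp add: mod_eq_dvd_iff[symmetric])
    then show "z i \<in> orbit (cycle_of_list ys) (z 0)"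
      using d_pos unfolding orbit_altdef
      by (metis (mono_tags, lifting) mem_Collect_eq add_gr_0 of_nat_0_less_iff)
  qed
  moreover have "orbit (cycle_of_list ys) (z 0) \<subseteq> range z" by (auto simp: orbit_altdef funpow)
  ultimately have "cyclic_on (cycle_of_list ys) (range z)" unfolding cyclic_on_def by blast
  moreover have "(\<lambda>y. inv y) ` range z = range z"
  proof
    show "(\<lambda>y. inv y) ` range z \<subseteq> range z"
      using inverse by (metis (no_types, lifting) image_subsetI rangeE rangeI)
    show "range z \<subseteq> (\<lambda>y. inv y) ` range z"
      using inverse closed by (metis DiffD1 image_subsetI inv_inv rangeI image_eqI)
  qed
  moreover have "generate G (range z) = carrier G" 
    using gen closed by (intro equalityI generate_incl) auto
  ultimately have "cayley_map_data G (set ys) (cycle_of_list ys)"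
    unfolding cayley_map_data_def range_z
    using finite closed cycle_permutes[of ys] is_group by (auto simp: range_z)
  then show "numbered_cayley_map G (set ys) (cycle_of_list ys) ?d z"
    by unfold_locales (use d_pos range_z z_eq_iff p_z in simp_all)
qed

section \<open>Cayley maps of dihedral groups\<close>

definition dih_reduce :: "nat \<Rightarrow> int \<times> bool \<Rightarrow> int \<times> bool" where
  "dih_reduce n g = (fst g mod int n, snd g)"

lemma dih_reduce_eq_iff: "dih_reduce n g = dih_reduce n h \<longleftrightarrow> dih_cong (int n) g h"
  by (auto simp: dih_reduce_def dih_cong_def mod_eq_dvd_iff)

lemma dih_reduce_cong: "dih_cong (int n) (dih_reduce n g) g"
  by (simp add: dih_reduce_eq_iff[symmetric]) (simp add: dih_reduce_def)

lemma dih_reduce_closed: "0 < n \<Longrightarrow> dih_reduce n g \<in> carrier (dihedral n)"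
  by (simp add: dihedral_def dih_reduce_def)

lemma dih_reduce_id: "g \<in> carrier (dihedral n) \<Longrightarrow> dih_reduce n g = g"
  by (cases g) (auto simp: dihedral_def dih_reduce_def)

lemma dih_cong_carrier_iff:
  "g \<in> carrier (dihedral n) \<Longrightarrow> h \<in> carrier (dihedral n) \<Longrightarrow> dih_cong (int n) g h \<longleftrightarrow> g = h"
  using dih_reduce_eq_iff[of n g h] by (simp add: dih_reduce_id)

lemma mult_dihedral: "g \<otimes>\<^bsub>dihedral n\<^esub> h = dih_reduce n (g \<cdot> h)"
  by (auto simp: dihedral_def dih_reduce_def dih_mult_def split: prod.splits)

lemma one_dihedral: "\<one>\<^bsub>dihedral n\<^esub> = (0, False)"
  by (simp add: dihedral_def)

lemma dih_reduce_one [simp]: "dih_reduce n (0, False) = (0, False)"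
  by (simp add: dih_reduce_def)

lemma dih_reduce_mult: "dih_reduce n (g \<cdot> h) = dih_reduce n g \<otimes>\<^bsub>dihedral n\<^esub> dih_reduce n h"
  unfolding mult_dihedral dih_reduce_eq_iff by (intro dih_cong_mult dih_cong_sym[OF dih_reduce_cong])

lemma finite_dihedral: "finite (carrier (dihedral n))"
  by (simp add: dihedral_def)

lemma apow_conv_dih_reduce: "0 < n \<Longrightarrow> apow n k = dih_reduce n (k, False)"
  by (simp add: apow_eq dih_reduce_def)

lemma apow_b_conv_dih_reduce: "0 < n \<Longrightarrow> apow_b n k = dih_reduce n (k, True)"
  by (simp add: apow_b_eq dih_reduce_def)

definition dih_affine :: "int \<Rightarrow> int \<Rightarrow> int \<times> bool \<Rightarrow> int \<times> bool" where
  "dih_affine \<beta> c g = (\<beta> * fst g + (if snd g then c else 0), snd g)"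

lemma dih_affine_Pair [simp]:
  "dih_affine \<beta> c (i, False) = (\<beta> * i, False)" "dih_affine \<beta> c (i, True) = (\<beta> * i + c, True)"
  by (simp_all add: dih_affine_def)

lemma dih_affine_mult: "dih_affine \<beta> c (g \<cdot> h) = dih_affine \<beta> c g \<cdot> dih_affine \<beta> c h"
  by (auto simp: dih_affine_def dih_mult_def algebra_simps)

lemma dih_affine_cong: "dih_cong n g h \<Longrightarrow> dih_cong n (dih_affine \<beta> c g) (dih_affine \<beta> c h)"
  by (auto simp: dih_affine_def dih_cong_def right_diff_distrib[symmetric])

lemma dih_affine_cong_iff:
  "coprime \<beta> n \<Longrightarrow> dih_cong n (dih_affine \<beta> c g) (dih_affine \<beta> c h) \<longleftrightarrow> dih_cong n g h"
  by (auto simp: dih_affine_def dih_cong_def right_diff_distrib[symmetric]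
      coprime_dvd_mult_right_iff coprime_commute)

lemma dih_affine_iso:
  assumes "0 < n" "coprime \<beta> (int n)"
  shows "(\<lambda>g. dih_reduce n (dih_affine \<beta> c g)) \<in> iso (dihedral n) (dihedral n)"
    (is "?h \<in> _")
proof -
  have "inj_on ?h (carrier (dihedral n))"
    unfolding inj_on_def dih_reduce_eq_iff dih_affine_cong_iff[OF assms(2)]
    by (simp add: dih_cong_carrier_iff)
  moreover have "?h ` carrier (dihedral n) \<subseteq> carrier (dihedral n)"
    using dih_reduce_closed[OF assms(1)] by (simp add: image_subset_iff)
  ultimately have "bij_betw ?h (carrier (dihedral n)) (carrier (dihedral n))"
    by (simp add: bij_betw_def endo_inj_surj[OF finite_dihedral])
  moreover have "?h (g \<otimes>\<^bsub>dihedral n\<^esub> g') = ?h g \<otimes>\<^bsub>dihedral n\<^esub> ?h g'" for g g'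
    unfolding mult_dihedral[of n g] dih_reduce_mult[symmetric] dih_affine_mult[symmetric] dih_reduce_eq_iff
    by (intro dih_affine_cong dih_reduce_cong)
  ultimately show ?thesis using dih_reduce_closed[OF assms(1)] by (auto simp: iso_def hom_def)
qed

locale dihedral_cayley_map = numbered_cayley_map "dihedral n" X p d z for n X p d z
begin

lemma n_gt_0: "0 < n"
  using one_closed by (auto simp: dihedral_def)

definition chi :: "int \<Rightarrow> int" where "chi i = (SOME j. z j = inv\<^bsub>dihedral n\<^esub> z i)"

lemma z_chi: "z (chi i) = inv\<^bsub>dihedral n\<^esub> z i"
  unfolding chi_def by (rule someI_ex[OF ex_inv_z])

lemma dih_reduce_mult_z: "dih_reduce n (g \<cdot> z i) = dih_reduce n g \<otimes>\<^bsub>dihedral n\<^esub> z i"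
  by (simp add: dih_reduce_mult dih_reduce_id[OF z_closed])

sublocale cyclic_generators "int n" d z chi
proof
  show "0 < int n" "0 < d" using n_gt_0 d_pos by simp_all
  show "dih_cong (int n) (z i) (z j) \<longleftrightarrow> d dvd i - j" for i j
    by (simp add: dih_cong_carrier_iff z_eq_iff)
  have "dih_reduce n (z i \<cdot> z (chi i)) = \<one>\<^bsub>dihedral n\<^esub>" for i
    unfolding dih_reduce_mult_z unfolding z_chi by (simp add: dih_reduce_id)
  then show "dih_cong (int n) (z i \<cdot> z (chi i)) (0, False)" for i
    unfolding one_dihedral by (simp flip: dih_reduce_eq_iff)
  show "Q g" if cong: "\<And>g h. dih_cong (int n) g h \<Longrightarrow> Q g \<Longrightarrow> Q h" and "Q (0, False)"
    and step: "\<And>g i. Q g \<Longrightarrow> Q (g \<cdot> z i)" for Q g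
  proof -
    have "Q (dih_reduce n g)" using dih_reduce_closed[OF n_gt_0]
    proof (induction rule: carrier_induct)
      case (step g i)
      then show ?case
        unfolding mult_dihedral using cong[OF dih_cong_sym[OF dih_reduce_cong]] that(3) by blast
    qed (use that(2) in \<open>simp add: one_dihedral\<close>)
    then show ?thesis by (rule cong[OF dih_reduce_cong])
  qed
qed

lemma maps_arcs_imp_arc_map:
  assumes "maps_arcs \<epsilon> f \<pi>"
  shows "arc_map \<epsilon> (\<lambda>g. f (dih_reduce n g)) (\<lambda>g. \<pi> (dih_reduce n g))"
  unfolding arc_map_def
proof (intro conjI allI impI)
  show "dih_cong (int n) (f (dih_reduce n g)) (f (dih_reduce n h))" if "dih_cong (int n) g h" for g h
    using that by (simp add: dih_reduce_eq_iff[symmetric])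
  show "dih_cong (int n) (f (dih_reduce n (g \<cdot> z i))) (f (dih_reduce n g) \<cdot> z (\<epsilon> * i + \<pi> (dih_reduce n g)))" for g i
    unfolding dih_reduce_mult_z maps_arcs_step[OF assms dih_reduce_closed[OF n_gt_0]]
    unfolding mult_dihedral by (rule dih_reduce_cong)
qed

lemma ex_vertex_rotations:
  assumes "regular_map M"
  shows "\<exists>F P. vertex_rotations (int n) d z chi F P"
proof -
  obtain f \<pi> where f: "\<And>t. maps_arcs 1 (f t) (\<pi> t)" "\<And>t. f t \<one>\<^bsub>dihedral n\<^esub> = \<one>\<^bsub>dihedral n\<^esub>"
      "\<And>t. d dvd \<pi> t \<one>\<^bsub>dihedral n\<^esub> - t"
    using ex_vertex_rotation[OF assms] by metis
  have "vertex_rotations (int n) d z chi (\<lambda>t g. f t (dih_reduce n g)) (\<lambda>t g. \<pi> t (dih_reduce n g))"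
    by unfold_locales (use maps_arcs_imp_arc_map[OF f(1)] f(2,3) in \<open>simp_all add: one_dihedral\<close>)
  then show ?thesis by blast
qed

lemma ex_mirror_rotations:
  assumes "reflexible_regular_map M"
  shows "\<exists>F P G S. mirror_rotations (int n) d (\<lambda>i. z (i + a)) (\<lambda>i. chi (i + a) - a) F P G S"
proof -
  obtain F P where "vertex_rotations (int n) d z chi F P"
    using ex_vertex_rotations assms by (auto simp: reflexible_regular_map_def)
  then interpret vertex_rotations "int n" d z chi F P .
  obtain f where f: "rev_iso M M f" using assms by (auto simp: reflexible_regular_map_def)
  obtain \<pi> where \<pi>: "maps_arcs (- 1) f \<pi>" using rev_iso_maps_arcs[OF f] by blast
  let ?u = "inv\<^bsub>dihedral n\<^esub> (f \<one>\<^bsub>dihedral n\<^esub>)"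
  have f_one: "f \<one>\<^bsub>dihedral n\<^esub> \<in> carrier (dihedral n)" by (rule maps_arcs_closed[OF \<pi> one_closed])
  have "maps_arcs (- 1) (\<lambda>g. ?u \<otimes>\<^bsub>dihedral n\<^esub> f g) \<pi>"
    using maps_arcs_comp[OF maps_arcs_translate[OF inv_closed[OF f_one]] \<pi>] by simp
  from maps_arcs_imp_arc_map[OF this]
  have "arc_map (- 1) (\<lambda>g. ?u \<otimes>\<^bsub>dihedral n\<^esub> f (dih_reduce n g)) (\<lambda>g. \<pi> (dih_reduce n g))" .
  moreover have "dih_cong (int n) (?u \<otimes>\<^bsub>dihedral n\<^esub> f (dih_reduce n (0, False))) (0, False)"
    using l_inv[OF f_one] by (simp add: one_dihedral)
  ultimately show ?thesis using ex_mirror_rotations_shift by blast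
qed

lemma ex_reflection: "\<exists>i. is_ref i"
proof (rule ccontr)
  assume no_ref: "\<nexists>i. is_ref i"
  have "\<not> snd g" for g :: "int \<times> bool"
    by (induction g rule: word_induct) (use no_ref in \<open>auto simp: dih_cong_def dih_mult_def\<close>)
  from this[of "(0, True)"] show False by simp
qed

lemma dihedral_cayley_map_shift: "dihedral_cayley_map n X p d (\<lambda>i. z (i + a))"
  unfolding dihedral_cayley_map_def by (rule numbered_cayley_map_shift)

lemma affine_isomorphic_CM_cycle:
  assumes cop: "coprime \<beta> (int n)"
    and L: "list_all2 (\<lambda>i g. dih_cong (int n) (z i) (dih_affine \<beta> c g)) [j..j + d - 1] L"
  shows "M \<simeq>\<^sub>m CM_cycle (dihedral n) (map (dih_reduce n) L)"
proof -
  let ?h = "\<lambda>g. dih_reduce n (dih_affine \<beta> c g)"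
  have h: "?h \<in> iso (dihedral n) (dihedral n)" by (rule dih_affine_iso[OF n_gt_0 cop])
  have len: "int (length L) = d" using list_all2_lengthD[OF L] d_pos by simp
  show ?thesis
  proof (rule isomorphic_CM_cycle[OF is_group iso_set_sym[OF h]])
    show "int (length (map (dih_reduce n) L)) = d" by (simp add: len)
    fix k assume "k < length (map (dih_reduce n) L)"
    then have k: "k < length L" by simp
    have "dih_cong (int n) (z (j + int k)) (dih_affine \<beta> c (L ! k))"
      using list_all2_nthD2[OF L k] k len by (simp add: nth_upto)
    then have "dih_cong (int n) (z (j + int k)) (dih_affine \<beta> c (dih_reduce n (L ! k)))"
      using dih_affine_cong[OF dih_reduce_cong] dih_cong_sym dih_cong_trans by blast
    then have "z (j + int k) = ?h (dih_reduce n (L ! k))"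
      by (simp add: dih_reduce_id flip: dih_reduce_eq_iff)
    then show "map (dih_reduce n) L ! k = inv_into (carrier (dihedral n)) ?h (z (j + int k))"
      using k inv_into_f_f[OF _ dih_reduce_closed[OF n_gt_0], of ?h] h
      by (simp add: iso_def bij_betw_def)
  qed
qed

end

section \<open>The maps of the classification\<close>

lemma cyc1_eq_map_dih_reduce:
  "0 < n \<Longrightarrow> cyc1 n l d = map (dih_reduce n) (map (\<lambda>k. (\<Sum>i<k. l ^ i, True)) [0..<d])"
  by (simp add: cyc1_def apow_b_conv_dih_reduce)

definition alternating :: "int \<Rightarrow> int \<Rightarrow> int \<times> bool" where
  "alternating \<rho> i = (if even i then (\<rho> * i, True) else (i, False))"

definition alternating_cycle :: "nat \<Rightarrow> int \<Rightarrow> (int \<times> bool) list" where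
  "alternating_cycle n \<rho> = map (dih_reduce n) (map (\<lambda>k. alternating \<rho> (int k)) [0..<n])"

lemma cyc2_eq_alternating_cycle: "0 < n \<Longrightarrow> cyc2 n = alternating_cycle n 1"
  by (simp add: cyc2_def alternating_cycle_def alternating_def apow_conv_dih_reduce apow_b_conv_dih_reduce)

lemma cyc3_eq_alternating_cycle:
  assumes "0 < n" "n = 8 * q" "m = 4 * q"
  shows "cyc3 n m = alternating_cycle n (1 + 2 * int q)"
proof -
  have "int (k + (k div 2) * m) = (1 + 2 * int q) * int k" if "even k" for k
    using that by (auto elim!: evenE simp: assms(3) algebra_simps)
  then show ?thesis
    using assms(1)
    by (simp add: cyc3_def alternating_cycle_def alternating_def apow_conv_dih_reduce apow_b_conv_dih_reduce)
qed

definition cycle4 :: "(int \<times> bool) list" where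
  "cycle4 = [(- 1, False), (1, False), (0, True), (2, True)]"

lemma cyc4_eq_map_dih_reduce: "0 < n \<Longrightarrow> cyc4 n = map (dih_reduce n) cycle4"
  by (simp add: cyc4_def cycle4_def apow_conv_dih_reduce apow_b_conv_dih_reduce)

definition cycle5 :: "int \<Rightarrow> (int \<times> bool) list" where
  "cycle5 m = [(- 1, False), (1, False), (0, True), (m + 1, False), (m - 1, False), (m + 2, True)]"

lemma cyc5_eq_map_dih_reduce: "0 < n \<Longrightarrow> cyc5 n m = map (dih_reduce n) (cycle5 (int m))"
  by (simp add: cyc5_def cycle5_def apow_conv_dih_reduce apow_b_conv_dih_reduce)

definition cycle6 :: "int \<Rightarrow> (int \<times> bool) list" where
  "cycle6 m = [(0, True), (m - 2, True), (1, False), (- 2, True), (m, True), (- 1, False)]"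

lemma cyc6_eq_map_dih_reduce: "0 < n \<Longrightarrow> cyc6 n m = map (dih_reduce n) (cycle6 (int m))"
  by (simp add: cyc6_def cycle6_def apow_conv_dih_reduce apow_b_conv_dih_reduce)

section \<open>Identifying reflexible maps\<close>

lemma half_modulus_mult_odd: "n = 2 * m \<Longrightarrow> odd b \<Longrightarrow> n dvd m * b - m" for n m b :: int
  by (elim oddE) (simp add: algebra_simps)

lemma odd_involution_iso: "(\<lambda>(i, e). (i, e \<noteq> odd i)) \<in> iso (dihedral 2) (dihedral 2)" (is "?\<kappa> \<in> _")
proof -
  have "bij_betw ?\<kappa> (carrier (dihedral 2)) (carrier (dihedral 2))"
    by (rule bij_betw_byWitness[where f' = ?\<kappa>]) (auto simp: dihedral_def)
  moreover have "?\<kappa> (g \<otimes>\<^bsub>dihedral 2\<^esub> h) = ?\<kappa> g \<otimes>\<^bsub>dihedral 2\<^esub> ?\<kappa> h" for g h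
    by (cases g; cases h) (auto simp: dihedral_def; presburger)
  then have "?\<kappa> \<in> hom (dihedral 2) (dihedral 2)" by (intro homI) (auto simp: dihedral_def)
  ultimately show ?thesis by (simp add: iso_def)
qed

context dihedral_cayley_map
begin

lemma all_reflections_CM:
  assumes "mirror_rotations (int n) d z chi' F P G S" and all_ref: "\<And>i. is_ref i"
  obtains l where "[l\<^sup>2 = 1] (mod int n)" "least_geom_sum_zero n l (nat d)"
    "M \<simeq>\<^sub>m CM_cycle (dihedral n) (cyc1 n l (nat d))"
proof -
  interpret mirror: mirror_rotations "int n" d z chi' F P G S by fact
  let ?\<beta> = "s 1 - s 0" and ?l = mirror.\<omega>
  note exponent = mirror.all_reflections_exponent[OF all_ref]
  have cop: "coprime ?\<beta> (int n)" by (rule mirror.all_reflections_coprime[OF all_ref])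
  have sum_zero_iff: "int n dvd (\<Sum>i<k. ?l ^ i) \<longleftrightarrow> d dvd int k" for k
  proof -
    have "d dvd int k - 0 \<longleftrightarrow> int n dvd s (int k) - s 0"
      using x_eq_iff[of "int k" 0] all_ref by (simp add: dih_cong_def)
    also have "\<dots> \<longleftrightarrow> int n dvd ?\<beta> * (\<Sum>i<k. ?l ^ i)"
      using dvd_diff_commute exponent[of k] dvd_add_right_iff
      by (metis add_diff_cancel_left' diff_diff_add dvd_diff_right_iff)
    also have "\<dots> \<longleftrightarrow> int n dvd (\<Sum>i<k. ?l ^ i)"
      using cop by (simp add: coprime_dvd_mult_right_iff coprime_commute)
    finally show ?thesis by simp
  qed
  show ?thesis
  proof
    show "[?l\<^sup>2 = 1] (mod int n)"
      using mirror.all_reflections_eigenvalue_square[OF all_ref] by (simp add: cong_iff_dvd_diff)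
    show "least_geom_sum_zero n ?l (nat d)"
      unfolding least_geom_sum_zero_def cong_0_iff sum_zero_iff using d_pos
      by (auto dest: zdvd_imp_le)
    have "list_all2 (\<lambda>i g. dih_cong (int n) (z i) (dih_affine ?\<beta> (s 0) g)) [0..0 + d - 1]
        (map (\<lambda>k. (\<Sum>i<k. ?l ^ i, True)) [0..<nat d])"
      using exponent all_ref d_pos
      by (auto simp: list_all2_conv_all_nth nth_upto dih_cong_def dih_affine_def add.commute)
    from affine_isomorphic_CM_cycle[OF cop this]
    show "M \<simeq>\<^sub>m CM_cycle (dihedral n) (cyc1 n ?l (nat d))"
      by (simp only: cyc1_eq_map_dih_reduce[OF n_gt_0])
  qed
qed

lemma two_in_four_CM:
  assumes "two_in_four (int n) d z chi' F P G S"
  shows "d = 4" and "3 dvd n" and "M \<simeq>\<^sub>m CM_cycle (dihedral n) (cyc4 n)"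
proof -
  interpret pattern: two_in_four "int n" d z chi' F P G S by fact
  show d: "d = 4" by (rule pattern.d_eq_4)
  show "3 dvd n" using pattern.three_dvd_n by presburger
  have period: "z 4 = z 0" "z 5 = z 1" by (simp_all add: z_eq_iff d)
  have "list_all2 (\<lambda>i g. dih_cong (int n) (z i) (dih_affine (- s 2) (s 0) g)) [2..2 + d - 1] cycle4"
    using pattern.s_1 pattern.s_3
    by (simp add: cycle4_def d dih_cong_def pattern.is_ref_iff period algebra_simps)
  then show "M \<simeq>\<^sub>m CM_cycle (dihedral n) (cyc4 n)"
    unfolding cyc4_eq_map_dih_reduce[OF n_gt_0]
    by (rule affine_isomorphic_CM_cycle[rotated]) (use pattern.coprime_s_2 in simp)
qed

lemma two_in_three_CM:
  assumes "two_in_three (int n) d z chi' F P G S"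
  obtains (valency_3) "d = 3" "M \<simeq>\<^sub>m CM_cycle (dihedral 2) [apow_b 2 0, apow_b 2 1, apow 2 1]"
    | (valency_6) m k where "d = 6" "0 < k" "n = 2 * m" "n = 4 * k + 2" "M \<simeq>\<^sub>m CM_cycle (dihedral n) (cyc6 n m)"
proof -
  interpret pattern: two_in_three "int n" d z chi' F P G S by fact
  show ?thesis
    using pattern.d_3_or_6
  proof
    assume d: "d = 3"
    have n: "n = 2" using pattern.two_in_three_3(1)[OF d] by simp
    have "list_all2 (\<lambda>i g. dih_cong (int n) (z i) (dih_affine 1 (s 0) g)) [0..0 + d - 1]
        [(0, True), (1, True), (1, False)]"
      using pattern.two_in_three_3[OF d] by (simp add: d upto_rec1 dih_cong_def pattern.is_ref_iff)
    from affine_isomorphic_CM_cycle[OF _ this]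
    have "M \<simeq>\<^sub>m CM_cycle (dihedral 2) [apow_b 2 0, apow_b 2 1, apow 2 1]"
      by (simp add: n apow_conv_dih_reduce apow_b_conv_dih_reduce)
    with d show ?thesis by (rule valency_3)
  next
    assume d: "d = 6"
    obtain m where m: "int n = 2 * m" "int n dvd s 1 - (s 0 + m - 2 * s 2)"
      by (rule pattern.two_in_three_half[OF d])
    note odd_m = pattern.odd_m[OF d m] and m_gt_1 = pattern.m_gt_1[OF d m]
      and cop = pattern.coprime_s_2[OF d m]
    obtain q where q: "m = int q"
      using m_gt_1 by (metis zero_le_imp_eq_int less_imp_le zero_less_one less_trans)
    have "odd (s 2)" using cop m(1) by auto
    then have "int n dvd m * s 2 - m" by (rule half_modulus_mult_odd[OF m(1)])
    then have "int n dvd s 1 - (s 2 * (m - 2) + s 0)" "int n dvd s 4 - (s 2 * m + s 0)"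
      using m(2) pattern.s_4[OF d m] by algebra+
    then have "list_all2 (\<lambda>i g. dih_cong (int n) (z i) (dih_affine (s 2) (s 0) g)) [0..0 + d - 1] (cycle6 m)"
      using pattern.s_3[OF d] pattern.s_5[OF d]
      by (simp add: cycle6_def d upto_rec1 dih_cong_def pattern.is_ref_iff algebra_simps)
    from affine_isomorphic_CM_cycle[OF cop this] have "M \<simeq>\<^sub>m CM_cycle (dihedral n) (cyc6 n q)"
      by (simp add: cyc6_eq_map_dih_reduce[OF n_gt_0] q)
    moreover have "q = 2 * (q div 2) + 1" "0 < q div 2" using odd_m m_gt_1 unfolding q by presburger+
    ultimately show ?thesis using valency_6[OF d, of "q div 2" q] m(1) q by simp
  qed
qed

lemma one_in_three_CM:
  assumes "one_in_three (int n) d z chi' F P G S"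
  obtains (valency_3) "d = 3" "M \<simeq>\<^sub>m CM_cycle (dihedral 4) [apow_b 4 0, apow 4 1, apow 4 (- 1)]"
    | (valency_6) m k where "d = 6" "0 < k" "n = 2 * m" "n = 8 * k + 4" "M \<simeq>\<^sub>m CM_cycle (dihedral n) (cyc5 n m)"
proof -
  interpret pattern: one_in_three "int n" d z chi' F P G S by fact
  show ?thesis
    using pattern.d_3_or_6
  proof
    assume d: "d = 3"
    have n: "n = 4" using pattern.one_in_three_3(1)[OF d] by simp
    have "list_all2 (\<lambda>i g. dih_cong (int n) (z i) (dih_affine (s 1) (s 0) g)) [0..0 + d - 1]
        [(0, True), (1, False), (- 1, False)]"
      using pattern.one_in_three_3(3)[OF d] by (simp add: d upto_rec1 dih_cong_def pattern.is_ref_iff)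
    from affine_isomorphic_CM_cycle[OF pattern.one_in_three_3(2)[OF d] this]
    have "M \<simeq>\<^sub>m CM_cycle (dihedral 4) [apow_b 4 0, apow 4 1, apow 4 (- 1)]"
      by (simp add: n apow_conv_dih_reduce apow_b_conv_dih_reduce)
    with d show ?thesis by (rule valency_3)
  next
    assume d: "d = 6"
    obtain m where m: "int n = 2 * m" "int n dvd pattern.\<delta> - 2 * s 1 - m"
      by (rule pattern.one_in_three_half[OF d])
    note m_gt_2 = pattern.m_gt_2[OF d m] and cop = pattern.coprime_s_5[OF d m]
      and exponents = pattern.s_1[OF d m] pattern.s_2'[OF d m] pattern.s_3[OF d m] pattern.s_4[OF d m]
    obtain q where q: "m = int q"
      using m_gt_2 by (metis zero_le_imp_eq_int less_imp_le zero_less_numeral less_trans)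
    have "odd (s 5)" using cop m(1) by auto
    then have "int n dvd m * s 5 - m" by (rule half_modulus_mult_odd[OF m(1)])
    then have "int n dvd s 1 - s 5 * (m + 1)" "int n dvd s 2 - s 5 * (m - 1)" "int n dvd s 3 - (s 5 * (m + 2) + s 0)"
      using exponents by algebra+
    moreover have "z 6 = z 0" "z 7 = z 1" "z 8 = z 2" "z 9 = z 3" by (simp_all add: z_eq_iff d)
    ultimately have "list_all2 (\<lambda>i g. dih_cong (int n) (z i) (dih_affine (s 5) (s 0) g)) [4..4 + d - 1] (cycle5 m)"
      using exponents(4) by (simp add: cycle5_def d dih_cong_def pattern.is_ref_iff algebra_simps)
    from affine_isomorphic_CM_cycle[OF cop this] have "M \<simeq>\<^sub>m CM_cycle (dihedral n) (cyc5 n q)"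
      by (simp add: cyc5_eq_map_dih_reduce[OF n_gt_0] q)
    moreover have "q = 4 * (q div 4) + 2" "0 < q div 4"
      using pattern.four_dvd_m_diff[OF d m] m_gt_2 unfolding q by presburger+
    ultimately show ?thesis using valency_6[OF d, of "q div 4" q] m(1) q by simp
  qed
qed

lemma klein_CM:
  assumes n: "n = 2" and d: "d = 2" and "is_ref 0" "\<not> is_ref 1" "odd (s 1)"
  shows "M \<simeq>\<^sub>m CM_cycle (dihedral n) [apow_b n 0, apow_b n 1]"
proof (rule isomorphic_CM_cycle[where a = 0])
  let ?f = "(\<lambda>(i, e). (i, e \<noteq> odd i)) \<circ> (\<lambda>g. dih_reduce 2 (dih_affine 1 (s 0) g))"
  show "?f \<in> iso (dihedral n) (dihedral n)"
    using iso_set_trans[OF dih_affine_iso odd_involution_iso] by (simp add: n)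
  show "[apow_b n 0, apow_b n 1] ! k = ?f (z (0 + int k))"
    if "k < length [apow_b n 0, apow_b n 1]" for k
    using that assms
    by (auto simp: less_Suc_eq apow_b_eq dih_reduce_def dih_affine_def odd_iff_mod_2_eq_one)
qed (use d is_group in simp_all)

lemma alternating_CM:
  assumes d: "d = int n" and cop: "coprime (s 1) (int n)" and ref: "\<And>i. is_ref i \<longleftrightarrow> even i"
    and odd_exponent: "\<And>j. odd j \<Longrightarrow> int n dvd s j - j * s 1"
    and even_exponent: "\<And>i. int n dvd s (2 * i) - (s 0 + 2 * i * \<rho> * s 1)"
  shows "M \<simeq>\<^sub>m CM_cycle (dihedral n) (alternating_cycle n \<rho>)"
proof -
  have "dih_cong (int n) (z i) (dih_affine (s 1) (s 0) (alternating \<rho> i))" for i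
  proof (cases "even i")
    case True
    then obtain j where "i = 2 * j" ..
    then show ?thesis
      using even_exponent[of j] ref[of i] by (simp add: alternating_def dih_cong_def algebra_simps)
  next
    case False
    then show ?thesis
      using odd_exponent[of i] ref[of i] by (simp add: alternating_def dih_cong_def mult.commute)
  qed
  then have "list_all2 (\<lambda>i g. dih_cong (int n) (z i) (dih_affine (s 1) (s 0) g)) [0..0 + d - 1]
      (map (\<lambda>k. alternating \<rho> (int k)) [0..<n])"
    by (simp add: list_all2_conv_all_nth nth_upto d)
  from affine_isomorphic_CM_cycle[OF cop this] show ?thesis by (simp only: alternating_cycle_def)
qed

lemma one_in_two_CM:
  assumes "one_in_two (int n) d z chi' F P G S" and chi'_odd: "\<And>j. odd j \<Longrightarrow> d dvd chi' j + j"
  obtains (cyc2) "d = int n" "even n" "n = 2 \<Longrightarrow> M \<simeq>\<^sub>m CM_cycle (dihedral n) [apow_b n 0, apow_b n 1]"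
      "M \<simeq>\<^sub>m CM_cycle (dihedral n) (cyc2 n)"
    | (cyc3) m where "d = int n" "n = 2 * m" "8 dvd n" "M \<simeq>\<^sub>m CM_cycle (dihedral n) (cyc3 n m)"
proof -
  interpret pattern: one_in_two "int n" d z chi' F P G S by fact
  have d: "d = int n" and cop: "coprime (s 1) (int n)"
    and odd_exponent: "\<And>j. odd j \<Longrightarrow> int n dvd s j - j * s 1"
    and even_exponents: "(\<forall>i. int n dvd s (2 * i) - (s 0 + 2 * i * s 1)) \<or>
      8 dvd int n \<and> (\<forall>i. int n dvd s (2 * i) - (s 0 + i * (2 + int n div 2) * s 1))"
    using pattern.centered_exponents chi'_odd by simp_all
  note isomorphic = alternating_CM[OF d cop pattern.is_ref_iff odd_exponent]
  show ?thesis
    using even_exponents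
  proof
    assume "\<forall>i. int n dvd s (2 * i) - (s 0 + 2 * i * s 1)"
    then have "M \<simeq>\<^sub>m CM_cycle (dihedral n) (cyc2 n)"
      unfolding cyc2_eq_alternating_cycle[OF n_gt_0] by (intro isomorphic) simp_all
    moreover have "M \<simeq>\<^sub>m CM_cycle (dihedral n) [apow_b n 0, apow_b n 1]" if "n = 2"
      using that cop d pattern.is_ref_iff by (intro klein_CM) auto
    ultimately show ?thesis using cyc2 d pattern.even_d by simp
  next
    assume twisted: "8 dvd int n \<and> (\<forall>i. int n dvd s (2 * i) - (s 0 + i * (2 + int n div 2) * s 1))"
    have "8 dvd n" using conjunct1[OF twisted] by presburger
    then obtain q where q: "n = 8 * q" ..
    have "M \<simeq>\<^sub>m CM_cycle (dihedral n) (cyc3 n (4 * q))"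
      unfolding cyc3_eq_alternating_cycle[OF n_gt_0 q HOL.refl]
      using twisted by (intro isomorphic) (simp_all add: q algebra_simps)
    then show ?thesis using cyc3 d q by simp
  qed
qed

lemma ex_centered_one_in_two:
  assumes refl: "reflexible_regular_map M" and pattern: "one_in 2 z chi b"
  obtains a F P G S where "one_in_two (int n) d (\<lambda>i. z (i + a)) (\<lambda>i. chi (i + a) - a) F P G S"
    "\<And>j. odd j \<Longrightarrow> d dvd chi (j + a) - a + j"
proof -
  have one_in_two: "\<exists>F P G S. one_in_two (int n) d (\<lambda>i. z (i + a)) (\<lambda>i. chi (i + a) - a) F P G S"
    if "even (a - b)" for a
    using ex_mirror_rotations[OF refl, of a] one_in_shift[OF pattern that]
    by (simp add: one_in_two_def periodic_reflections_def periodic_reflections_axioms_def)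
  obtain F P G S where "one_in_two (int n) d (\<lambda>i. z (i + b)) (\<lambda>i. chi (i + b) - b) F P G S"
    using one_in_two[of b] by auto
  from one_in_two.ex_center[OF this]
  obtain e where e: "even e" "\<And>j. odd j \<Longrightarrow> d dvd chi (j + b) - b + j - 2 * e" by blast
  moreover have "d dvd chi (j + (e + b)) - (e + b) + j" if "odd j" for j
    using e(2)[of "j + e"] that e(1) by (simp add: algebra_simps)
  ultimately show ?thesis using one_in_two[of "e + b"] that by auto
qed

lemma reflexible_pattern_cases:
  assumes refl: "reflexible_regular_map M" and "\<not> is_ref j"
  obtains (one_in_two) a F P G S where "one_in_two (int n) d (\<lambda>i. z (i + a)) (\<lambda>i. chi (i + a) - a) F P G S"
      "\<And>j. odd j \<Longrightarrow> d dvd chi (j + a) - a + j"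
    | (one_in_three) a F P G S where "one_in_three (int n) d (\<lambda>i. z (i + a)) (\<lambda>i. chi (i + a) - a) F P G S"
    | (two_in_three) a F P G S where "two_in_three (int n) d (\<lambda>i. z (i + a)) (\<lambda>i. chi (i + a) - a) F P G S"
    | (two_in_four) a F P G S where "two_in_four (int n) d (\<lambda>i. z (i + a)) (\<lambda>i. chi (i + a) - a) F P G S"
proof -
  obtain F P where "vertex_rotations (int n) d z chi F P"
    using ex_vertex_rotations refl by (auto simp: reflexible_regular_map_def)
  then obtain a where pattern: "reflection_pattern z chi a"
    using ex_reflection_pattern ex_reflection assms(2) by metis
  obtain F P G S where mirror: "mirror_rotations (int n) d (\<lambda>i. z (i + a)) (\<lambda>i. chi (i + a) - a) F P G S"
    using ex_mirror_rotations[OF refl] by blast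
  from pattern consider "one_in 2 z chi a" | "one_in 3 z chi a" | "two_in_3 z a" | "two_in_4 z chi a"
    unfolding reflection_pattern_def by blast
  then show ?thesis
  proof cases
    assume "one_in 2 z chi a"
    from ex_centered_one_in_two[OF refl this] show ?thesis using one_in_two by blast
  next
    assume "one_in 3 z chi a"
    then show ?thesis
      using one_in_three[OF one_in_three.intro[OF mirror one_in_three_axioms.intro]] one_in_shift
      by auto
  next
    assume "two_in_3 z a"
    then show ?thesis
      using two_in_three[OF two_in_three.intro[OF mirror two_in_three_axioms.intro]] two_in_3_shift
      by blast
  next
    assume "two_in_4 z chi a"
    then show ?thesis
      using two_in_four[OF two_in_four.intro[OF mirror two_in_four_axioms.intro]] two_in_4_shift
      by blast
  qed
qed

end

theorem reflexible_regular_CM_dihedral_cases: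
  assumes R: "reflexible_regular_CM (dihedral n) X p"
  obtains (cyc1) l where "[l\<^sup>2 = 1] (mod int n)" "least_geom_sum_zero n l (card X)"
      "CM (dihedral n) X p \<simeq>\<^sub>m CM_cycle (dihedral n) (cyc1 n l (card X))"
    | (cyc2) "card X = n" "even n" "n = 2 \<Longrightarrow> CM (dihedral n) X p \<simeq>\<^sub>m CM_cycle (dihedral n) [apow_b n 0, apow_b n 1]"
      "CM (dihedral n) X p \<simeq>\<^sub>m CM_cycle (dihedral n) (cyc2 n)"
    | (cyc3) m where "card X = n" "n = 2 * m" "8 dvd n" "CM (dihedral n) X p \<simeq>\<^sub>m CM_cycle (dihedral n) (cyc3 n m)"
    | (cyc4) k where "card X = 4" "0 < k" "n = 3 * k" "CM (dihedral n) X p \<simeq>\<^sub>m CM_cycle (dihedral n) (cyc4 n)"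
    | (cyc5) m k where "card X = 6" "0 < k" "n = 2 * m" "n = 8 * k + 4"
      "CM (dihedral n) X p \<simeq>\<^sub>m CM_cycle (dihedral n) (cyc5 n m)"
    | (cyc6) m k where "card X = 6" "0 < k" "n = 2 * m" "n = 4 * k + 2"
      "CM (dihedral n) X p \<simeq>\<^sub>m CM_cycle (dihedral n) (cyc6 n m)"
    | (dihedral_2) "card X = 3" "CM (dihedral n) X p \<simeq>\<^sub>m CM_cycle (dihedral 2) [apow_b 2 0, apow_b 2 1, apow 2 1]"
    | (dihedral_4) "card X = 3" "CM (dihedral n) X p \<simeq>\<^sub>m CM_cycle (dihedral 4) [apow_b 4 0, apow 4 1, apow 4 (- 1)]"
proof -
  have refl: "reflexible_regular_map (CM (dihedral n) X p)" and "cayley_map_data (dihedral n) X p"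
    using R by (simp_all add: reflexible_regular_CM_def)
  from ex_numbered_cayley_map[OF this(2)]
  obtain z where "dihedral_cayley_map n X p (int (card X)) z" unfolding dihedral_cayley_map_def ..
  then interpret dihedral_cayley_map n X p "int (card X)" z .
  show thesis
  proof (cases "\<forall>i. is_ref i")
    case True
    obtain F P G S where "mirror_rotations (int n) (int (card X)) z chi F P G S"
      using ex_mirror_rotations[OF refl, of 0] by auto
    then show thesis by (rule all_reflections_CM) (use True cyc1 in simp_all)
  next
    case False
    then obtain j where "\<not> is_ref j" by blast
    with refl show thesis
    proof (cases rule: reflexible_pattern_cases)
      case (one_in_two a F P G S)
      from dihedral_cayley_map.one_in_two_CM[OF dihedral_cayley_map_shift this]
      show thesis by (cases; use cyc2 cyc3 in simp)
    next
      case (one_in_three a F P G S)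
      interpret shifted: dihedral_cayley_map n X p "int (card X)" "\<lambda>i. z (i + a)"
        by (rule dihedral_cayley_map_shift)
      from one_in_three show thesis
      proof (cases rule: shifted.one_in_three_CM)
        case (valency_6 m k)
        then show thesis by (intro cyc5[of k m]) simp_all
      qed (use dihedral_4 in simp)
    next
      case (two_in_three a F P G S)
      interpret shifted: dihedral_cayley_map n X p "int (card X)" "\<lambda>i. z (i + a)"
        by (rule dihedral_cayley_map_shift)
      from two_in_three show thesis
      proof (cases rule: shifted.two_in_three_CM)
        case (valency_6 m k)
        then show thesis by (intro cyc6[of k m]) simp_all
      qed (use dihedral_2 in simp)
    next
      case (two_in_four a F P G S)
      note dihedral_cayley_map.two_in_four_CM[OF dihedral_cayley_map_shift this]
      moreover from this(2) n_gt_0 obtain k where "n = 3 * k" "0 < k" by (auto elim!: dvdE)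
      ultimately show thesis using cyc4 by simp
    qed
  qed
qed

lemma cyc1_two: "0 < n \<Longrightarrow> cyc1 n l 2 = [apow_b n 0, apow_b n 1]"
  by (simp add: cyc1_def upt_rec numeral_2_eq_2)

lemma CM_cycle_cyc1_three:
  assumes "2 \<le> n" and l: "[l\<^sup>2 = 1] (mod int n)" and "least_geom_sum_zero n l 3"
  shows "CM_cycle (dihedral n) (cyc1 n l 3) = CM_cycle (dihedral 3) [apow_b 3 0, apow_b 3 1, apow_b 3 2]"
proof -
  have "(\<Sum>i<(3::nat). l ^ i) = 1 + l + l * l" by (simp add: numeral_3_eq_3)
  then have "int n dvd 1 + l + l * l" using assms(3) by (simp add: least_geom_sum_zero_def cong_0_iff)
  moreover have "int n dvd l * l - 1" using l by (simp add: cong_iff_dvd_diff power2_eq_square)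
  ultimately have l_2: "int n dvd l + 2" by algebra
  with \<open>int n dvd l * l - 1\<close> have "int n dvd 3" by algebra
  then have "n dvd 3" by presburger
  moreover have "prime (3 :: nat)" by simp
  ultimately have n: "n = 3" using assms(1) by (auto simp: prime_nat_iff)
  have "(1 + l) mod 3 = 2" using l_2 unfolding n by presburger
  then show ?thesis
    by (simp add: cyc1_def n upt_rec numeral_3_eq_3 apow_b_eq)
qed

section \<open>Reflexibility and regularity of the listed maps\<close>

lemma dihedral_induct [case_names one reflection rotation]:
  assumes "Q (0, False)" and reflection: "\<And>g. Q g \<Longrightarrow> Q (g \<cdot> (0, True))"
    and rotation: "\<And>g. Q g \<Longrightarrow> Q (g \<cdot> (1, False))"
  shows "Q g"
proof -
  have rotations: "Q (j, False)" for j
  proof (induction j rule: int_induct[where k = 0])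
    case (step1 i)
    then show ?case using rotation[of "(i, False)"] by simp
  next
    case (step2 i)
    then show ?case using reflection[OF rotation[OF reflection[OF step2(2)]]] by simp
  qed (rule assms(1))
  moreover have "Q (j, True)" for j using reflection[OF rotations[of j]] by simp
  ultimately show ?thesis by (cases g) (metis (full_types))
qed

lemma cyclic_generators_numbered_cayley_map:
  assumes gens: "cyclic_generators (int n) (int (length ys)) y chi"
    and nth: "\<And>k. k < length ys \<Longrightarrow> ys ! k = dih_reduce n (y (int k))"
    and neq_one: "\<And>i. \<not> dih_cong (int n) (y i) (0, False)"
  shows "distinct ys"
    and "numbered_cayley_map (dihedral n) (set ys) (cycle_of_list ys) (int (length ys)) (\<lambda>i. dih_reduce n (y i))"
proof -
  interpret cyclic_generators "int n" "int (length ys)" y chi by fact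
  let ?D = "dihedral n" and ?z = "\<lambda>i. dih_reduce n (y i)"
  have n: "0 < n" using n_pos by simp
  interpret group ?D by (rule group_dihedral[OF n])
  note closed = dih_reduce_closed[OF n]
  have nonempty: "ys \<noteq> []" using d_pos by auto
  have z_eq_iff: "?z i = ?z j \<longleftrightarrow> int (length ys) dvd i - j" for i j
    by (simp add: dih_reduce_eq_iff x_eq_iff)
  have z_closed: "?z i \<in> carrier ?D - {\<one>\<^bsub>?D\<^esub>}" for i
    using closed neq_one[of i] by (simp add: one_dihedral flip: dih_reduce_eq_iff)
  have z_inverse: "\<exists>j. ?z j = inv\<^bsub>?D\<^esub> ?z i" for i
  proof -
    have "?z i \<otimes>\<^bsub>?D\<^esub> ?z (chi i) = \<one>\<^bsub>?D\<^esub>"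
      using x_mult_x_chi[of i] by (simp add: one_dihedral flip: dih_reduce_mult dih_reduce_eq_iff)
    then show ?thesis using closed by (metis inv_equality inv_inv)
  qed
  have "dih_reduce n g \<in> generate ?D (range ?z)" for g
  proof (induction g rule: word_induct)
    case (cong g h)
    then show ?case by (simp flip: dih_reduce_eq_iff)
  next
    case one
    show ?case using generate.one[of ?D] by (simp add: one_dihedral)
  next
    case (step g i)
    then show ?case unfolding dih_reduce_mult by (rule generate.eng[OF _ generate.incl]) simp
  qed
  then have generated: "carrier ?D \<subseteq> generate ?D (range ?z)" using dih_reduce_id by (metis subsetI)
  note cycle = numbered_cayley_map_cycle[OF is_group finite_dihedral nonempty nth z_eq_iff z_closed z_inverse generated]
  show "distinct ys" by (rule cycle(1))
  show "numbered_cayley_map ?D (set ys) (cycle_of_list ys) (int (length ys)) ?z" by (rule cycle(2))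
qed

lemma reflexible_regular_CM_cycleI:
  assumes gens: "cyclic_generators (int n) (int (length ys)) y chi"
    and nth: "\<And>k. k < length ys \<Longrightarrow> ys ! k = dih_reduce n (y (int k))"
    and neq_one: "\<And>i. \<not> dih_cong (int n) (y i) (0, False)"
    and f: "cyclic_generators.arc_map (int n) y 1 f \<pi>" "dih_cong (int n) (f (0, False)) (0, False)" "\<pi> (0, False) = 1"
    and f': "cyclic_generators.arc_map (int n) y (- 1) f' \<pi>'"
  shows "reflexible_regular_CM_cycle (dihedral n) ys"
proof -
  interpret cyclic_generators "int n" "int (length ys)" y chi by fact
  let ?D = "dihedral n" and ?z = "\<lambda>i. dih_reduce n (y i)"
  note cycle = cyclic_generators_numbered_cayley_map[OF gens nth neq_one]
  interpret numbered_cayley_map ?D "set ys" "cycle_of_list ys" "int (length ys)" ?z by (rule cycle(2))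
  have n: "0 < n" using n_pos by simp
  have maps_arcs: "maps_arcs \<epsilon> (\<lambda>g. dih_reduce n (h g)) \<rho>" if h: "arc_map \<epsilon> h \<rho>" for \<epsilon> h \<rho>
    unfolding maps_arcs_def
  proof (intro ballI conjI allI dih_reduce_closed[OF n])
    fix g i
    have "dih_cong (int n) (h (dih_reduce n (g \<cdot> ?z i))) (h (g \<cdot> y i))"
      by (intro arc_map_cong[OF h] dih_cong_trans[OF dih_reduce_cong] dih_cong_mult dih_cong_refl dih_reduce_cong)
    also have "dih_cong (int n) \<dots> (h g \<cdot> y (\<epsilon> * i + \<rho> g))" by (rule arc_map_step[OF h])
    finally show "dih_reduce n (h (g \<otimes>\<^bsub>?D\<^esub> ?z i)) = dih_reduce n (h g) \<otimes>\<^bsub>?D\<^esub> ?z (\<epsilon> * i + \<rho> g)"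
      by (simp add: mult_dihedral[of n g] dih_reduce_eq_iff flip: dih_reduce_mult)
  qed
  have "regular_map M"
  proof (rule regular_mapI[OF maps_arcs[OF f(1)]])
    show "dih_reduce n (f \<one>\<^bsub>?D\<^esub>) = \<one>\<^bsub>?D\<^esub>" "\<pi> \<one>\<^bsub>?D\<^esub> = 1"
      using f(2,3) by (simp_all add: one_dihedral flip: dih_reduce_eq_iff)
  qed
  moreover have "\<exists>h. rev_iso M M h" using maps_arcs_rev_iso[OF maps_arcs[OF f']] by blast
  ultimately show ?thesis
    using cycle(1) data
    by (simp add: reflexible_regular_CM_cycle_def reflexible_regular_CM_def reflexible_regular_map_def)
qed

context cyclic_generators
begin

lemma arc_map_residues:
  assumes cong: "\<And>g h. g \<approx> h \<Longrightarrow> f g \<approx> f h"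
    and step: "\<And>g i. i \<in> {0..<d} \<Longrightarrow> f (g \<cdot> x i) \<approx> f g \<cdot> x (\<epsilon> * i + \<pi> g)"
  shows "arc_map \<epsilon> f \<pi>"
  unfolding arc_map_def
proof (intro conjI allI impI cong)
  fix g i
  have "f (g \<cdot> x i) \<approx> f (g \<cdot> x (i mod d))" by (intro cong dih_cong_mult x_cong) simp_all
  also have "\<dots> \<approx> f g \<cdot> x (\<epsilon> * (i mod d) + \<pi> g)" using d_pos by (intro step) simp
  also have "\<dots> \<approx> f g \<cdot> x (\<epsilon> * i + \<pi> g)"
  proof (intro dih_cong_mult dih_cong_refl x_cong)
    have "d dvd i mod d - i" by (simp flip: mod_eq_dvd_iff)
    then show "d dvd \<epsilon> * (i mod d) + \<pi> g - (\<epsilon> * i + \<pi> g)" by algebra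
  qed
  finally show "f (g \<cdot> x i) \<approx> f g \<cdot> x (\<epsilon> * i + \<pi> g)" .
qed

lemma arc_map_affine:
  assumes "\<forall>i\<in>{0..<d}. dih_affine \<beta> c (x i) \<approx> x (\<epsilon> * i + k)"
  shows "arc_map \<epsilon> (dih_affine \<beta> c) (\<lambda>_. k)"
  by (rule arc_map_residues) (use assms in \<open>auto simp: dih_affine_mult intro: dih_affine_cong dih_cong_mult\<close>)

text \<open>
  The automorphism \<open>a\<^sup>jb\<^sup>e \<mapsto> a\<^sup>-\<^sup>jT\<close>, where \<open>T\<close> depends only on \<open>e\<close> and on \<open>j\<close> modulo \<open>m\<close>, inverts the
  subgroup generated by \<open>a\<^sup>m\<close> and is determined by its values on finitely many cosets.
\<close>

lemma arc_map_coset_table: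
  assumes m: "0 < m" "m dvd n" and R: "\<forall>i\<in>{0..<d}. m dvd s i - R i"
    and table: "\<forall>i\<in>{0..<d}. \<forall>r\<in>{0..<m}. \<forall>e.
      (if e then s i else - s i, False) \<cdot> T ((if e then r - R i else r + R i) mod m) (e \<noteq> is_ref i) \<approx>
      T r e \<cdot> x (i + J r e)"
  shows "arc_map 1 (\<lambda>g. (- fst g, False) \<cdot> T (fst g mod m) (snd g)) (\<lambda>g. J (fst g mod m) (snd g))"
    (is "arc_map 1 ?f ?\<pi>")
proof (rule arc_map_residues)
  show "?f g \<approx> ?f h" if "g \<approx> h" for g h
  proof -
    have "fst g mod m = fst h mod m"
      using that m(2) by (auto simp: dih_cong_def mod_eq_dvd_iff intro: dvd_trans)
    moreover have "(- fst g, False) \<approx> (- fst h, False)" "snd g = snd h"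
      using that by (simp_all add: dih_cong_def dvd_diff_commute)
    ultimately show ?thesis by (simp add: dih_cong_mult)
  qed
  fix g :: "int \<times> bool" and i assume i: "i \<in> {0..<d}"
  define r where "r = fst g mod m"
  let ?r' = "(if snd g then r - R i else r + R i) mod m" and ?c = "if snd g then s i else - s i"
  have "s i mod m = R i mod m" using R i by (simp add: mod_eq_dvd_iff)
  then have "(fst g + s i) mod m = (r + R i) mod m" "(fst g - s i) mod m = (r - R i) mod m"
    unfolding r_def by (metis mod_add_cong mod_mod_trivial, metis mod_diff_cong mod_mod_trivial)
  then have "fst (g \<cdot> x i) mod m = ?r'" by (simp add: dih_mult_def)
  then have "?f (g \<cdot> x i) = (- fst g, False) \<cdot> ((?c, False) \<cdot> T ?r' (snd g \<noteq> is_ref i))"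
    by (simp add: dih_mult_def)
  also have "\<dots> \<approx> (- fst g, False) \<cdot> (T r (snd g) \<cdot> x (i + J r (snd g)))"
  proof (intro dih_cong_mult[OF dih_cong_refl])
    have "r \<in> {0..<m}" using m(1) by (simp add: r_def)
    with table i show "(?c, False) \<cdot> T ?r' (snd g \<noteq> is_ref i) \<approx> T r (snd g) \<cdot> x (i + J r (snd g))"
      by blast
  qed
  finally show "?f (g \<cdot> x i) \<approx> ?f g \<cdot> x (1 * i + ?\<pi> g)" by (simp add: dih_mult_assoc r_def)
qed

end

subsection \<open>Reflections only\<close>

text \<open>Modulo \<open>n\<close> this is \<open>1 + l + \<dots> + l\<^sup>i\<^sup>-\<^sup>1\<close> for \<open>l\<^sup>2 = 1\<close>, extended to all integers \<open>i\<close>.\<close>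

definition alt_sum :: "int \<Rightarrow> int \<Rightarrow> int" where
  "alt_sum l i = i div 2 * (1 + l) + i mod 2"

lemma alt_sum_double: "alt_sum l (2 * h) = h * (1 + l)"
  and alt_sum_double_add_one: "alt_sum l (2 * h + 1) = h * (1 + l) + 1"
  by (simp_all add: alt_sum_def)

lemma alt_sum_0_1 [simp]: "alt_sum l 0 = 0" "alt_sum l 1 = 1"
  by (simp_all add: alt_sum_def)

lemma alt_sum_add:
  assumes "n dvd l * l - 1"
  shows "n dvd alt_sum l (i + j) - (alt_sum l j + (if even j then 1 else l) * alt_sum l i)"
proof -
  consider (even_even) h k where "i = 2 * h" "j = 2 * k"
    | (odd_even) h k where "i = 2 * h + 1" "j = 2 * k"
    | (even_odd) h k where "i = 2 * h" "j = 2 * k + 1"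
    | (odd_odd) h k where "i = 2 * h + 1" "j = 2 * k + 1"
    by (metis evenE oddE)
  then show ?thesis
  proof cases
    case even_even
    then have "alt_sum l (i + j) = (h + k) * (1 + l)" using alt_sum_double[of l "h + k"] by simp
    then show ?thesis by (simp add: even_even alt_sum_double) (simp add: algebra_simps)
  next
    case odd_even
    then have "alt_sum l (i + j) = (h + k) * (1 + l) + 1"
      using alt_sum_double_add_one[of l "h + k"] by (simp add: algebra_simps)
    then show ?thesis
      by (simp add: odd_even alt_sum_double alt_sum_double_add_one) (simp add: algebra_simps)
  next
    case even_odd
    then have "alt_sum l (i + j) = (h + k) * (1 + l) + 1"
      using alt_sum_double_add_one[of l "h + k"] by (simp add: algebra_simps)
    moreover have "n dvd (h + k) * (1 + l) + 1 - (k * (1 + l) + 1 + l * (h * (1 + l)))"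
      using assms by algebra
    ultimately show ?thesis by (simp add: even_odd alt_sum_double alt_sum_double_add_one)
  next
    case odd_odd
    then have "alt_sum l (i + j) = (h + k + 1) * (1 + l)"
      using alt_sum_double[of l "h + k + 1"] by (simp add: algebra_simps)
    moreover have "n dvd (h + k + 1) * (1 + l) - (k * (1 + l) + 1 + l * (h * (1 + l) + 1))"
      using assms by algebra
    ultimately show ?thesis by (simp add: odd_odd alt_sum_double_add_one)
  qed
qed

context
  fixes n l :: int
  assumes l: "n dvd l * l - 1"
begin

lemma alt_sum_unit: "n dvd (if even j then 1 else l) * w \<longleftrightarrow> n dvd w"
proof
  show "n dvd w" if "n dvd (if even j then 1 else l) * w"
  proof (cases "even j")
    case False
    then have "n dvd l * w" using that by simp
    then show ?thesis using l by algebra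
  qed (use that in simp)
qed simp

lemma alt_sum_succ: "n dvd alt_sum l (i + 1) - (l * alt_sum l i + 1)"
  using alt_sum_add[OF l, of i 1] by (simp add: algebra_simps)

lemma alt_sum_minus: "n dvd alt_sum l (- i) + l * alt_sum l i"
proof (cases "even i")
  case True
  then obtain h where h: "i = 2 * h" ..
  have "alt_sum l (- i) = - h * (1 + l)" "alt_sum l i = h * (1 + l)"
    using alt_sum_double[of l "- h"] alt_sum_double[of l h] by (simp_all add: h)
  then show ?thesis using l by algebra
next
  case False
  then have "n dvd - alt_sum l i - l * alt_sum l (- i)" using alt_sum_add[OF l, of "- i" i] by simp
  then show ?thesis using l by algebra
qed

lemma alt_sum_diff_iff: "n dvd alt_sum l i - alt_sum l j \<longleftrightarrow> n dvd alt_sum l (i - j)"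
proof -
  let ?w = "(if even j then 1 else l) * alt_sum l (i - j)"
  have diff: "n dvd alt_sum l i - (alt_sum l j + ?w)" using alt_sum_add[OF l, of "i - j" j] by simp
  have "n dvd alt_sum l i - alt_sum l j \<longleftrightarrow> n dvd ?w"
    by (rule iffI) (use diff in algebra)+
  then show ?thesis by (simp only: alt_sum_unit)
qed

lemma alt_sum_geometric: "n dvd alt_sum l (int k) - (\<Sum>i<k. l ^ i)"
proof (induction k)
  case (Suc k)
  have "(\<Sum>i<Suc k. l ^ i) = 1 + l * (\<Sum>i<k. l ^ i)"
    unfolding sum.lessThan_Suc_shift by (simp add: sum_distrib_left)
  moreover have "n dvd l * (alt_sum l (int k) - (\<Sum>i<k. l ^ i)) + (alt_sum l (int k + 1) - (l * alt_sum l (int k) + 1))"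
    by (intro dvd_add dvd_mult Suc alt_sum_succ)
  ultimately show ?case by (simp add: algebra_simps)
qed simp

end

lemma alt_sum_zero_iff:
  assumes l: "int n dvd l * l - 1" and least: "least_geom_sum_zero n l d"
  shows "int n dvd alt_sum l i \<longleftrightarrow> int d dvd i"
proof -
  have geom: "[(\<Sum>i<k. l ^ i) = 0] (mod int n) \<longleftrightarrow> int n dvd alt_sum l (int k)" for k
    using alt_sum_geometric[OF l, of k] unfolding cong_0_iff
    by (metis diff_add_cancel dvd_add_right_iff)
  have d: "0 < d" "int n dvd alt_sum l (int d)" "\<And>k. 0 < k \<Longrightarrow> k < d \<Longrightarrow> \<not> int n dvd alt_sum l (int k)"
    using least unfolding least_geom_sum_zero_def geom by auto
  obtain k where k: "0 < k" "\<And>i. int n dvd alt_sum l i \<longleftrightarrow> k dvd i"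
  proof (rule int_subgroup_eq_multiples[where N = "\<lambda>i. int n dvd alt_sum l i" and n = "int d"])
    show "int n dvd alt_sum l (- i)" if "int n dvd alt_sum l i" for i
      using alt_sum_minus[OF l, of i] that by algebra
    show "int n dvd alt_sum l (i + j)" if "int n dvd alt_sum l i" "int n dvd alt_sum l j" for i j
      using alt_sum_add[OF l, of i j] that by algebra
  qed (use d in auto)
  have "k dvd int d" using d(2) k(2) by blast
  then have "k \<le> int d" using d(1) by (simp add: zdvd_imp_le)
  moreover have "\<not> k < int d" using d(3)[of "nat k"] k by (auto simp: nat_less_iff)
  ultimately show ?thesis using k(2) by simp
qed

lemma reflexible_regular_cyc1:
  assumes n: "0 < n" and l: "[l\<^sup>2 = 1] (mod int n)" and least: "least_geom_sum_zero n l d"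
  shows "reflexible_regular_CM_cycle (dihedral n) (cyc1 n l d)"
proof -
  have l: "int n dvd l * l - 1" using l by (simp add: cong_iff_dvd_diff power2_eq_square)
  define y where "y i = (alt_sum l i, True)" for i
  have len: "length (cyc1 n l d) = d" by (simp add: cyc1_def)
  interpret cyclic_generators "int n" "int (length (cyc1 n l d))" y "\<lambda>i. i"
  proof
    show "0 < int (length (cyc1 n l d))" using least by (simp add: len least_geom_sum_zero_def)
    show "dih_cong (int n) (y i) (y j) \<longleftrightarrow> int (length (cyc1 n l d)) dvd i - j" for i j
      by (simp add: y_def alt_sum_diff_iff[OF l] alt_sum_zero_iff[OF l least] len)
    show "Q g" if "Q (0, False)" and step: "\<And>g i. Q g \<Longrightarrow> Q (g \<cdot> y i)" for Q g
    proof (induction g rule: dihedral_induct)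
      case (reflection g)
      then show ?case using step[of g 0] by (simp add: y_def)
    next
      case (rotation g)
      then have "Q (g \<cdot> y 1 \<cdot> y 0)" by (intro step)
      then show ?case by (simp add: y_def dih_mult_assoc)
    qed (rule that(1))
  qed (use n in \<open>simp_all add: y_def\<close>)
  show ?thesis
  proof (rule reflexible_regular_CM_cycleI)
    show "cyclic_generators (int n) (int (length (cyc1 n l d))) y (\<lambda>i. i)" by unfold_locales
    show "cyc1 n l d ! k = dih_reduce n (y (int k))" if "k < length (cyc1 n l d)" for k
      using that alt_sum_geometric[OF l, of k] n
      by (simp add: len cyc1_def apow_b_conv_dih_reduce dih_reduce_eq_iff y_def dvd_diff_commute)
    show "arc_map 1 (dih_affine l 1) (\<lambda>_. 1)"
      using alt_sum_succ[OF l] by (intro arc_map_affine) (simp add: y_def dvd_diff_commute)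
    show "arc_map (- 1) (dih_affine (- l) 0) (\<lambda>_. 0)"
      using alt_sum_minus[OF l] by (intro arc_map_affine) (simp add: y_def dvd_diff_commute)
  qed (simp_all add: y_def)
qed

subsection \<open>Alternating reflections and rotations\<close>

definition alternating_rotation :: "int \<Rightarrow> int \<times> bool \<Rightarrow> int \<times> bool" where
  "alternating_rotation \<rho> g =
     (if even (fst g) then ((if snd g then 2 * fst g + 1 else 0) - \<rho> * fst g, False)
      else (\<rho> * (fst g + 1) - (if snd g then 2 * fst g + 1 else 0), True))"

definition alternating_turn :: "int \<times> bool \<Rightarrow> int" where
  "alternating_turn g = (if snd g then - 1 - 2 * fst g else 1 + 2 * fst g)"

context
  fixes n :: nat and \<kappa> :: int
  assumes n: "0 < n" "even n" and \<kappa>: "int n dvd 8 * \<kappa>"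
begin

lemma even_if_modulus_dvd: "int n dvd w \<Longrightarrow> even w"
  using n(2) by (meson dvd_trans even_of_nat)

lemma alternating_cong_iff:
  "dih_cong (int n) (alternating (1 + 2 * \<kappa>) i) (alternating (1 + 2 * \<kappa>) j) \<longleftrightarrow> int n dvd i - j"
proof (cases "even i \<and> even j")
  case True
  then obtain h k where hk: "i = 2 * h" "j = 2 * k" by (metis evenE)
  let ?w = "2 * h - 2 * k"
  have "?w = (1 - 2 * \<kappa>) * ((1 + 2 * \<kappa>) * ?w) + 8 * \<kappa> * (\<kappa> * (h - k))" by (simp add: algebra_simps)
  then have "int n dvd ?w" if "int n dvd (1 + 2 * \<kappa>) * ?w"
    using that \<kappa> by (metis dvd_add dvd_mult dvd_mult2)
  then have "int n dvd (1 + 2 * \<kappa>) * ?w \<longleftrightarrow> int n dvd ?w" by auto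
  then show ?thesis by (simp add: hk alternating_def right_diff_distrib)
next
  case False
  then show ?thesis using even_if_modulus_dvd[of "i - j"] by (auto simp: alternating_def)
qed

lemma alternating_generators:
  "cyclic_generators (int n) (int n) (alternating (1 + 2 * \<kappa>)) (\<lambda>i. if even i then i else - i)"
proof
  show "dih_cong (int n) (alternating (1 + 2 * \<kappa>) i \<cdot> alternating (1 + 2 * \<kappa>) (if even i then i else - i)) (0, False)" for i
    by (simp add: alternating_def)
  show "Q g" if "Q (0, False)" and step: "\<And>g i. Q g \<Longrightarrow> Q (g \<cdot> alternating (1 + 2 * \<kappa>) i)" for Q g
  proof (induction g rule: dihedral_induct)
    case (reflection g)
    then show ?case using step[of g 0] by (simp add: alternating_def)
  next
    case (rotation g)
    then show ?case using step[of g 1] by (simp add: alternating_def)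
  qed (rule that(1))
qed (use n alternating_cong_iff in simp_all)

interpretation cyclic_generators "int n" "int n" "alternating (1 + 2 * \<kappa>)" "\<lambda>i. if even i then i else - i"
  by (rule alternating_generators)

lemma arc_map_alternating_rotation: "arc_map 1 (alternating_rotation (1 + 2 * \<kappa>)) alternating_turn"
  unfolding arc_map_def
proof (intro conjI allI impI)
  show "dih_cong (int n) (alternating_rotation (1 + 2 * \<kappa>) g) (alternating_rotation (1 + 2 * \<kappa>) h)"
    if "dih_cong (int n) g h" for g h
  proof -
    have e: "snd g = snd h" and jk: "int n dvd fst g - fst h" using that by (simp_all add: dih_cong_def)
    have "even (fst g) \<longleftrightarrow> even (fst h)" using even_if_modulus_dvd[OF jk] by simp
    moreover have "int n dvd (c * fst g + a - (1 + 2 * \<kappa>) * fst g) - (c * fst h + a - (1 + 2 * \<kappa>) * fst h)"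
      "int n dvd ((1 + 2 * \<kappa>) * (fst g + 1) - (c * fst g + a)) - ((1 + 2 * \<kappa>) * (fst h + 1) - (c * fst h + a))"
      for c a
      using jk by algebra+
    note this[of 0 0] this[of 2 1]
    ultimately show ?thesis by (simp add: e alternating_rotation_def)
  qed
  show "dih_cong (int n) (alternating_rotation (1 + 2 * \<kappa>) (g \<cdot> alternating (1 + 2 * \<kappa>) i))
      (alternating_rotation (1 + 2 * \<kappa>) g \<cdot> alternating (1 + 2 * \<kappa>) (1 * i + alternating_turn g))" for g i
  proof -
    obtain j e where g: "g = (j, e)" by (cases g)
    note defs = g alternating_def alternating_rotation_def alternating_turn_def
    consider (even_even) h k where "j = 2 * h" "i = 2 * k"
      | (odd_even) h k where "j = 2 * h + 1" "i = 2 * k"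
      | (even_odd) h k where "j = 2 * h" "i = 2 * k + 1"
      | (odd_odd) h k where "j = 2 * h + 1" "i = 2 * k + 1"
      by (metis evenE oddE)
    then show ?thesis
    proof cases
      case even_even
      show ?thesis using \<kappa> by (cases e rule: bool.exhaust; simp add: defs even_even; algebra)
    next
      case odd_even
      show ?thesis using \<kappa> by (cases e rule: bool.exhaust; simp add: defs odd_even; algebra)
    next
      case even_odd
      show ?thesis using \<kappa>
        by (cases e rule: bool.exhaust; simp add: defs even_odd; (algebra | simp add: algebra_simps))
    next
      case odd_odd
      show ?thesis using \<kappa>
        by (cases e rule: bool.exhaust; simp add: defs odd_odd; (algebra | simp add: algebra_simps))
    qed
  qed
qed

lemma arc_map_alternating_mirror: "arc_map (- 1) (dih_affine (- 1) 0) (\<lambda>_. 0)"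
  by (rule arc_map_affine) (simp add: alternating_def dih_affine_def)

lemma reflexible_regular_alternating_cycle:
  "reflexible_regular_CM_cycle (dihedral n) (alternating_cycle n (1 + 2 * \<kappa>))"
proof (rule reflexible_regular_CM_cycleI)
  show "cyclic_generators (int n) (int (length (alternating_cycle n (1 + 2 * \<kappa>)))) (alternating (1 + 2 * \<kappa>))
      (\<lambda>i. if even i then i else - i)"
    using alternating_generators by (simp add: alternating_cycle_def)
  show "\<not> dih_cong (int n) (alternating (1 + 2 * \<kappa>) i) (0, False)" for i
    using even_if_modulus_dvd[of i] by (auto simp: alternating_def)
  show "arc_map 1 (alternating_rotation (1 + 2 * \<kappa>)) alternating_turn"
    by (rule arc_map_alternating_rotation)
  show "arc_map (- 1) (dih_affine (- 1) 0) (\<lambda>_. 0)" by (rule arc_map_alternating_mirror)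
qed (simp_all add: alternating_cycle_def alternating_rotation_def alternating_turn_def)

end

lemma reflexible_regular_cyc2: "0 < n \<Longrightarrow> even n \<Longrightarrow> reflexible_regular_CM_cycle (dihedral n) (cyc2 n)"
  using reflexible_regular_alternating_cycle[of n 0] by (simp add: cyc2_eq_alternating_cycle)

lemma reflexible_regular_cyc3:
  assumes "0 < n" "n = 2 * m" "8 dvd n"
  shows "reflexible_regular_CM_cycle (dihedral n) (cyc3 n m)"
proof -
  obtain q where q: "n = 8 * q" using assms(3) by blast
  then have "m = 4 * q" using assms(2) by simp
  then have "cyc3 n m = alternating_cycle n (1 + 2 * int q)"
    by (rule cyc3_eq_alternating_cycle[OF assms(1) q])
  then show ?thesis using reflexible_regular_alternating_cycle[of n "int q"] assms(1) by (simp add: q)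
qed

subsection \<open>The sporadic cycles\<close>

definition cyclic_nth :: "'a list \<Rightarrow> int \<Rightarrow> 'a" where
  "cyclic_nth L i = L ! nat (i mod int (length L))"

lemma cyclic_nth_int [simp]: "k < length L \<Longrightarrow> cyclic_nth L (int k) = L ! k"
  by (simp add: cyclic_nth_def flip: zmod_int)

lemma cyclic_nth_in_set: "L \<noteq> [] \<Longrightarrow> cyclic_nth L i \<in> set L"
  by (simp add: cyclic_nth_def nat_less_iff)

lemma ex_cyclic_nth: "g \<in> set L \<Longrightarrow> \<exists>i. cyclic_nth L i = g"
  by (metis cyclic_nth_int in_set_conv_nth)

lemma cyclic_generators_list:
  assumes "0 < n" and dist: "distinct (map (dih_reduce n) L)"
    and inverse: "\<forall>g\<in>set L. \<exists>h\<in>set L. dih_cong (int n) (g \<cdot> h) (0, False)"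
    and gens: "(0, True) \<in> set L" "(1, False) \<in> set L"
  shows "\<exists>chi. cyclic_generators (int n) (int (length L)) (cyclic_nth L) chi"
proof -
  have L: "L \<noteq> []" using gens by auto
  have "\<exists>j. dih_cong (int n) (cyclic_nth L i \<cdot> cyclic_nth L j) (0, False)" for i
    using inverse cyclic_nth_in_set[OF L] ex_cyclic_nth by metis
  then obtain chi where chi: "\<And>i. dih_cong (int n) (cyclic_nth L i \<cdot> cyclic_nth L (chi i)) (0, False)" by metis
  have "cyclic_generators (int n) (int (length L)) (cyclic_nth L) chi"
  proof
    show "dih_cong (int n) (cyclic_nth L i) (cyclic_nth L j) \<longleftrightarrow> int (length L) dvd i - j" for i j
    proof -
      have less: "nat (i mod int (length L)) < length L" for i using L by (simp add: nat_less_iff)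
      have "dih_cong (int n) (cyclic_nth L i) (cyclic_nth L j) \<longleftrightarrow>
          nat (i mod int (length L)) = nat (j mod int (length L))"
        using nth_eq_iff_index_eq[OF dist, of "nat (i mod int (length L))" "nat (j mod int (length L))"] less
        by (simp add: cyclic_nth_def dih_reduce_eq_iff)
      then show ?thesis using L by (simp add: eq_nat_nat_iff mod_eq_dvd_iff)
    qed
    show "Q g" if "Q (0, False)" and step: "\<And>g i. Q g \<Longrightarrow> Q (g \<cdot> cyclic_nth L i)" for Q g
      by (induction g rule: dihedral_induct) (use that(1) step ex_cyclic_nth[OF gens(1)] ex_cyclic_nth[OF gens(2)] in metis)+
  qed (use assms(1) L chi in simp_all)
  then show ?thesis by blast
qed

lemma reflexible_regular_coset_table:
  fixes T :: "int \<Rightarrow> bool \<Rightarrow> (int \<times> bool) \<times> int"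
  assumes gens: "0 < n" "distinct (map (dih_reduce n) L)"
      "\<forall>g\<in>set L. \<exists>h\<in>set L. dih_cong (int n) (g \<cdot> h) (0, False)" "(0, True) \<in> set L" "(1, False) \<in> set L"
    and neq_one: "\<forall>g\<in>set L. \<not> dih_cong (int n) g (0, False)"
    and m: "0 < m" "m dvd int n" and R: "\<forall>i\<in>{0..<int (length L)}. m dvd fst (cyclic_nth L i) - R i"
    and table: "\<forall>i\<in>{0..<int (length L)}. \<forall>r\<in>{0..<m}. \<forall>e.
      dih_cong (int n)
        ((if e then fst (cyclic_nth L i) else - fst (cyclic_nth L i), False) \<cdot>
          fst (T ((if e then r - R i else r + R i) mod m) (e \<noteq> snd (cyclic_nth L i))))
        (fst (T r e) \<cdot> cyclic_nth L (i + snd (T r e)))"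
    and T_one: "T 0 False = ((0, False), 1)"
    and mirror: "\<forall>i\<in>{0..<int (length L)}. dih_cong (int n) (dih_affine (- 1) \<nu> (cyclic_nth L i)) (cyclic_nth L (1 - i))"
  shows "reflexible_regular_CM_cycle (dihedral n) (map (dih_reduce n) L)"
proof -
  obtain chi where "cyclic_generators (int n) (int (length L)) (cyclic_nth L) chi"
    using cyclic_generators_list[OF gens] by blast
  then interpret cyclic_generators "int n" "int (length L)" "cyclic_nth L" chi .
  have "L \<noteq> []" using gens(4) by auto
  show ?thesis
  proof (rule reflexible_regular_CM_cycleI)
    show "cyclic_generators (int n) (int (length (map (dih_reduce n) L))) (cyclic_nth L) chi"
      by simp unfold_locales
    show "\<not> dih_cong (int n) (cyclic_nth L i) (0, False)" for i
      using neq_one cyclic_nth_in_set[OF \<open>L \<noteq> []\<close>] by blast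
    show "arc_map 1 (\<lambda>g. (- fst g, False) \<cdot> fst (T (fst g mod m) (snd g))) (\<lambda>g. snd (T (fst g mod m) (snd g)))"
      by (rule arc_map_coset_table[OF m R, where T = "\<lambda>r e. fst (T r e)" and J = "\<lambda>r e. snd (T r e)"]) (fact table)
    show "arc_map (- 1) (dih_affine (- 1) \<nu>) (\<lambda>_. 1)" using mirror by (intro arc_map_affine) simp
  qed (simp_all add: T_one)
qed

lemma int_interval_rec: "a < b \<Longrightarrow> {a..<b} = insert a {a + 1..<b}" for a b :: int
  by auto

lemma not_dvd_small: "0 < \<bar>c\<bar> \<Longrightarrow> \<bar>c\<bar> < n \<Longrightarrow> \<not> n dvd c" for c n :: int
  using zdvd_imp_le[of n "\<bar>c\<bar>"] by auto

lemma reflexible_regular_cyc4: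
  assumes "0 < k" "n = 3 * k"
  shows "reflexible_regular_CM_cycle (dihedral n) (cyc4 n)"
proof -
  let ?T = "\<lambda>r e. (if e then [((2, True), 1), ((2, True), 3), ((1, False), 2)]
    else [((0, False), 1), ((1, True), 2), ((0, False), 3)]) ! nat r"
  have "reflexible_regular_CM_cycle (dihedral n) (map (dih_reduce n) cycle4)"
    by (rule reflexible_regular_coset_table[where T = ?T and m = 3 and \<nu> = 2 and R = "\<lambda>i. [2, 1, 0, 2] ! nat i"])
      (use assms in \<open>simp_all add: cycle4_def dih_reduce_eq_iff not_dvd_small cyclic_nth_def
        int_interval_rec all_bool_eq\<close>)
  then show ?thesis using assms by (simp add: cyc4_eq_map_dih_reduce)
qed

lemma reflexible_regular_cyc5:
  assumes "0 < k" "n = 2 * m" "n = 8 * k + 4"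
  shows "reflexible_regular_CM_cycle (dihedral n) (cyc5 n m)"
proof -
  let ?m = "int m"
  have n: "int n = 2 * ?m" "0 < n" "6 \<le> ?m" using assms by simp_all
  have mod_4: "4 dvd ?m - 2" "4 dvd ?m + 2" "4 dvd int n" using assms by presburger+
  let ?T = "\<lambda>r e. (if e then [((?m + 1, False), 2), ((?m + 2, True), 1), ((?m + 2, True), 5), ((1, False), 4)]
    else [((0, False), 1), ((1, True), 2), ((?m + 1, True), 4), ((0, False), 5)]) ! nat r"
  have "reflexible_regular_CM_cycle (dihedral n) (map (dih_reduce n) (cycle5 ?m))"
    by (rule reflexible_regular_coset_table[where T = ?T and m = 4 and \<nu> = "?m + 2" and R = "\<lambda>i. [3, 1, 0, 3, 1, 0] ! nat i"])
      (use n mod_4 in \<open>simp_all add: cycle5_def dih_reduce_eq_iff not_dvd_small cyclic_nth_def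
        int_interval_rec all_bool_eq\<close>)
  then show ?thesis using assms(3) by (simp add: cyc5_eq_map_dih_reduce)
qed

lemma reflexible_regular_cyc6:
  assumes "0 < k" "n = 2 * m" "n = 4 * k + 2"
  shows "reflexible_regular_CM_cycle (dihedral n) (cyc6 n m)"
proof -
  let ?m = "int m"
  have n: "int n = 2 * ?m" "0 < n" "3 \<le> ?m" and odd_m: "odd ?m" using assms by presburger+
  let ?T = "\<lambda>r e. (if e then [((?m - 2, True), 1), ((?m - 1, False), 4)]
    else [((0, False), 1), ((- 1, True), 4)]) ! nat r"
  have "reflexible_regular_CM_cycle (dihedral n) (map (dih_reduce n) (cycle6 ?m))"
    by (rule reflexible_regular_coset_table[where T = ?T and m = 2 and \<nu> = "?m - 2" and R = "\<lambda>i. [0, 1, 1, 0, 1, 1] ! nat i"])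
      (use n odd_m in \<open>simp_all add: cycle6_def dih_reduce_eq_iff not_dvd_small cyclic_nth_def
        int_interval_rec all_bool_eq\<close>)
  then show ?thesis using assms(3) by (simp add: cyc6_eq_map_dih_reduce)
qed

theorem theorem1p1:
  fixes n :: nat
  assumes "n \<ge> 2"
  shows
    "(\<forall>X p d. reflexible_regular_CM (dihedral n) X p \<and> d = card X \<longrightarrow>
        (d = 2 \<longrightarrow> CM (dihedral n) X p \<simeq>\<^sub>m CM_cycle (dihedral n) [apow_b n 0, apow_b n 1]) \<and>
        (d = 3 \<longrightarrow>
           CM (dihedral n) X p \<simeq>\<^sub>m CM_cycle (dihedral 2) [apow_b 2 0, apow_b 2 1, apow 2 1] \<or>
           CM (dihedral n) X p \<simeq>\<^sub>m CM_cycle (dihedral 3) [apow_b 3 0, apow_b 3 1, apow_b 3 2] \<or>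
           CM (dihedral n) X p \<simeq>\<^sub>m CM_cycle (dihedral 4) [apow_b 4 0, apow 4 1, apow 4 (- 1)]) \<and>
        (d \<ge> 4 \<longrightarrow>
           (\<exists>l::int. [l\<^sup>2 = 1] (mod int n) \<and> least_geom_sum_zero n l d \<and>
              CM (dihedral n) X p \<simeq>\<^sub>m CM_cycle (dihedral n) (cyc1 n l d)) \<or>
           (even n \<and> CM (dihedral n) X p \<simeq>\<^sub>m CM_cycle (dihedral n) (cyc2 n)) \<or>
           (\<exists>m. n = 2 * m \<and> 8 dvd n \<and>
              CM (dihedral n) X p \<simeq>\<^sub>m CM_cycle (dihedral n) (cyc3 n m)) \<or>
           (\<exists>k>0. n = 3 * k \<and>
              CM (dihedral n) X p \<simeq>\<^sub>m CM_cycle (dihedral n) (cyc4 n)) \<or>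
           (\<exists>m. \<exists>k>0. n = 2 * m \<and> n = 8 * k + 4 \<and>
              CM (dihedral n) X p \<simeq>\<^sub>m CM_cycle (dihedral n) (cyc5 n m)) \<or>
           (\<exists>m. \<exists>k>0. n = 2 * m \<and> n = 4 * k + 2 \<and>
              CM (dihedral n) X p \<simeq>\<^sub>m CM_cycle (dihedral n) (cyc6 n m)))) \<and>
     (\<forall>(l::int) d. [l\<^sup>2 = 1] (mod int n) \<and> least_geom_sum_zero n l d \<longrightarrow>
        reflexible_regular_CM_cycle (dihedral n) (cyc1 n l d)) \<and>
     (even n \<longrightarrow> reflexible_regular_CM_cycle (dihedral n) (cyc2 n)) \<and>
     (\<forall>m. n = 2 * m \<and> 8 dvd n \<longrightarrow> reflexible_regular_CM_cycle (dihedral n) (cyc3 n m)) \<and>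
     (\<forall>k>0. n = 3 * k \<longrightarrow> reflexible_regular_CM_cycle (dihedral n) (cyc4 n)) \<and>
     (\<forall>m. \<forall>k>0. n = 2 * m \<and> n = 8 * k + 4 \<longrightarrow>
        reflexible_regular_CM_cycle (dihedral n) (cyc5 n m)) \<and>
     (\<forall>m. \<forall>k>0. n = 2 * m \<and> n = 4 * k + 2 \<longrightarrow>
        reflexible_regular_CM_cycle (dihedral n) (cyc6 n m))"
proof -
  have n: "0 < n" using assms by simp
  show ?thesis
  proof (intro conjI allI impI, goal_cases valency_2 valency_3 valency_ge_4 cyc1 cyc2 cyc3 cyc4 cyc5 cyc6)
    case (valency_2 X p d)
    then show ?case by (auto elim!: reflexible_regular_CM_dihedral_cases simp: cyc1_two[OF n])
  next
    case (valency_3 X p d)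
    then show ?case
      by (auto elim!: reflexible_regular_CM_dihedral_cases simp: CM_cycle_cyc1_three[OF assms])
  next
    case (valency_ge_4 X p d)
    then have "reflexible_regular_CM (dihedral n) X p" "d = card X" "d \<ge> 4" by simp_all
    then show ?case by (cases rule: reflexible_regular_CM_dihedral_cases[consumes 1]) auto
  qed ((elim conjE)?; rule reflexible_regular_cyc1[OF n] reflexible_regular_cyc2[OF n] reflexible_regular_cyc3[OF n]
      reflexible_regular_cyc4 reflexible_regular_cyc5 reflexible_regular_cyc6; assumption)+
qed

end
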